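(* Let $f_n^{(p,q)}$ be the number of $n$-TITOs avoiding both $p$ and $q$, and let $\mathcal{F}^{(p,q)}(x)=\sum_{n\ge 0} f_n^{(p,q)}x^n$ be its ordinary generating function. For $q\in S_4$ and every positive integer $n$, the number $f_n^{(312,q)}$ of $n$-TITOs avoiding both $312$ and $q$, together with $\mathcal{F}^{(312,q)}(x)$, is given by the following table: (a) $q=1234$: $\mathcal{F}^{(312,q)}(x)=\frac{x}{1-x}$ and $f_n^{(312,q)}=1$; (b) $q=1243$: $\mathcal{F}^{(312,q)}(x)=\frac{2x}{1-x}$ and $f_n^{(312,q)}=2$; (c) $q=4321$: $\mathcal{F}^{(312,q)}(x)=\frac{x(2x^2-2x+1)}{(1-2x)(1-3x+x^2)}$ and $f_n^{(312,q)}=\left(\frac{3+\sqrt5}{2}\right)^n+\left(\frac{3-\sqrt5}{2}\right)^n-2^n$; (d) $q\in\{3421,2431\}$: $\mathcal{F}^{(312,q)}(x)=\frac{x(2-8x+11x^2-4x^3)}{(1-x)(1-2x)(1-3x+x^2)}$ and $f_n^{(312,q)}=\left(\frac{3+\sqrt5}{2}\right)^n+\left(\frac{3-\sqrt5}{2}\right)^n-2^n+1$; (e) $q\in\{3241,3214,2314\}$: $\mathcal{F}^{(312,q)}(x)=\frac{-x(x^2-2x+2)}{(x-1)(x^2-3x+1)}$ and $f_n^{(312,q)}=\left(\frac{3+\sqrt5}{2}\right)^n+\left(\frac{3-\sqrt5}{2}\right)^n-1$; (f) $q=2341$: $\mathcal{F}^{(312,q)}(x)=\frac{x(3x^3-9x^2+6x-2)}{(1-x)(3x^3-5x^2+4x-1)}$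 and $f_n^{(312,q)}=-2+\lambda_1^n+\lambda_2^n+\lambda_3^n$, where $\lambda_1=\frac{1}{\alpha}$, $\lambda_2=\frac{1}{\beta}$, $\lambda_3=\frac{1}{\overline{\beta}}$ and $\alpha,\beta,\overline{\beta}$ are the roots of $3x^3-5x^2+4x-1$; (g) $q\in\{2134,2143,1324,1432,1342\}$: $\mathcal{F}^{(312,q)}(x)=\frac{2x}{1-2x}$ and $f_n^{(312,q)}=2^n$. Together with the symmetries $f_n^{(p,q)}=f_n^{(r(p),r(q))}=f_n^{(c(p),c(q))}$, where $r$ is reversal and $c$ is complementation of patterns, this determines $f_n^{(p,q)}$ for every $p\in S_3\setminus\{123,321\}$ and every $q\in S_4$.
   Context: For a positive integer $n$, a translation-invariant total order with period $n$ ($n$-TITO) is a total order $\preceq$ of $\mathbb{Z}$ such that for all $a,b\in\mathbb{Z}$, $a\preceq b$ if and only if $a+n\preceq b+n$. An $n$-TITO $\preceq$ avoids a pattern $p=p_1\cdots p_k\in S_k$ (one-line notation) if there are no integers $i_1<\cdots<i_k$ with $i_{p_1}\preceq i_{p_2}\preceq\cdots\preceq i_{p_k}$. For instance, integers $a<b<c$ form a $312$-pattern if $c\preceq a\preceq b$. For $p\in S_k$, the reverse is $r(p)=p_k\cdots p_1$ and the complement is $c(p)=(k+1-p_1)\cdots(k+1-p_k)$; the symmetries come from reversing the order $\preceq$ and from the map $x\mapsto -x$ on $\mathbb{Z}$, respectively. Convention: $f_0^{(p,q)}=0$. *)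

theory Defs
  imports
    Complex_Main
    "HOL-Library.Sublist"
    "HOL-Combinatorics.Multiset_Permutations"
    "HOL-Computational_Algebra.Formal_Power_Series"
begin

text \<open>
  A total order \<open>\<preceq>\<close> on the integers is represented by its graph \<open>{(a, b). a \<preceq> b}\<close>.
\<close>

definition tito :: "nat \<Rightarrow> int rel \<Rightarrow> bool" where
  "tito n r \<longleftrightarrow> n > 0 \<and> linear_order r \<and>
     (\<forall>a b. (a, b) \<in> r \<longleftrightarrow> (a + int n, b + int n) \<in> r)"

text \<open>
  A pattern in \<open>S\<^sub>k\<close> is given in one-line notation, as a list in \<open>permutations_of_set {1..k}\<close>.
\<close>

definition contains_pattern :: "int rel \<Rightarrow> nat list \<Rightarrow> bool" where
  "contains_pattern r p \<longleftrightarrow>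
     (\<exists>i :: nat \<Rightarrow> int. strict_mono_on {1..length p} i \<and>
        successively (\<lambda>a b. (a, b) \<in> r) (map i p))"

definition avoiding_titos :: "nat list set \<Rightarrow> nat \<Rightarrow> int rel set" where
  "avoiding_titos P n = {r. tito n r \<and> (\<forall>p\<in>P. \<not> contains_pattern r p)}"

definition num_avoiding :: "nat list set \<Rightarrow> nat \<Rightarrow> nat" where
  "num_avoiding P n = (if n = 0 then 0 else card (avoiding_titos P n))"

definition gf_avoiding :: "nat list set \<Rightarrow> real fps" where
  "gf_avoiding P = Abs_fps (\<lambda>n. of_nat (num_avoiding P n))"

definition compl_pattern :: "nat list \<Rightarrow> nat list" where
  "compl_pattern p = map (\<lambda>j. length p + 1 - j) p"

text \<open>
  Containment of one permutation in another: some subsequence of \<open>q\<close> is order-isomorphic to \<open>p\<close>.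
\<close>

definition perm_contains :: "nat list \<Rightarrow> nat list \<Rightarrow> bool" where
  "perm_contains q p \<longleftrightarrow>
     (\<exists>i :: nat \<Rightarrow> nat. strict_mono_on {1..length p} i \<and> subseq (map i p) q)"

definition tabulated_patterns :: "nat list set" where
  "tabulated_patterns =
     {[1,2,3,4], [1,2,4,3], [4,3,2,1], [3,4,2,1], [2,4,3,1], [3,2,4,1], [3,2,1,4],
      [2,3,1,4], [2,3,4,1], [2,1,3,4], [2,1,4,3], [1,3,2,4], [1,4,3,2], [1,3,4,2]}"

end

theory Submission
  imports Defs "HOL-Library.Extended_Nat"
begin

text \<open>
  In an order that avoids 312, the integers larger than \<open>a\<close> that precede \<open>a\<close> form an interval
  immediately above \<open>a\<close>: if \<open>c\<close> precedes \<open>a\<close> and \<open>a < b < c\<close>, then \<open>b\<close> cannot follow \<open>a\<close>. So the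
  order is described by the lengths \<open>h a \<in> \<nat> \<union> {\<infinity>}\<close> of these intervals. Translation invariance of
  the order is periodicity of \<open>h\<close>, and transitivity says that the intervals are nested
  (\<open>avoider_312_code\<close>, \<open>num_avoiding_312\<close>). A finite length is smaller than \<open>n\<close>, so there are only
  finitely many such words.

  For each \<open>q\<close> in the table, avoidance of \<open>q\<close> becomes a condition on the position of the letters
  \<open>\<infinity>\<close> and \<open>0\<close> and on the interior \<open>(a, a + h a]\<close> of each finite interval, because translating by
  multiples of \<open>n\<close> supplies copies of any letter arbitrarily far to the left and to the right. In
  particular a pattern \<open>q\<close> ending in 1 restricts the interiors exactly by the pattern that remains
  when this 1 is deleted. The restriction on \<open>\<infinity>\<close> often comes out as all or nothing: either all letters
  are infinite, which gives the reversed integers, or none is. (See \<open>avoids_1234\<close> up to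
  \<open>avoids_2341\<close>.)

  The interior of a finite interval is itself a finite nested word, hence a binary tree, and the
  pattern conditions are recursive conditions on trees. For 312 together with a second
  pattern of length 3, counting them gives the Simion-Schmidt numbers: \<open>2 ^ (k - 1)\<close>, or
  \<open>(k choose 2) + 1\<close> for the second pattern 123.

  The maximal finite intervals and the single letters \<open>\<infinity>\<close> outside them tile the integers
  periodically. If \<open>W\<close> is the generating function of the tiles by length, then cutting a tiling of
  period \<open>n\<close> at the tile that contains 0 shows that the tilings have the generating function
  \<open>x W' / (1 - W)\<close> (\<open>tilings_gf\<close>, \<open>interior_codes_tilings\<close>). Only constant words survive for 1234
  and 1243. The other rational functions of the table come from this formula, for 3241 as the sum of
  two instances, with a correction for a constant word that is missed or counted twice. The closed
  forms are their partial fractions.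

  The symmetries are the converse relation and the reflection \<open>x \<mapsto> -x\<close>. The patterns \<open>q\<close> outside
  the table contain 312, so that avoiding \<open>q\<close> is no further restriction.
\<close>

section \<open>Periodic words cut into blocks\<close>

definition periodic :: "nat \<Rightarrow> (int \<Rightarrow> 'a) \<Rightarrow> bool" where
  "periodic n h \<longleftrightarrow> (\<forall>x. h (x + int n) = h x)"

definition window :: "(int \<Rightarrow> 'a) \<Rightarrow> int \<Rightarrow> nat \<Rightarrow> 'a list" where
  "window h x k = map (\<lambda>i. h (x + int i)) [0..<k]"

definition periodic_extension :: "'a list \<Rightarrow> int \<Rightarrow> int \<Rightarrow> 'a" where
  "periodic_extension w x0 = (\<lambda>x. w ! nat ((x - x0) mod int (length w)))"

lemma periodic_shift:
  assumes "periodic n h"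
  shows "h (x + i * int n) = h x"
proof (induction i rule: int_induct[where k = 0])
  case (step1 i)
  have "h (x + (i + 1) * int n) = h ((x + i * int n) + int n)" by (simp add: algebra_simps)
  then show ?case using assms step1 by (simp add: periodic_def)
next
  case (step2 i)
  have "h (x + i * int n) = h ((x + (i - 1) * int n) + int n)" by (simp add: algebra_simps)
  then show ?case using assms step2 by (simp add: periodic_def)
qed simp

lemma length_window [simp]: "length (window h x k) = k"
  by (simp add: window_def)

lemma nth_window [simp]: "i < k \<Longrightarrow> window h x k ! i = h (x + int i)"
  by (simp add: window_def)

lemma window_append: "window h x (k + l) = window h x k @ window h (x + int k) l"
  by (rule nth_equalityI) (auto simp: nth_append)

lemma window_Suc: "window h x (Suc k) = h x # window h (x + 1) k"
  by (rule nth_equalityI) (auto simp: nth_Cons ac_simps split: nat.split)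

lemma window_0 [simp]: "window h x 0 = []"
  by (simp add: window_def)

lemma window_shift: "periodic n h \<Longrightarrow> window h (x + i * int n) k = window h x k"
  using periodic_shift[of n h "x + int _" i] by (auto simp: window_def algebra_simps)

lemma periodic_periodic_extension: "periodic (length w) (periodic_extension w x0)"
  by (simp add: periodic_def periodic_extension_def add_diff_eq[symmetric] add.commute)
     (metis add.commute add_diff_eq mod_add_self2)

lemma window_periodic_extension: "window (periodic_extension w x0) x0 (length w) = w"
  by (rule nth_equalityI) (auto simp: periodic_extension_def)

lemma periodic_extension_window:
  assumes "periodic n h" "n > 0"
  shows "periodic_extension (window h x0 n) x0 = h"
proof
  fix x
  let ?i = "(x - x0) mod int n"
  have i: "0 \<le> ?i" "?i < int n" using assms by auto
  have "x = (x0 + ?i) + ((x - x0) div int n) * int n"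
    by (simp add: algebra_simps)
  then have "h x = h (x0 + ?i)" using periodic_shift[OF assms(1)] by metis
  then show "periodic_extension (window h x0 n) x0 x = h x"
    using i by (simp add: periodic_extension_def nat_less_iff)
qed

text \<open>
  The first letter of a block determines how long the block is, and no letter of a block announces
  something that would reach beyond the end of the block. The first property makes concatenations of
  blocks uniquely decodable from the left, the second makes the boundaries of a bi-infinite word
  recoverable: they are the positions that no earlier letter reaches across.
\<close>

locale block_code =
  fixes len :: "'a \<Rightarrow> nat" and B :: "'a list set"
  assumes block_nonempty: "u \<in> B \<Longrightarrow> u \<noteq> []"
    and len_hd: "u \<in> B \<Longrightarrow> len (hd u) = length u"
    and len_within: "u \<in> B \<Longrightarrow> i < length u \<Longrightarrow> i + len (u ! i) \<le> length u"
    and finite_blocks: "finite {u \<in> B. length u = m}"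
begin

definition starts :: "(int \<Rightarrow> 'a) \<Rightarrow> int set" where
  "starts h = {x. \<forall>y<x. y + int (len (h y)) \<le> x}"

definition tilings :: "nat \<Rightarrow> (int \<Rightarrow> 'a) set" where
  "tilings n = {h. periodic n h \<and> starts h \<noteq> {} \<and> (\<forall>x\<in>starts h. window h x (len (h x)) \<in> B)}"

definition blocks :: "nat \<Rightarrow> 'a list set" where
  "blocks m = {u \<in> B. length u = m}"

definition sequences :: "nat \<Rightarrow> 'a list set" where
  "sequences k = {concat us |us. us \<in> lists B \<and> length (concat us) = k}"

lemma before_start: "x \<in> starts h \<Longrightarrow> y < x \<Longrightarrow> y + int (len (h y)) \<le> x"
  by (simp add: starts_def)

lemma window_block:
  assumes "window h x (length u) = u" "u \<in> B"
  shows "len (h x) = length u"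
proof -
  have "hd (window h x (length u)) = h x"
    using block_nonempty[OF assms(2)] by (cases "length u") (auto simp: window_Suc)
  then show ?thesis using assms len_hd by metis
qed

lemma sequence_within:
  assumes "us \<in> lists B" "i < length (concat us)"
  shows "i + len (concat us ! i) \<le> length (concat us)"
  using assms
proof (induction us arbitrary: i rule: list.induct)
  case (Cons u us)
  show ?case
  proof (cases "i < length u")
    case True
    then show ?thesis using len_within[of u i] Cons.prems by (simp add: nth_append)
  next
    case False
    then show ?thesis using Cons.IH[of "i - length u"] Cons.prems by (simp add: nth_append) linarith
  qed
qed simp

lemma starts_shift:
  assumes "periodic n h"
  shows "x + i * int n \<in> starts h \<longleftrightarrow> x \<in> starts h"
proof -
  have *: "x + i * int n \<in> starts h" if "x \<in> starts h" for x i
    unfolding starts_def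
  proof (safe)
    fix y assume "y < x + i * int n"
    then have "(y - i * int n) + int (len (h (y - i * int n))) \<le> x"
      using that by (auto simp: starts_def)
    moreover have "h (y - i * int n) = h y"
      using periodic_shift[OF assms, of y "- i"] by simp
    ultimately show "y + int (len (h y)) \<le> x + i * int n" by simp
  qed
  show ?thesis using *[of x i] *[of "x + i * int n" "-i"] by auto
qed

lemma next_start:
  assumes "h \<in> tilings n" "x \<in> starts h"
  shows "x + int (len (h x)) \<in> starts h" "len (h x) > 0"
proof -
  define u where "u = window h x (len (h x))"
  have u: "u \<in> B" "length u = len (h x)" using assms by (auto simp: tilings_def u_def)
  then show "len (h x) > 0" using block_nonempty[of u] by (cases "len (h x)") auto
  show "x + int (len (h x)) \<in> starts h"
    unfolding starts_def
  proof safe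
    fix y assume y: "y < x + int (len (h x))"
    show "y + int (len (h y)) \<le> x + int (len (h x))"
    proof (cases "y < x")
      case True
      then show ?thesis using assms(2) by (force simp: starts_def)
    next
      case False
      then have "nat (y - x) < length u" using y u by auto
      from len_within[OF u(1) this] show ?thesis using False y u(2) by (auto simp: u_def)
    qed
  qed
qed

text \<open>
  Jumping from a boundary by the length of its letter leads to the next boundary, so the word between
  two boundaries decodes into blocks.
\<close>

lemma window_starts:
  assumes h: "h \<in> tilings n" and "x \<in> starts h" "y \<in> starts h" "x \<le> y"
  shows "window h x (nat (y - x)) \<in> sequences (nat (y - x))"
  using assms(2-)
proof (induction "nat (y - x)" arbitrary: x rule: less_induct)
  case less
  show ?case
  proof (cases "x = y")
    case True
    then show ?thesis by (auto simp: sequences_def intro: exI[of _ "[]"])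
  next
    case False
    let ?m = "len (h x)" let ?x = "x + int ?m"
    have x': "?x \<in> starts h" "?m > 0" using next_start[OF h less.prems(1)] by auto
    have le: "?x \<le> y" using less.prems False by (force simp: starts_def)
    from less.hyps[of ?x] x' le less.prems obtain us where us:
      "us \<in> lists B" "window h ?x (nat (y - ?x)) = concat us"
      by (auto simp: sequences_def)
    have "nat (y - x) = ?m + nat (y - ?x)" using le by auto
    then have "window h x (nat (y - x)) = concat (window h x ?m # us)"
      using us(2) by (simp add: window_append)
    moreover have "window h x ?m \<in> B" using h less.prems by (auto simp: tilings_def)
    ultimately show ?thesis using us(1)
      by (auto simp: sequences_def intro!: exI[of _ "window h x ?m # us"] simp del: concat.simps)
         (metis length_window)
  qed
qed

text \<open>
  If a stretch of \<open>h\<close> is known to be a concatenation of blocks, then \<open>h\<close> cannot have a boundary in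
  the middle of one of these blocks, since the first letter of that block reaches across. Hence every
  boundary in this stretch begins one of the given blocks.
\<close>

lemma start_in_sequence:
  assumes "us \<in> lists B" "window h x (length (concat us)) = concat us"
    "y \<in> starts h" "x \<le> y" "y < x + int (length (concat us))"
  shows "window h y (len (h y)) \<in> B"
  using assms
proof (induction us arbitrary: x rule: list.induct)
  case (Cons u us)
  have w: "window h x (length u) = u" "window h (x + int (length u)) (length (concat us)) = concat us"
    using Cons.prems(2) by (simp_all add: window_append)
  have l: "len (h x) = length u" using window_block w(1) Cons.prems(1) by auto
  show ?case
  proof (cases "x = y")
    case True
    then show ?thesis using w l Cons.prems(1) by auto
  next
    case False
    then have "x + int (length u) \<le> y" using before_start[of y h x] Cons.prems(3,4) l by simp
    then show ?thesis using Cons.IH[of "x + int (length u)"] Cons.prems w by auto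
  qed
qed simp

text \<open>
  Repeating a sequence of blocks periodically creates no new boundaries and destroys none: letters of
  earlier copies reach at most to the end of their copy.
\<close>

lemma periodic_extension_tiling:
  assumes us: "us \<in> lists B" and ne: "concat us \<noteq> []"
  shows "periodic_extension (concat us) x0 \<in> tilings (length (concat us))"
    and "x0 \<in> starts (periodic_extension (concat us) x0)"
proof -
  define w h n where "w = concat us" and "h = periodic_extension w x0" and "n = length w"
  have n: "n > 0" using ne by (auto simp: n_def w_def)
  have per: "periodic n h" unfolding n_def h_def by (rule periodic_periodic_extension)
  have win: "window h x0 n = w" unfolding n_def h_def by (rule window_periodic_extension)
  have st: "x0 \<in> starts h"
    unfolding starts_def
  proof safe
    fix y assume y: "y < x0"
    let ?i = "(y - x0) mod int n"
    have i: "0 \<le> ?i" "?i < int n" using n by auto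
    have "nat ?i + len (w ! nat ?i) \<le> n"
      using sequence_within[OF us, of "nat ?i"] i by (auto simp: w_def n_def nat_less_iff)
    moreover have "h y = w ! nat ?i" by (simp add: h_def periodic_extension_def n_def)
    ultimately have 1: "?i + int (len (h y)) \<le> int n" using i by auto
    have 2: "y - x0 = ?i + ((y - x0) div int n) * int n" by (simp add: algebra_simps)
    have "(y - x0) div int n \<le> -1" using y n using div_neg_pos_less0[of "y - x0" "int n"] by simp
    then have "((y - x0) div int n) * int n \<le> - int n" using n
      by (metis mult_minus1 mult_right_mono of_nat_0_le_iff)
    then show "y + int (len (h y)) \<le> x0" using 1 2 by linarith
  qed
  have "window h y (len (h y)) \<in> B" if y: "y \<in> starts h" for y
  proof -
    let ?i = "(y - x0) mod int n" let ?q = "(y - x0) div int n"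
    have i: "0 \<le> ?i" "?i < int n" using n by auto
    have e: "y = (x0 + ?i) + ?q * int n" by (simp add: algebra_simps)
    have s: "x0 + ?i \<in> starts h" using y starts_shift[OF per] e by metis
    have "window h (x0 + ?i) (len (h (x0 + ?i))) \<in> B"
      by (rule start_in_sequence[OF us _ s]) (use i win in \<open>auto simp: n_def w_def\<close>)
    then show ?thesis using window_shift[OF per] periodic_shift[OF per] e by metis
  qed
  then show "periodic_extension (concat us) x0 \<in> tilings (length (concat us))"
    "x0 \<in> starts (periodic_extension (concat us) x0)"
    using per st unfolding tilings_def h_def n_def w_def by auto
qed

lemma exists_tile:
  assumes n: "n > 0" and h: "h \<in> tilings n"
  shows "\<exists>x\<in>starts h. x \<le> a \<and> a < x + int (len (h x))"
proof -
  have per: "periodic n h" using h by (simp add: tilings_def)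
  obtain x1 where "x1 \<in> starts h" using h by (auto simp: tilings_def)
  then have "x1 + (- \<bar>x1 - a\<bar>) * int n \<in> starts h" using starts_shift[OF per] by blast
  moreover have "x1 + (- \<bar>x1 - a\<bar>) * int n \<le> a"
  proof -
    have "\<bar>x1 - a\<bar> * 1 \<le> \<bar>x1 - a\<bar> * int n" using n by (intro mult_left_mono) auto
    then show ?thesis by auto
  qed
  ultimately obtain x2 where x2: "x2 \<in> starts h" "x2 \<le> a" by blast
  \<comment> \<open>the last boundary at or before a; its tile reaches beyond a, since otherwise the next boundary would be closer\<close>
  define j where "j = (LEAST j. a - int j \<in> starts h)"
  have ex: "a - int (nat (a - x2)) \<in> starts h" using x2 by simp
  have j: "a - int j \<in> starts h" unfolding j_def by (rule LeastI, rule ex)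
  have jmin: "j \<le> i" if "a - int i \<in> starts h" for i unfolding j_def by (rule Least_le, rule that)
  define m where "m = len (h (a - int j))"
  have m: "a - int j + int m \<in> starts h" "m > 0" using next_start[OF h j] by (auto simp: m_def)
  have "j < m"
  proof (rule ccontr)
    assume "\<not> j < m"
    then have "a - int (j - m) \<in> starts h" using m by (simp add: of_nat_diff algebra_simps)
    then show False using jmin[of "j - m"] m \<open>\<not> j < m\<close> by auto
  qed
  then show ?thesis using j by (intro bexI[of _ "a - int j"]) (auto simp: m_def)
qed

text \<open>
  A periodic tiling is cut at the beginning of the tile \<open>u\<close> that contains 0. What has to be recorded
  is this tile, the offset \<open>j\<close> of 0 in it, and the sequence \<open>v\<close> of the other tiles of one period.
\<close>

lemma bij_betw_tilings:
  assumes n: "n > 0"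
  shows "bij_betw (\<lambda>(m, j, u, v). periodic_extension (u @ v) (- int j))
     (SIGMA m:{1..n}. {0..<m} \<times> blocks m \<times> sequences (n - m)) (tilings n)"
  (is "bij_betw ?f ?D _")
proof (rule bij_betwI')
  have D: "?f (m, j, u, v) \<in> tilings n \<and> - int j \<in> starts (?f (m, j, u, v)) \<and>
      window (?f (m, j, u, v)) (- int j) n = u @ v \<and>
      len (?f (m, j, u, v) (- int j)) = m \<and> length u = m \<and> j < m"
    if "(m, j, u, v) \<in> ?D" for m j u v
  proof -
    from that obtain vs where vs: "vs \<in> lists B" "v = concat vs" "length v = n - m"
      by (auto simp: sequences_def)
    have m: "m \<ge> 1" "m \<le> n" "j < m" using that by auto
    have u: "u \<in> B" "length u = m" using that by (auto simp: blocks_def)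
    have c: "u # vs \<in> lists B" "concat (u # vs) = u @ v" "length (u @ v) = n"
      using vs u m by auto
    have ne: "concat (u # vs) \<noteq> []" using m u by auto
    from periodic_extension_tiling[OF c(1) ne, of "- int j"] c
    have 1: "?f (m, j, u, v) \<in> tilings n" "- int j \<in> starts (?f (m, j, u, v))" by auto
    have 2: "window (?f (m, j, u, v)) (- int j) n = u @ v"
      using window_periodic_extension[of "u @ v"] c by auto
    then have "window (?f (m, j, u, v)) (- int j) (m + (n - m)) = u @ v" using m by simp
    then have "window (?f (m, j, u, v)) (- int j) (length u) = u"
      using u unfolding window_append by simp
    from window_block[OF this u(1)] show ?thesis using 1 2 u m by auto
  qed
  show "?f a \<in> tilings n" if "a \<in> ?D" for a
    using D that by (cases a) auto
  show "(?f a = ?f b) = (a = b)" if "a \<in> ?D" "b \<in> ?D" for a b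
  proof
    assume eq: "?f a = ?f b"
    obtain m j u v where a: "a = (m, j, u, v)" by (cases a)
    obtain m' j' u' v' where b: "b = (m', j', u', v')" by (cases b)
    define h where "h = ?f a"
    have A: "- int j \<in> starts h" "window h (- int j) n = u @ v" "len (h (- int j)) = m"
      "length u = m" "j < m"
      using D[of m j u v] that(1) unfolding a h_def by auto
    have A': "- int j' \<in> starts h" "window h (- int j') n = u' @ v'" "len (h (- int j')) = m'"
      "length u' = m'" "j' < m'"
      using D[of m' j' u' v'] that(2) unfolding h_def eq unfolding b by auto
    have "j = j'"
    proof (rule ccontr)
      assume "j \<noteq> j'"
      then consider "j < j'" | "j' < j" by linarith
      then show False

      proof cases
        case 1
        then have "- int j' + int m' \<le> - int j" using before_start[OF A(1), of "- int j'"] A'(3) by simp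
        then show False using A'(5) by simp
      next
        case 2
        then have "- int j + int m \<le> - int j'" using before_start[OF A'(1), of "- int j"] A(3) by simp
        then show False using A(5) by simp
      qed
    qed
    then show "a = b" using A A' unfolding a b by auto
  qed simp
  show "\<exists>a\<in>?D. h = ?f a" if h: "h \<in> tilings n" for h
  proof -
    have per: "periodic n h" using h by (simp add: tilings_def)
    obtain x where x: "x \<in> starts h" "x \<le> 0" "0 < x + int (len (h x))"
      using exists_tile[OF n h, of 0] by blast
    define j where "j = nat (- x)"
    have j: "- int j \<in> starts h" using x by (simp add: j_def)
    define m where "m = len (h (- int j))"
    have m: "- int j + int m \<in> starts h" "m > 0" using next_start[OF h j] by (auto simp: m_def)
    have jm: "j < m" using x by (simp add: j_def m_def)
    have jn: "- int j + int n \<in> starts h" using starts_shift[OF per, of "- int j" 1] j by simp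
    have mn: "m \<le> n" using before_start[OF jn, of "- int j"] n by (simp add: m_def)
    define u v where "u = window h (- int j) m" and "v = window h (- int j + int m) (n - m)"
    have "u \<in> blocks m" using h j by (auto simp: blocks_def u_def m_def tilings_def)
    moreover have "v \<in> sequences (n - m)"
      using window_starts[OF h m(1) jn] mn by (simp add: v_def nat_diff_distrib)
    moreover have "u @ v = window h (- int j) n"
      unfolding u_def v_def window_append[symmetric] using mn by simp
    ultimately show ?thesis
      using m jm mn periodic_extension_window[OF per n]
      by (intro bexI[of _ "(m, j, u, v)"]) auto
  qed
qed

lemma sequences_0: "sequences 0 = {[]}"
  using block_nonempty by (auto simp: sequences_def intro: exI[of _ "[]"])

lemma bij_betw_sequences:
  assumes "k > 0"
  shows "bij_betw (\<lambda>(m, u, v). u @ v) (SIGMA m:{1..k}. blocks m \<times> sequences (k - m)) (sequences k)"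
  (is "bij_betw ?f ?D _")
proof (rule bij_betwI')
  show "?f a \<in> sequences k" if "a \<in> ?D" for a
  proof -
    obtain m u v where a: "a = (m, u, v)" by (cases a)
    moreover have v: "v \<in> sequences (k - m)" using that by (simp add: a)
    obtain us where "v = concat us" "us \<in> lists B" "length (concat us) = k - m"
      using v unfolding sequences_def by blast
    moreover have "m \<le> k" "u \<in> B" "length u = m" using that by (auto simp: a blocks_def)
    ultimately show ?thesis by (auto simp: sequences_def intro!: exI[of _ "u # us"])
  qed
  show "(?f a = ?f b) = (a = b)" if "a \<in> ?D" "b \<in> ?D" for a b
  proof
    assume eq: "?f a = ?f b"
    obtain m u v where a: "a = (m, u, v)" by (cases a)
    obtain m' u' v' where b: "b = (m', u', v')" by (cases b)
    have u: "u \<in> B" "length u = m" "u' \<in> B" "length u' = m'"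
      using that by (auto simp: a b blocks_def)
    have "hd u = hd u'"
      using arg_cong[OF eq, of hd] u block_nonempty by (auto simp: a b)
    then have "m = m'" using len_hd u by metis
    then show "a = b" using eq u by (auto simp: a b)
  qed simp
  show "\<exists>a\<in>?D. w = ?f a" if w: "w \<in> sequences k" for w
  proof -
    obtain us where us: "us \<in> lists B" "w = concat us" "length w = k"
      using w by (auto simp: sequences_def)
    then obtain u vs where "us = u # vs" using assms by (cases us) auto
    moreover have "Suc 0 \<le> length u" using block_nonempty us calculation by (cases u) auto
    ultimately show ?thesis using us
      by (intro bexI[of _ "(length u, u, concat vs)"]) (auto simp: sequences_def blocks_def)
  qed
qed

lemma finite_block_sets [simp]: "finite (blocks m)"
  unfolding blocks_def by (rule finite_blocks)

lemma finite_sequences [simp]: "finite (sequences k)"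
proof (induction k rule: less_induct)
  case (less k)
  show ?case
  proof (cases "k = 0")
    case False
    then have "finite (SIGMA m:{1..k}. blocks m \<times> sequences (k - m))"
      using less by (intro finite_SigmaI finite_cartesian_product) auto
    then show ?thesis using bij_betw_finite bij_betw_sequences False by blast
  qed (simp add: sequences_0)
qed

lemma finite_tilings: "n > 0 \<Longrightarrow> finite (tilings n)"
  using bij_betw_finite[OF bij_betw_tilings]
  by (auto intro!: finite_SigmaI finite_cartesian_product)

lemma card_sequences:
  "k > 0 \<Longrightarrow> card (sequences k) = (\<Sum>m=1..k. card (blocks m) * card (sequences (k - m)))"
  using bij_betw_same_card[OF bij_betw_sequences]
  by (simp add: card_SigmaI card_cartesian_product)

lemma card_tilings:
  "n > 0 \<Longrightarrow> card (tilings n) = (\<Sum>m=1..n. m * card (blocks m) * card (sequences (n - m)))"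
  using bij_betw_same_card[OF bij_betw_tilings]
  by (simp add: card_SigmaI card_cartesian_product mult.assoc)

lemma blocks_0: "blocks 0 = {}"
  using block_nonempty by (auto simp: blocks_def)

text \<open>
  \<open>S = 1 / (1 - W)\<close> counts sequences of blocks. By the cut at the tile that contains 0, tilings are
  counted by \<open>x W' S\<close>; the derivative accounts for the \<open>m\<close> offsets of 0 in a tile of length \<open>m\<close>.
\<close>

lemma tilings_gf:
  fixes W S :: "'b :: comm_ring_1 fps"
  defines "W \<equiv> Abs_fps (\<lambda>m. of_nat (card (blocks m)))"
  shows "Abs_fps (\<lambda>n. if n = 0 then 0 else of_nat (card (tilings n))) * (1 - W) = fps_X * fps_deriv W"
proof -
  define S where "S = Abs_fps (\<lambda>k. of_nat (card (sequences k)) :: 'b)"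
  have S: "S * (1 - W) = 1"
  proof -
    have "fps_nth S k = fps_nth (1 + W * S) k" for k
    proof (cases "k = 0")
      case True
      then show ?thesis by (simp add: S_def W_def sequences_0 blocks_0)
    next
      case False
      have "fps_nth (W * S) k = (\<Sum>m=0..k. of_nat (card (blocks m) * card (sequences (k - m))))"
        by (simp add: fps_mult_nth W_def S_def)
      also have "\<dots> = (\<Sum>m=1..k. of_nat (card (blocks m) * card (sequences (k - m))))"
        by (rule sum.mono_neutral_right) (auto simp: blocks_0 not_less_eq_eq)
      finally show ?thesis using False by (simp add: S_def card_sequences)
    qed
    then have "S = 1 + W * S" by (rule fps_ext)
    then show ?thesis by (simp add: algebra_simps)
  qed
  have "Abs_fps (\<lambda>n. if n = 0 then 0 else of_nat (card (tilings n))) = (fps_X * fps_deriv W) * S"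
  proof (rule fps_ext)
    fix n
    have c: "fps_nth (fps_X * fps_deriv W) m = of_nat (m * card (blocks m))" for m
      by (cases m) (auto simp: W_def algebra_simps)
    have "fps_nth ((fps_X * fps_deriv W) * S) n =
        (\<Sum>m=0..n. of_nat (m * card (blocks m) * card (sequences (n - m))))"
      unfolding fps_mult_nth[of "fps_X * fps_deriv W"] c by (simp add: S_def)
    also have "\<dots> = (\<Sum>m=1..n. of_nat (m * card (blocks m) * card (sequences (n - m))))"
      by (rule sum.mono_neutral_right) (auto simp: not_less_eq_eq)
    finally show "fps_nth (Abs_fps (\<lambda>n. if n = 0 then 0 else of_nat (card (tilings n)))) n =
        fps_nth ((fps_X * fps_deriv W) * S) n"
      by (simp add: card_tilings)
  qed
  then show ?thesis using S by (simp add: mult.assoc)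
qed

end

section \<open>Codes of 312-avoiding orders\<close>

text \<open>
  The letter \<open>h a\<close> stands for the interval \<open>(a, a + h a]\<close>, which is \<open>(a, \<infinity>)\<close> if \<open>h a = \<infinity>\<close>. Its
  elements are the integers above \<open>a\<close> that come before \<open>a\<close> in the order, so \<open>covers h a b\<close> is an
  inversion.
\<close>

definition covers :: "(int \<Rightarrow> enat) \<Rightarrow> int \<Rightarrow> int \<Rightarrow> bool" where
  "covers h a b \<longleftrightarrow> a < b \<and> enat (nat (b - a)) \<le> h a"

text \<open>
  Transitivity of the encoded order for three decreasing integers. The other cases of transitivity
  hold because the covered elements form an interval.
\<close>

definition nested :: "(int \<Rightarrow> enat) \<Rightarrow> bool" where
  "nested h \<longleftrightarrow> (\<forall>a b c. covers h a b \<longrightarrow> covers h b c \<longrightarrow> covers h a c)"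

definition code_order :: "(int \<Rightarrow> enat) \<Rightarrow> int rel" where
  "code_order h = {(a, b). a = b \<or> covers h b a \<or> a < b \<and> \<not> covers h a b}"

lemma covers_less: "covers h a b \<Longrightarrow> a < b"
  by (simp add: covers_def)

lemma covers_between: "covers h a c \<Longrightarrow> a < b \<Longrightarrow> b \<le> c \<Longrightarrow> covers h a b"
  by (cases "h a") (auto simp: covers_def)

lemma nestedD: "nested h \<Longrightarrow> covers h a b \<Longrightarrow> covers h b c \<Longrightarrow> covers h a c"
  unfolding nested_def by blast

lemma covers_infinity: "h a = \<infinity> \<Longrightarrow> covers h a b \<longleftrightarrow> a < b"
  by (simp add: covers_def)

lemma covers_enat: "h a = enat k \<Longrightarrow> covers h a b \<longleftrightarrow> a < b \<and> b \<le> a + int k"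
  by (auto simp: covers_def)

lemma covers_shift: "periodic n h \<Longrightarrow> covers h (a + i * int n) (b + i * int n) \<longleftrightarrow> covers h a b"
  using periodic_shift[of n h a i] by (simp add: covers_def)

lemma code_order_less: "a < b \<Longrightarrow> (a, b) \<in> code_order h \<longleftrightarrow> \<not> covers h a b"
  and code_order_greater: "a < b \<Longrightarrow> (b, a) \<in> code_order h \<longleftrightarrow> covers h a b"
  by (auto simp: code_order_def covers_def)

lemma linear_order_code_order:
  assumes "nested h"
  shows "linear_order (code_order h)"
proof -
  have "trans (code_order h)"
  proof (rule transI)
    fix a b c assume ab: "(a, b) \<in> code_order h" and bc: "(b, c) \<in> code_order h"
    consider "a = b \<or> b = c \<or> a = c" | "a < b" "b < c" | "a < c" "c < b" | "c < a" "a < b"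
      | "b < a" "a < c" | "b < c" "c < a" | "b < a" "c < b"
      by linarith
    then show "(a, c) \<in> code_order h"
    proof cases
      case 1
      then show ?thesis using ab bc by (auto simp: code_order_def)
    next
      case 2
      then have "\<not> covers h a b" using ab by (simp add: code_order_less)
      then have "\<not> covers h a c" using covers_between[of h a c b] 2 by auto
      then show ?thesis using 2 by (simp add: code_order_less)
    next
      case 3
      then have "\<not> covers h a b" "covers h c b"
        using ab bc by (simp_all add: code_order_less code_order_greater)
      then have "\<not> covers h a c" using nestedD[OF assms, of a c b] by blast
      then show ?thesis using 3 by (simp add: code_order_less)
    next
      case 4
      then have "covers h c b" using bc by (simp add: code_order_greater)
      then have "covers h c a" using covers_between[of h c b a] 4 by simp
      then show ?thesis using 4 by (simp add: code_order_greater)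
    next
      case 5
      then have "covers h b a" "\<not> covers h b c"
        using ab bc by (simp_all add: code_order_less code_order_greater)
      then have "\<not> covers h a c" using nestedD[OF assms, of b a c] by blast
      then show ?thesis using 5 by (simp add: code_order_less)
    next
      case 6
      then have "covers h b a" "\<not> covers h b c"
        using ab bc by (simp_all add: code_order_less code_order_greater)
      then show ?thesis using 6 covers_between[of h b a c] by simp
    next
      case 7
      then have "covers h b a" "covers h c b"
        using ab bc by (simp_all add: code_order_greater)
      then have "covers h c a" using nestedD[OF assms, of c b a] by blast
      then show ?thesis using 7 by (simp add: code_order_greater)
    qed
  qed
  moreover have "a = b" if "(a, b) \<in> code_order h" "(b, a) \<in> code_order h" for a b
    using that by (cases a b rule: linorder_cases) (auto simp: code_order_less code_order_greater)
  then have "antisym (code_order h)" by (rule antisymI)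
  moreover have "(a, b) \<in> code_order h \<or> (b, a) \<in> code_order h" for a b
    by (cases a b rule: linorder_cases) (auto simp: code_order_less code_order_greater code_order_def)
  then have "total (code_order h)" by (simp add: total_on_def)
  moreover have "refl (code_order h)" by (simp add: code_order_def refl_on_def)
  ultimately show ?thesis
    by (simp add: linear_order_on_def partial_order_on_def preorder_on_def)
qed

lemma tito_code_order:
  assumes "nested h" "periodic n h" "n > 0"
  shows "tito n (code_order h)"
proof -
  have "covers h (a + int n) (b + int n) = covers h a b" for a b
    using covers_shift[OF assms(2), of a 1 b] by simp
  then have "\<forall>a b. (a, b) \<in> code_order h \<longleftrightarrow> (a + int n, b + int n) \<in> code_order h"
    by (simp add: code_order_def)
  with assms(3) linear_order_code_order[OF assms(1)] show ?thesis
    unfolding tito_def by (intro conjI)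
qed

lemma inj_code_order: "inj code_order"
proof (rule injI, rule ext)
  fix h h' :: "int \<Rightarrow> enat" and a assume eq: "code_order h = code_order h'"
  have "enat k \<le> h a \<longleftrightarrow> enat k \<le> h' a" for k
  proof (cases "k = 0")
    case False
    then have "covers h a (a + int k) \<longleftrightarrow> covers h' a (a + int k)"
      using code_order_greater[of a "a + int k"] eq by auto
    then show ?thesis using False by (simp add: covers_def)
  qed (simp add: zero_enat_def[symmetric])
  moreover have "x \<le> y" if "\<And>k. enat k \<le> x \<Longrightarrow> enat k \<le> y" for x y :: enat
    using that[of "the_enat x"] that[of "Suc (the_enat y)"] by (cases x; cases y) auto
  ultimately show "h a = h' a" by (blast intro: antisym)
qed

lemma contains_pattern_3:
  assumes "set [p, q, s] \<subseteq> {1..3}"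
  shows "contains_pattern r [p, q, s] \<longleftrightarrow> (\<exists>a b c. a < b \<and> b < c \<and>
     successively (\<lambda>x y. (x, y) \<in> r) (map (\<lambda>j. if j = 1 then a else if j = 2 then b else c) [p, q, s]))"
  (is "_ \<longleftrightarrow> (\<exists>a b c. _ \<and> _ \<and> successively _ (map (?v a b c) _))")
proof
  assume "contains_pattern r [p, q, s]"
  then obtain i :: "nat \<Rightarrow> int" where i: "strict_mono_on {1..length [p, q, s]} i"
    "successively (\<lambda>x y. (x, y) \<in> r) (map i [p, q, s])"
    unfolding contains_pattern_def by blast
  have "x = 1 \<or> x = 2 \<or> x = 3" if "x \<in> {1..3}" for x :: nat
    using that unfolding atLeastAtMost_iff by linarith
  then have e: "map i [p, q, s] = map (?v (i 1) (i 2) (i 3)) [p, q, s]"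
    by (intro map_cong[OF refl]) (metis assms subsetD)
  have "i 1 < i 2" "i 2 < i 3"
    using i(1) by (auto simp: strict_mono_on_def)
  then show "\<exists>a b c. a < b \<and> b < c \<and> successively (\<lambda>x y. (x, y) \<in> r) (map (?v a b c) [p, q, s])"
    using i(2) unfolding e by blast
next
  assume "\<exists>a b c. a < b \<and> b < c \<and> successively (\<lambda>x y. (x, y) \<in> r) (map (?v a b c) [p, q, s])"
  then obtain a b c where "a < b" "b < c"
    "successively (\<lambda>x y. (x, y) \<in> r) (map (?v a b c) [p, q, s])" by blast
  then show "contains_pattern r [p, q, s]"
    unfolding contains_pattern_def
    by (intro exI[of _ "?v a b c"] conjI) (auto simp: strict_mono_on_def)
qed

lemma contains_pattern_4:
  assumes "set [p, q, s, t] \<subseteq> {1..4}"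
  shows "contains_pattern r [p, q, s, t] \<longleftrightarrow> (\<exists>a b c d. a < b \<and> b < c \<and> c < d \<and>
     successively (\<lambda>x y. (x, y) \<in> r)
       (map (\<lambda>j. if j = 1 then a else if j = 2 then b else if j = 3 then c else d) [p, q, s, t]))"
  (is "_ \<longleftrightarrow> (\<exists>a b c d. _ \<and> _ \<and> _ \<and> successively _ (map (?v a b c d) _))")
proof
  assume "contains_pattern r [p, q, s, t]"
  then obtain i :: "nat \<Rightarrow> int" where i: "strict_mono_on {1..length [p, q, s, t]} i"
    "successively (\<lambda>x y. (x, y) \<in> r) (map i [p, q, s, t])"
    unfolding contains_pattern_def by blast
  have "x = 1 \<or> x = 2 \<or> x = 3 \<or> x = 4" if "x \<in> {1..4}" for x :: nat
    using that unfolding atLeastAtMost_iff by linarith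
  then have e: "map i [p, q, s, t] = map (?v (i 1) (i 2) (i 3) (i 4)) [p, q, s, t]"
    by (intro map_cong[OF refl]) (metis assms subsetD)
  have "i 1 < i 2" "i 2 < i 3" "i 3 < i 4"
    using i(1) by (auto simp: strict_mono_on_def)
  then show "\<exists>a b c d. a < b \<and> b < c \<and> c < d \<and>
      successively (\<lambda>x y. (x, y) \<in> r) (map (?v a b c d) [p, q, s, t])"
    using i(2) unfolding e by blast
next
  assume "\<exists>a b c d. a < b \<and> b < c \<and> c < d \<and>
      successively (\<lambda>x y. (x, y) \<in> r) (map (?v a b c d) [p, q, s, t])"
  then obtain a b c d where "a < b" "b < c" "c < d"
    "successively (\<lambda>x y. (x, y) \<in> r) (map (?v a b c d) [p, q, s, t])" by blast
  then show "contains_pattern r [p, q, s, t]"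
    unfolding contains_pattern_def
    by (intro exI[of _ "?v a b c d"] conjI) (auto simp: strict_mono_on_def)
qed

lemma contains_312:
  "contains_pattern r [3, 1, 2] \<longleftrightarrow> (\<exists>a b c. a < b \<and> b < c \<and> (c, a) \<in> r \<and> (a, b) \<in> r)"
  by (subst contains_pattern_3) auto

lemma code_order_avoids_312: "\<not> contains_pattern (code_order h) [3, 1, 2]"
  unfolding contains_312
  using covers_between[of h] by (metis code_order_greater code_order_less less_imp_le less_trans)

text \<open>
  The elements above \<open>a\<close> that precede \<open>a\<close> are downward closed in \<open>(a, \<infinity>)\<close>, since a gap \<open>b\<close> would
  give the pattern \<open>c, a, b\<close>. The letter at \<open>a\<close> is the supremum of their distances from \<open>a\<close>.
\<close>

lemma avoider_312_code:
  assumes r: "tito n r" and av: "\<not> contains_pattern r [3, 1, 2]"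
  shows "\<exists>h. periodic n h \<and> nested h \<and> r = code_order h"
proof -
  have n: "n > 0" and lin: "linear_order r"
    and per: "\<And>a b. (a, b) \<in> r \<longleftrightarrow> (a + int n, b + int n) \<in> r"
    using r by (auto simp: tito_def)
  have tr: "(a, b) \<in> r \<Longrightarrow> (b, c) \<in> r \<Longrightarrow> (a, c) \<in> r" for a b c
    using lin by (auto simp: linear_order_on_def partial_order_on_def preorder_on_def dest: transD)
  have anti: "(a, b) \<in> r \<Longrightarrow> (b, a) \<in> r \<Longrightarrow> a = b" for a b
    using lin by (auto simp: linear_order_on_def partial_order_on_def dest: antisymD)
  have tot: "(a, b) \<in> r \<or> (b, a) \<in> r" for a b
    using lin by (cases "a = b") (auto simp: linear_order_on_def partial_order_on_def preorder_on_def
        refl_on_def total_on_def)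
  have down: "(b, a) \<in> r" if "(c, a) \<in> r" "a < b" "b \<le> c" for a b c
    using av[unfolded contains_312] that tot[of a b] by (cases "b = c") auto
  \<comment> \<open>the element 0 yields the letter 0 if no larger element precedes a\<close>
  define h where "h a = Sup (enat ` {k. k = 0 \<or> (a + int k, a) \<in> r})" for a
  have cov: "covers h a b \<longleftrightarrow> a < b \<and> (b, a) \<in> r" for a b
  proof (cases "a < b")
    case True
    define k where "k = nat (b - a)"
    have b: "b = a + int k" "k > 0" using True by (auto simp: k_def)
    have "enat k \<le> h a" if "(b, a) \<in> r"
      unfolding h_def by (rule Sup_upper) (use that b in auto)
    moreover have "(b, a) \<in> r" if "enat k \<le> h a"
    proof -
      have "\<not> (h a \<le> enat (k - 1))" using that b by (cases "h a") auto
      then obtain l where "l = 0 \<or> (a + int l, a) \<in> r" "\<not> enat l \<le> enat (k - 1)"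
        unfolding h_def Sup_le_iff by auto
      then show ?thesis using down[of "a + int l" a b] b by auto
    qed
    ultimately show ?thesis using True by (auto simp: covers_def k_def)
  qed (simp add: covers_def)
  have "periodic n h"
    unfolding periodic_def
  proof
    fix x
    have "(x + int n + int k, x + int n) \<in> r \<longleftrightarrow> (x + int k, x) \<in> r" for k
      using per[of "x + int k" x] by (simp add: ac_simps)
    then show "h (x + int n) = h x" by (simp add: h_def)
  qed
  moreover have "nested h"
    unfolding nested_def cov using tr by (meson less_trans)
  moreover have "r = code_order h"
  proof -
    have "(a, b) \<in> r \<longleftrightarrow> (a, b) \<in> code_order h" for a b
      using tot[of a b] anti[of a b]
      by (cases a b rule: linorder_cases)
         (auto simp: code_order_less code_order_greater cov, simp add: code_order_def)
    then show ?thesis by auto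
  qed
  ultimately show ?thesis by blast
qed

definition codes :: "nat \<Rightarrow> (int \<Rightarrow> enat) set" where
  "codes n = {h. periodic n h \<and> nested h}"

lemma num_avoiding_312:
  assumes "n > 0"
  shows "num_avoiding {[3, 1, 2], q} n = card {h \<in> codes n. \<not> contains_pattern (code_order h) q}"
proof -
  have "avoiding_titos {[3, 1, 2], q} n =
      code_order ` {h \<in> codes n. \<not> contains_pattern (code_order h) q}" (is "?L = ?R")
  proof
    show "?L \<subseteq> ?R"
    proof
      fix r assume r: "r \<in> ?L"
      then obtain h where "periodic n h" "nested h" "r = code_order h"
        using avoider_312_code[of n r] by (auto simp: avoiding_titos_def)
      then show "r \<in> ?R" using r by (auto simp: codes_def avoiding_titos_def)
    qed
    show "?R \<subseteq> ?L"
      using tito_code_order[OF _ _ assms] code_order_avoids_312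
      by (auto simp: avoiding_titos_def codes_def)
  qed
  then show ?thesis
    using assms card_image[OF inj_on_subset[OF inj_code_order subset_UNIV]]
    by (simp add: num_avoiding_def)
qed

section \<open>Trees describing finite interiors\<close>

datatype bintree = Leaf | Node bintree bintree

text \<open>
  \<open>Node l r\<close> is a word that begins with the letter \<open>size l\<close>, whose interval is filled by \<open>l\<close> and
  followed by \<open>r\<close>. In the encoded order the first position comes after \<open>l\<close> and before \<open>r\<close>, while its
  value is the smallest; so this is the decomposition of a 312-avoiding permutation at its minimum.
\<close>

fun letters :: "bintree \<Rightarrow> enat list" where
  "letters Leaf = []"
| "letters (Node l r) = enat (size l) # letters l @ letters r"

lemma length_letters [simp]: "length (letters t) = size t"
  by (induction t) auto

lemma letters_inject: "letters s = letters t \<longleftrightarrow> s = t"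
proof
  show "letters s = letters t \<Longrightarrow> s = t"
  proof (induction s arbitrary: t)
    case Leaf
    then show ?case by (cases t) auto
  next
    case (Node l r)
    obtain l' r' where t: "t = Node l' r'" using Node.prems by (cases t) auto
    have s: "size l = size l'" and a: "letters l @ letters r = letters l' @ letters r'"
      using Node.prems by (auto simp: t)
    have "letters l = letters l' \<and> letters r = letters r'"
      by (rule append_eq_append_conv[THEN iffD1, OF _ a]) (simp add: s)
    then show ?case using Node.IH by (simp add: t)
  qed
qed simp

definition follows :: "(int \<Rightarrow> enat) \<Rightarrow> int \<Rightarrow> bintree \<Rightarrow> bool" where
  "follows h x t \<longleftrightarrow> window h x (size t) = letters t"

lemma follows_Leaf [simp]: "follows h x Leaf"
  by (simp add: follows_def)

lemma follows_Node [simp]: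
  "follows h x (Node l r) \<longleftrightarrow>
     h x = enat (size l) \<and> follows h (x + 1) l \<and> follows h (x + 1 + int (size l)) r"
  unfolding follows_def by (simp add: window_Suc window_append append_eq_append_conv)

definition hereditary :: "(bintree \<Rightarrow> bool) \<Rightarrow> bool" where
  "hereditary Q \<longleftrightarrow> (\<forall>l r. Q (Node l r) \<longrightarrow> Q l \<and> Q r)"

text \<open>
  Every position inside a word given by a tree is the root of a subtree, whose left part describes
  the interval of the letter at that position.
\<close>

lemma follows_subtree:
  assumes "follows h x t" "Q t" "hereditary Q" "x \<le> a" "a < x + int (size t)"
  shows "\<exists>s. Q s \<and> h a = enat (size s) \<and> follows h (a + 1) s \<and> a + int (size s) < x + int (size t)"
  using assms
proof (induction t arbitrary: x)
  case (Node l r)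
  have Q: "Q l" "Q r" using Node.prems(2,3) unfolding hereditary_def by blast+
  consider "a = x" | "x + 1 \<le> a" "a < x + 1 + int (size l)" | "x + 1 + int (size l) \<le> a"
    using Node.prems(4) by linarith
  then show ?case
  proof cases
    case 1
    then show ?thesis using Node.prems(1) Q by (intro exI[of _ l]) simp
  next
    case 2
    have f: "follows h (x + 1) l" using Node.prems(1) by simp
    obtain s where "Q s" "h a = enat (size s)" "follows h (a + 1) s"
      "a + int (size s) < x + 1 + int (size l)"
      using Node.IH(1)[OF f Q(1) Node.prems(3) 2] by blast
    then show ?thesis by (intro exI[of _ s]) simp
  next
    case 3
    have f: "follows h (x + 1 + int (size l)) r" using Node.prems(1) by simp
    have a: "a < x + 1 + int (size l) + int (size r)" using Node.prems(5) by simp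
    obtain s where "Q s" "h a = enat (size s)" "follows h (a + 1) s"
      "a + int (size s) < x + 1 + int (size l) + int (size r)"
      using Node.IH(2)[OF f Q(2) Node.prems(3) 3 a] by blast
    then show ?thesis by (intro exI[of _ s]) simp
  qed
qed simp

lemma follows_within:
  assumes "follows h x t" "covers h b c" "x \<le> b" "b < x + int (size t)"
  shows "c < x + int (size t)"
proof -
  have "hereditary (\<lambda>_. True)" by (simp add: hereditary_def)
  from follows_subtree[OF assms(1) TrueI this assms(3,4)]
  obtain s :: bintree where "h b = enat (size s)" "b + int (size s) < x + int (size t)" by blast
  then show ?thesis using assms(2) by (simp add: covers_enat)
qed

text \<open>
  A stretch of a nested word whose letters do not reach beyond its end is split at its first letter
  into the interval of this letter and the remainder, and both are again such stretches.
\<close>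

lemma exists_follows:
  assumes "nested h" "\<And>b. x \<le> b \<Longrightarrow> b < x + int k \<Longrightarrow> \<exists>m. h b = enat m \<and> b + int m < x + int k"
  shows "\<exists>t. size t = k \<and> follows h x t"
  using assms(2)
proof (induction k arbitrary: x rule: less_induct)
  case (less k)
  show ?case
  proof (cases "k = 0")
    case True
    then show ?thesis by (intro exI[of _ Leaf]) simp
  next
    case False
    then obtain m where m: "h x = enat m" "m < k" using less.prems[of x] by auto
    have "\<exists>p. h b = enat p \<and> b + int p < (x + 1) + int m" if b: "x + 1 \<le> b" "b < (x + 1) + int m" for b
    proof -
      obtain p where p: "h b = enat p" using less.prems[of b] b m by auto
      have "b + int p \<le> x + int m"
      proof (cases "p = 0")
        case False
        have "covers h x b" using b m by (simp add: covers_enat)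
        moreover have "covers h b (b + int p)" using p False by (simp add: covers_enat)
        ultimately have "covers h x (b + int p)" by (rule nestedD[OF assms(1)])
        then show ?thesis using m by (simp add: covers_enat)
      qed (use b in auto)
      then show ?thesis using p by auto
    qed
    with less.IH[OF m(2), of "x + 1"] obtain l where l: "size l = m" "follows h (x + 1) l" by blast
    have "\<exists>p. h b = enat p \<and> b + int p < x + 1 + int m + int (k - 1 - m)"
      if "x + 1 + int m \<le> b" "b < x + 1 + int m + int (k - 1 - m)" for b
      using less.prems[of b] that m by (simp add: of_nat_diff)
    with less.IH[of "k - 1 - m" "x + 1 + int m"] False
    obtain r where r: "size r = k - 1 - m" "follows h (x + 1 + int m) r" by auto
    show ?thesis using l r m by (intro exI[of _ "Node l r"]) auto
  qed
qed

lemma exists_interior: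
  assumes "nested h" "h a = enat k"
  shows "\<exists>t. size t = k \<and> follows h (a + 1) t"
proof (rule exists_follows[OF assms(1)])
  fix b assume b: "a + 1 \<le> b" "b < a + 1 + int k"
  have ab: "covers h a b" using assms b by (simp add: covers_enat)
  have "h b \<noteq> \<infinity>"
  proof
    assume "h b = \<infinity>"
    then have "covers h b (a + 1 + int k)" using b by (simp add: covers_infinity)
    from nestedD[OF assms(1) ab this] show False using assms(2) by (simp add: covers_enat)
  qed
  then obtain m where m: "h b = enat m" by auto
  have "b + int m \<le> a + int k"
  proof (cases "m = 0")
    case False
    then have "covers h b (b + int m)" using m by (simp add: covers_enat)
    from nestedD[OF assms(1) ab this] show ?thesis using assms by (simp add: covers_enat)
  qed (use b in auto)
  then show "\<exists>m. h b = enat m \<and> b + int m < a + 1 + int k" using m by auto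
qed

definition interior_codes :: "(bintree \<Rightarrow> bool) \<Rightarrow> nat \<Rightarrow> (int \<Rightarrow> enat) set" where
  "interior_codes Q n =
     {h. periodic n h \<and> (\<forall>a k. h a = enat k \<longrightarrow> (\<exists>t. Q t \<and> size t = k \<and> follows h (a + 1) t))}"

text \<open>
  Nestedness only has to be checked for finite letters, and there it follows from the tree
  that describes the interior.
\<close>

lemma interior_codes_subset: "interior_codes Q n \<subseteq> codes n"
proof
  fix h assume h: "h \<in> interior_codes Q n"
  have "nested h"
    unfolding nested_def
  proof (intro allI impI)
    fix a b c assume ab: "covers h a b" and bc: "covers h b c"
    show "covers h a c"
    proof (cases "h a")
      case (enat k)
      then obtain t where t: "size t = k" "follows h (a + 1) t"
        using h by (auto simp: interior_codes_def)
      have "a + 1 \<le> b" "b < a + 1 + int (size t)" using ab enat t(1) by (simp_all add: covers_enat)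
      from follows_within[OF t(2) bc this] show ?thesis
        using covers_less[OF ab] covers_less[OF bc] enat t(1) by (simp add: covers_enat)
    next
      case infinity
      then show ?thesis using covers_less[OF ab] covers_less[OF bc] by (simp add: covers_infinity)
    qed
  qed
  then show "h \<in> codes n" using h by (simp add: interior_codes_def codes_def)
qed

text \<open>
  The statement that \<open>A\<close>, a condition on the order restricted to \<open>[x, z)\<close>, depends only on the tree of
  that stretch and is expressed by \<open>Q\<close>.
\<close>

definition captures :: "((int \<Rightarrow> enat) \<Rightarrow> int \<Rightarrow> int \<Rightarrow> bool) \<Rightarrow> (bintree \<Rightarrow> bool) \<Rightarrow> bool" where
  "captures A Q \<longleftrightarrow> (\<forall>h x t. follows h x t \<longrightarrow> (A h x (x + int (size t)) \<longleftrightarrow> Q t))"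

lemma codes_captured:
  assumes "captures A Q"
  shows "{h \<in> codes n. \<forall>a k. h a = enat k \<longrightarrow> A h (a + 1) (a + 1 + int k)} = interior_codes Q n"
proof (intro equalityI subsetI)
  fix h assume h: "h \<in> {h \<in> codes n. \<forall>a k. h a = enat k \<longrightarrow> A h (a + 1) (a + 1 + int k)}"
  have "\<exists>t. Q t \<and> size t = k \<and> follows h (a + 1) t" if k: "h a = enat k" for a k
  proof -
    obtain t where t: "size t = k" "follows h (a + 1) t"
      using exists_interior[of h a k] k h unfolding codes_def by blast
    moreover have "A h (a + 1) (a + 1 + int k)" using h k by blast
    ultimately have "Q t" using assms unfolding captures_def by blast
    then show ?thesis using t by blast
  qed
  then show "h \<in> interior_codes Q n" using h by (simp add: interior_codes_def codes_def)
next
  fix h assume h: "h \<in> interior_codes Q n"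
  have "A h (a + 1) (a + 1 + int k)" if k: "h a = enat k" for a k
  proof -
    obtain t where "Q t" "size t = k" "follows h (a + 1) t"
      using h k unfolding interior_codes_def by blast
    then show ?thesis using assms unfolding captures_def by blast
  qed
  then show "h \<in> {h \<in> codes n. \<forall>a k. h a = enat k \<longrightarrow> A h (a + 1) (a + 1 + int k)}"
    using h interior_codes_subset by blast
qed

text \<open>
  For \<open>b < c\<close>, the order has \<open>c\<close> before \<open>b\<close> exactly if \<open>covers h b c\<close>. The following conditions
  express that the elements of \<open>[x, z)\<close>, listed in this order, avoid the indicated pattern; the
  patterns of length 3 compare neighbours of the pattern only.
\<close>

definition avoids21 :: "(int \<Rightarrow> enat) \<Rightarrow> int \<Rightarrow> int \<Rightarrow> bool" where
  "avoids21 h x z \<longleftrightarrow> (\<forall>b c. x \<le> b \<and> b < c \<and> c < z \<longrightarrow> \<not> covers h b c)"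

definition avoids12 :: "(int \<Rightarrow> enat) \<Rightarrow> int \<Rightarrow> int \<Rightarrow> bool" where
  "avoids12 h x z \<longleftrightarrow> (\<forall>b c. x \<le> b \<and> b < c \<and> c < z \<longrightarrow> covers h b c)"

definition avoids321 :: "(int \<Rightarrow> enat) \<Rightarrow> int \<Rightarrow> int \<Rightarrow> bool" where
  "avoids321 h x z \<longleftrightarrow>
     (\<forall>b c d. x \<le> b \<and> b < c \<and> c < d \<and> d < z \<longrightarrow> \<not> (covers h c d \<and> covers h b c))"

definition avoids231 :: "(int \<Rightarrow> enat) \<Rightarrow> int \<Rightarrow> int \<Rightarrow> bool" where
  "avoids231 h x z \<longleftrightarrow>
     (\<forall>b c d. x \<le> b \<and> b < c \<and> c < d \<and> d < z \<longrightarrow> \<not> (\<not> covers h c d \<and> covers h b d))"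

definition avoids132 :: "(int \<Rightarrow> enat) \<Rightarrow> int \<Rightarrow> int \<Rightarrow> bool" where
  "avoids132 h x z \<longleftrightarrow>
     (\<forall>b c d. x \<le> b \<and> b < c \<and> c < d \<and> d < z \<longrightarrow> \<not> (\<not> covers h b d \<and> covers h c d))"

definition avoids213 :: "(int \<Rightarrow> enat) \<Rightarrow> int \<Rightarrow> int \<Rightarrow> bool" where
  "avoids213 h x z \<longleftrightarrow>
     (\<forall>b c d. x \<le> b \<and> b < c \<and> c < d \<and> d < z \<longrightarrow> \<not> (covers h b c \<and> \<not> covers h b d))"

definition avoids123 :: "(int \<Rightarrow> enat) \<Rightarrow> int \<Rightarrow> int \<Rightarrow> bool" where
  "avoids123 h x z \<longleftrightarrow>
     (\<forall>b c d. x \<le> b \<and> b < c \<and> c < d \<and> d < z \<longrightarrow> \<not> (\<not> covers h b c \<and> \<not> covers h c d))"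

text \<open>
  For \<open>Node l r\<close> the order lists \<open>l\<close>, then the minimum, then \<open>r\<close>, and everything in \<open>r\<close> exceeds
  everything in \<open>l\<close>. Thus an occurrence of a pattern lies in \<open>l\<close>, in \<open>r\<close>, or is split between these
  parts and the minimum. For example, 321 arises from a descent in \<open>l\<close> followed by the minimum, and
  132 from the minimum followed by a descent in \<open>r\<close>.
\<close>

fun tree21 tree12 tree321 tree231 tree132 tree213 tree123 :: "bintree \<Rightarrow> bool" where
  "tree21 Leaf = True"
| "tree21 (Node l r) = (l = Leaf \<and> tree21 r)"
| "tree12 Leaf = True"
| "tree12 (Node l r) = (r = Leaf \<and> tree12 l)"
| "tree321 Leaf = True"
| "tree321 (Node l r) = (tree21 l \<and> tree321 r)"
| "tree231 Leaf = True"
| "tree231 (Node l r) = (tree12 l \<and> tree231 r)"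
| "tree132 Leaf = True"
| "tree132 (Node l r) = (tree132 l \<and> tree21 r)"
| "tree213 Leaf = True"
| "tree213 (Node l r) = (tree213 l \<and> tree213 r \<and> (l = Leaf \<or> r = Leaf))"
| "tree123 Leaf = True"
| "tree123 (Node l r) = (tree123 l \<and> tree12 r \<and> (r = Leaf \<or> tree12 l))"

context
  fixes h :: "int \<Rightarrow> enat" and x y z :: int
  assumes xy: "x < y" and yz: "y \<le> z"
    and root: "\<forall>c. covers h x c \<longleftrightarrow> x < c \<and> c < y"
    and left: "\<forall>b c. x < b \<and> b < y \<and> covers h b c \<longrightarrow> c < y"
begin

text \<open>
  Here \<open>x\<close> is the root of a tree, \<open>[x + 1, y)\<close> its left and \<open>[y, z)\<close> its right subtree. An inversion
  never leads from the left subtree into the right one.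
\<close>

lemma avoids21_split: "avoids21 h x z \<longleftrightarrow> y = x + 1 \<and> avoids21 h y z"
  unfolding avoids21_def using xy yz root by (smt (verit))

lemma avoids12_split: "avoids12 h x z \<longleftrightarrow> y = z \<and> avoids12 h (x + 1) y"
  unfolding avoids12_def using xy yz root by (smt (verit))

lemma avoids321_split: "avoids321 h x z \<longleftrightarrow> avoids21 h (x + 1) y \<and> avoids321 h y z"
  unfolding avoids21_def avoids321_def using xy yz root left by (smt (verit))

lemma avoids231_split: "avoids231 h x z \<longleftrightarrow> avoids12 h (x + 1) y \<and> avoids231 h y z"
  unfolding avoids12_def avoids231_def using xy yz root left by (smt (verit))

lemma avoids132_split: "avoids132 h x z \<longleftrightarrow> avoids132 h (x + 1) y \<and> avoids21 h y z"
  unfolding avoids21_def avoids132_def using xy yz root left by (smt (verit))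

lemma avoids213_split: "avoids213 h x z \<longleftrightarrow>
    avoids213 h (x + 1) y \<and> avoids213 h y z \<and> (y = x + 1 \<or> z = y)"
  unfolding avoids213_def using xy yz root left by (smt (verit))

lemma avoids123_split: "avoids123 h x z \<longleftrightarrow>
    avoids123 h (x + 1) y \<and> avoids12 h y z \<and> (z = y \<or> avoids12 h (x + 1) y)"
  unfolding avoids123_def avoids12_def using xy yz root left by (smt (verit))

end

lemma capturesI:
  assumes "\<And>h x. A h x x" and "Q Leaf"
    and "\<And>h x l r. follows h x (Node l r) \<Longrightarrow>
      A h (x + 1) (x + 1 + int (size l)) = Q l \<Longrightarrow>
      A h (x + 1 + int (size l)) (x + 1 + int (size l) + int (size r)) = Q r \<Longrightarrow>
      A h x (x + 1 + int (size l) + int (size r)) = Q (Node l r)"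
  shows "captures A Q"
  unfolding captures_def
proof (intro allI impI)
  fix h x t assume "follows h x t"
  then show "A h x (x + int (size t)) \<longleftrightarrow> Q t"
  proof (induction t arbitrary: x)
    case (Node l r)
    have "x + int (size (Node l r)) = x + 1 + int (size l) + int (size r)" by simp
    moreover have "follows h (x + 1) l" "follows h (x + 1 + int (size l)) r"
      using Node.prems by simp_all
    ultimately show ?case
      using assms(3)[OF Node.prems Node.IH(1) Node.IH(2)] by presburger
  qed (simp add: assms)
qed

lemma capturesD: "captures A Q \<Longrightarrow> follows h x t \<Longrightarrow> A h x (x + int (size t)) = Q t"
  by (simp add: captures_def)

lemma size_bintree_eq_0 [simp]: "size t = 0 \<longleftrightarrow> t = Leaf" for t :: bintree
  by (cases t) auto

lemma follows_root:
  assumes "follows h x (Node l r)"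
  shows "x < x + 1 + int (size l)"
    and "x + 1 + int (size l) \<le> x + 1 + int (size l) + int (size r)"
    and "\<forall>c. covers h x c \<longleftrightarrow> x < c \<and> c < x + 1 + int (size l)"
    and "\<forall>b c. x < b \<and> b < x + 1 + int (size l) \<and> covers h b c \<longrightarrow> c < x + 1 + int (size l)"
  using assms follows_within[of h "x + 1" l] by (auto simp: covers_enat)

lemma captures_21: "captures avoids21 tree21"
proof (rule capturesI)
  fix h x l r assume f: "follows h x (Node l r)"
    and "avoids21 h (x + 1 + int (size l)) (x + 1 + int (size l) + int (size r)) = tree21 r"
  then show "avoids21 h x (x + 1 + int (size l) + int (size r)) = tree21 (Node l r)"
    unfolding avoids21_split[OF follows_root[OF f]] by simp
qed (auto simp: avoids21_def)

lemma captures_12: "captures avoids12 tree12"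
proof (rule capturesI)
  fix h x l r assume f: "follows h x (Node l r)"
    and "avoids12 h (x + 1) (x + 1 + int (size l)) = tree12 l"
  then show "avoids12 h x (x + 1 + int (size l) + int (size r)) = tree12 (Node l r)"
    unfolding avoids12_split[OF follows_root[OF f]] by simp
qed (auto simp: avoids12_def)

lemma captures_321: "captures avoids321 tree321"
proof (rule capturesI)
  fix h x l r assume f: "follows h x (Node l r)"
    and "avoids321 h (x + 1 + int (size l)) (x + 1 + int (size l) + int (size r)) = tree321 r"
  then show "avoids321 h x (x + 1 + int (size l) + int (size r)) = tree321 (Node l r)"
    unfolding avoids321_split[OF follows_root[OF f]]
    using capturesD[OF captures_21, of h "x + 1" l] by simp
qed (auto simp: avoids321_def)

lemma captures_231: "captures avoids231 tree231"
proof (rule capturesI)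
  fix h x l r assume f: "follows h x (Node l r)"
    and "avoids231 h (x + 1 + int (size l)) (x + 1 + int (size l) + int (size r)) = tree231 r"
  then show "avoids231 h x (x + 1 + int (size l) + int (size r)) = tree231 (Node l r)"
    unfolding avoids231_split[OF follows_root[OF f]]
    using capturesD[OF captures_12, of h "x + 1" l] by simp
qed (auto simp: avoids231_def)

lemma captures_132: "captures avoids132 tree132"
proof (rule capturesI)
  fix h x l r assume f: "follows h x (Node l r)"
    and "avoids132 h (x + 1) (x + 1 + int (size l)) = tree132 l"
  then show "avoids132 h x (x + 1 + int (size l) + int (size r)) = tree132 (Node l r)"
    unfolding avoids132_split[OF follows_root[OF f]]
    using capturesD[OF captures_21, of h "x + 1 + int (size l)" r] by simp
qed (auto simp: avoids132_def)

lemma captures_213: "captures avoids213 tree213"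
proof (rule capturesI)
  fix h x l r assume f: "follows h x (Node l r)"
    and "avoids213 h (x + 1) (x + 1 + int (size l)) = tree213 l"
    and "avoids213 h (x + 1 + int (size l)) (x + 1 + int (size l) + int (size r)) = tree213 r"
  then show "avoids213 h x (x + 1 + int (size l) + int (size r)) = tree213 (Node l r)"
    unfolding avoids213_split[OF follows_root[OF f]] by simp
qed (auto simp: avoids213_def)

lemma captures_123: "captures avoids123 tree123"
proof (rule capturesI)
  fix h x l r assume f: "follows h x (Node l r)"
    and "avoids123 h (x + 1) (x + 1 + int (size l)) = tree123 l"
  then show "avoids123 h x (x + 1 + int (size l) + int (size r)) = tree123 (Node l r)"
    unfolding avoids123_split[OF follows_root[OF f]]
    using capturesD[OF captures_12, of h "x + 1 + int (size l)" r]
      capturesD[OF captures_12, of h "x + 1" l] by simp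
qed (auto simp: avoids123_def)

section \<open>Codes as periodic tilings, and the number of tiles\<close>

text \<open>
  A finite letter begins a tile that consists of itself and its interval. An infinite letter is a
  tile of its own: its interval does not bind the later letters at all.
\<close>

fun tile_length :: "enat \<Rightarrow> nat" where
  "tile_length (enat k) = Suc k"
| "tile_length \<infinity> = 1"

definition tiles :: "(bintree \<Rightarrow> bool) \<Rightarrow> bool \<Rightarrow> enat list set" where
  "tiles Q infin = (\<lambda>t. letters (Node t Leaf)) ` {t. Q t} \<union> (if infin then {[\<infinity>]} else {})"

lemma letters_within: "i < size t \<Longrightarrow> i + tile_length (letters t ! i) \<le> size t"
proof (induction t arbitrary: i)
  case (Node l r)
  show ?case
  proof (cases i)
    case (Suc j)
    show ?thesis
    proof (cases "j < size l")
      case True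
      then show ?thesis using Node.IH(1)[of j] Suc by (simp add: nth_append)
    next
      case False
      then have "j - size l < size r" using Node.prems Suc by simp
      from Node.IH(2)[OF this] show ?thesis using False Suc by (simp add: nth_append)
    qed
  qed simp
qed simp

text \<open>
  The decomposition of nonempty trees by the size of the left subtree.
\<close>

lemma trees_Suc:
  "{t. size t = Suc k \<and> Q t} =
     (\<Union>i\<le>k. (\<lambda>(l, r). Node l r) ` {(l, r). size l = i \<and> size r = k - i \<and> Q (Node l r)})"
  (is "?L = ?R")
proof (intro equalityI subsetI)
  fix t assume "t \<in> ?L"
  then obtain l r where "t = Node l r" "size l + size r = k" "Q t" by (cases t) auto
  then show "t \<in> ?R" by (intro UN_I[of "size l"]) auto
qed auto

lemma finite_trees: "finite {t :: bintree. size t = k}"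
proof (induction k rule: less_induct)
  case (less k)
  show ?case
  proof (cases k)
    case (Suc j)
    have "finite {(l :: bintree, r :: bintree). size l = i \<and> size r = j - i}" if "i \<le> j" for i
    proof -
      have "{(l :: bintree, r :: bintree). size l = i \<and> size r = j - i} =
          {l. size l = i} \<times> {r. size r = j - i}" by auto
      then show ?thesis using less[of i] less[of "j - i"] that Suc by auto
    qed
    then show ?thesis using trees_Suc[of j "\<lambda>_. True"] Suc by simp
  qed simp
qed

lemma finite_trees_Q [simp]: "finite {t :: bintree. size t = k \<and> Q t}"
  by (rule finite_subset[OF _ finite_trees[of k]]) auto

interpretation tile: block_code tile_length "tiles Q infin" for Q infin
proof
  fix u assume u: "u \<in> tiles Q infin"
  then show "u \<noteq> []" by (auto simp: tiles_def split: if_splits)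
  from u show "tile_length (hd u) = length u" by (auto simp: tiles_def split: if_splits)
  fix i assume "i < length u"
  with u show "i + tile_length (u ! i) \<le> length u"
  proof (cases "u = [\<infinity>]")
    case False
    then obtain t where "u = letters (Node t Leaf)" using u by (auto simp: tiles_def split: if_splits)
    then show ?thesis using letters_within[of i "Node t Leaf"] \<open>i < length u\<close> by simp
  qed auto
next
  fix m
  have "{u \<in> tiles Q infin. length u = m} \<subseteq>
      insert [\<infinity>] ((\<lambda>t. letters (Node t Leaf)) ` {t. size t = m - 1})"
  proof
    fix u assume u: "u \<in> {u \<in> tiles Q infin. length u = m}"
    show "u \<in> insert [\<infinity>] ((\<lambda>t. letters (Node t Leaf)) ` {t. size t = m - 1})"
    proof (cases "u = [\<infinity>]")
      case False
      then obtain t where t: "u = letters (Node t Leaf)"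
        using u by (auto simp: tiles_def split: if_splits)
      then have "size t = m - 1" using u by auto
      then show ?thesis using t by blast
    qed simp
  qed
  then show "finite {u \<in> tiles Q infin. length u = m}"
    by (rule finite_subset) (simp add: finite_trees)
qed

lemma card_tile_blocks:
  "card (tile.blocks Q infin m) =
     (if m = 0 then 0 else card {t. size t = m - 1 \<and> Q t} + (if infin \<and> m = 1 then 1 else 0))"
proof (cases m)
  case 0
  then show ?thesis by (simp add: tile.blocks_0)
next
  case (Suc k)
  define f where "f t = letters (Node t Leaf)" for t
  have len: "length (f t) = m \<longleftrightarrow> size t = k" for t using Suc by (simp add: f_def)
  have inj: "inj f" unfolding f_def by (rule injI) (drule letters_inject[THEN iffD1], erule bintree.inject[THEN iffD1, THEN conjunct1])
  have fin: "f t \<noteq> [\<infinity>]" for t by (simp add: f_def)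
  let ?A = "f ` {t. size t = k \<and> Q t}"
  have T: "tiles Q infin = f ` {t. Q t} \<union> (if infin then {[\<infinity>]} else {})"
    unfolding tiles_def f_def by (rule refl)
  have 1: "{u \<in> f ` {t. Q t}. length u = m} = ?A"
    unfolding len[symmetric] by blast
  have 2: "{u \<in> (if infin then {[\<infinity>]} else {}). length u = m} =
      (if infin \<and> m = 1 then {[\<infinity> :: enat]} else {})"
    by (cases infin; cases "m = 1") auto
  have "{u \<in> A \<union> B. length u = m} = {u \<in> A. length u = m} \<union> {u \<in> B. length u = m}"
    for A B :: "enat list set" by blast
  then have "{u \<in> tiles Q infin. length u = m} = ?A \<union> (if infin \<and> m = 1 then {[\<infinity>]} else {})"
    by (simp only: T 1 2)
  then have eq: "tile.blocks Q infin m = ?A \<union> (if infin \<and> m = 1 then {[\<infinity>]} else {})"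
    by (simp only: tile.blocks_def)
  have A: "card ?A = card {t. size t = k \<and> Q t}"
    by (rule card_image) (rule inj_on_subset[OF inj subset_UNIV])
  have "[\<infinity>] \<notin> ?A" 
  proof
    assume "[\<infinity>] \<in> ?A"
    then obtain t where "[\<infinity>] = f t" by (rule imageE)
    then show False using fin[of t] by simp
  qed
  moreover have "finite ?A" by (rule finite_imageI) (rule finite_trees_Q)
  ultimately have "card (?A \<union> {[\<infinity>]}) = card ?A + 1" by simp
  then have "card (tile.blocks Q infin m) = card ?A + (if infin \<and> m = 1 then 1 else 0)"
    unfolding eq by (simp split: if_split)
  then show ?thesis unfolding A Suc by (simp only: nat.simps if_False diff_Suc_1)
qed

lemma follows_tile: "follows h x (Node t Leaf) \<longleftrightarrow> window h x (Suc (size t)) = letters (Node t Leaf)"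
  unfolding follows_def by simp

text \<open>
  An infinite letter cannot lie in a finite interval, so it is a boundary. If there is no infinite
  letter, a position with the largest letter is a boundary, as an interval that covers this position
  would have to be longer.
\<close>

lemma starts_nonempty:
  assumes h: "h \<in> interior_codes Q n" and n: "n > 0"
  shows "tile.starts h \<noteq> {}"
proof -
  have per: "periodic n h" using h by (simp add: interior_codes_def)
  have nest: "nested h" using h interior_codes_subset by (auto simp: codes_def)
  have start: "a \<in> tile.starts h" if a: "\<And>y. y < a \<Longrightarrow> h y \<noteq> \<infinity> \<Longrightarrow> \<not> covers h y a" for a
    unfolding tile.starts_def
  proof safe
    fix y assume y: "y < a"
    show "y + int (tile_length (h y)) \<le> a"
    proof (cases "h y")
      case (enat k)
      then show ?thesis using a[OF y] y by (simp add: covers_enat)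
    qed (use y in simp)
  qed
  show ?thesis
  proof (cases "\<exists>a. h a = \<infinity>")
    case True
    then obtain a where a: "h a = \<infinity>" by blast
    have "a \<in> tile.starts h"
    proof (rule start)
      fix y assume y: "y < a" "h y \<noteq> \<infinity>"
      then obtain k where k: "h y = enat k" by auto
      show "\<not> covers h y a"
      proof
        assume c: "covers h y a"
        have "covers h a (y + int k + 1)" using c k a by (simp add: covers_infinity covers_enat)
        from nestedD[OF nest c this] show False using k by (simp add: covers_enat)
      qed
    qed
    then show ?thesis by blast
  next
    case False
    have "finite (h ` {0..<int n})" "h ` {0..<int n} \<noteq> {}" using n by auto
    then obtain a where a: "\<And>x. x \<in> {0..<int n} \<Longrightarrow> h x \<le> h a"
      using Max_in[of "h ` {0..<int n}"] Max_ge[of "h ` {0..<int n}"] by (metis imageE image_eqI)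
    have max: "h x \<le> h a" for x
    proof -
      have "h (x mod int n) \<le> h a" using a n by simp
      moreover have "x mod int n + (x div int n) * int n = x" by simp
      ultimately show ?thesis using periodic_shift[OF per] by metis
    qed
    have "a \<in> tile.starts h"
    proof (rule start)
      fix y assume y: "y < a"
      obtain k where k: "h y = enat k" using False by (meson enat.exhaust)
      obtain m where m: "h a = enat m" using False by (meson enat.exhaust)
      show "\<not> covers h y a"
      proof
        assume c: "covers h y a"
        have "covers h y (a + int m)"
        proof (cases "m = 0")
          case False
          then have "covers h a (a + int m)" using m by (simp add: covers_enat)
          then show ?thesis using nestedD[OF nest c] by blast
        qed (use c in simp)
        then have "a + int m \<le> y + int k" using k by (simp add: covers_enat)
        moreover have "k \<le> m" using max[of y] k m by simp
        ultimately show False using y by simp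
      qed
    qed
    then show ?thesis by blast
  qed
qed

text \<open>
  Inside an infinite interval nothing is required beyond the conditions on finite letters, and each
  finite letter lies in one tile together with its interval. For hereditary \<open>Q\<close> it is therefore enough
  to require \<open>Q\<close> for the maximal finite intervals.
\<close>

lemma interior_codes_tilings:
  assumes n: "n > 0" and Q: "hereditary Q"
  shows "{h \<in> interior_codes Q n. infin \<or> (\<forall>a. h a \<noteq> \<infinity>)} = tile.tilings Q infin n"
proof (intro equalityI subsetI)
  fix h assume "h \<in> {h \<in> interior_codes Q n. infin \<or> (\<forall>a. h a \<noteq> \<infinity>)}"
  then have h: "h \<in> interior_codes Q n" and i: "infin \<or> h a \<noteq> \<infinity>" for a by auto
  have "window h x (tile_length (h x)) \<in> tiles Q infin" for x
  proof (cases "h x")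
    case (enat k)
    then obtain t where t: "Q t" "size t = k" "follows h (x + 1) t"
      using h unfolding interior_codes_def by blast
    then have "follows h x (Node t Leaf)" using enat by simp
    then have "window h x (tile_length (h x)) = letters (Node t Leaf)"
      unfolding follows_tile using t enat by simp
    then show ?thesis using t(1) unfolding tiles_def by blast
  next
    case infinity
    then show ?thesis using i[of x] by (simp add: tiles_def window_def)
  qed
  then show "h \<in> tile.tilings Q infin n"
    using h starts_nonempty[OF h n] by (simp add: tile.tilings_def interior_codes_def)
next
  fix h assume h: "h \<in> tile.tilings Q infin n"
  then have per: "periodic n h" by (simp add: tile.tilings_def)
  have loc: "(h a = \<infinity> \<and> infin) \<or> (\<exists>t. Q t \<and> h a = enat (size t) \<and> follows h (a + 1) t)" for a
  proof -
    obtain x where x: "x \<in> tile.starts h" "x \<le> a" "a < x + int (tile_length (h x))"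
      using tile.exists_tile[OF n h] by blast
    define u where "u = window h x (tile_length (h x))"
    have u: "u \<in> tiles Q infin" using h x by (auto simp: tile.tilings_def u_def)
    show ?thesis
    proof (cases "u = [\<infinity>]")
      case True
      then have l: "tile_length (h x) = 1" unfolding u_def by (metis length_window length_Cons list.size(3) One_nat_def)
      then have "h x = \<infinity>" using True by (simp add: u_def window_def)
      moreover have "a = x" using x l by simp
      moreover have "infin" using u True by (auto simp: tiles_def split: if_splits)
      ultimately show ?thesis by simp
    next
      case False
      then obtain t where t: "Q t" "u = letters (Node t Leaf)"
        using u by (auto simp: tiles_def split: if_splits)
      have l: "tile_length (h x) = Suc (size t)"
        using arg_cong[OF t(2), of length] by (simp add: u_def)
      have f: "follows h x (Node t Leaf)"
        unfolding follows_tile using t(2) l by (simp add: u_def)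
      show ?thesis
      proof (cases "a = x")
        case True
        then show ?thesis using t f by auto
      next
        case False
        have "follows h (x + 1) t" "x + 1 \<le> a" "a < x + 1 + int (size t)"
          using f False x l by auto
        then show ?thesis using follows_subtree[of h "x + 1" t Q a] t(1) Q by blast
      qed
    qed
  qed
  have "infin \<or> h a \<noteq> \<infinity>" for a using loc[of a] by auto
  moreover have "\<exists>t. Q t \<and> size t = k \<and> follows h (a + 1) t" if "h a = enat k" for a k
    using loc[of a] that by auto
  ultimately show "h \<in> {h \<in> interior_codes Q n. infin \<or> (\<forall>a. h a \<noteq> \<infinity>)}"
    using per by (auto simp: interior_codes_def)
qed

lemma card_trees_Suc:
  "card {t. size t = Suc k \<and> Q t} =
     (\<Sum>i\<le>k. card {(l, r). size l = i \<and> size r = k - i \<and> Q (Node l r)})"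
proof -
  let ?S = "\<lambda>i. {(l, r). size l = i \<and> size r = k - i \<and> Q (Node l r)}"
  have "finite (?S i)" for i
    by (rule finite_subset[of _ "{l. size l = i} \<times> {r. size r = k - i}"])
       (auto intro: finite_cartesian_product finite_trees)
  then have "card {t. size t = Suc k \<and> Q t} = (\<Sum>i\<le>k. card ((\<lambda>(l, r). Node l r) ` ?S i))"
    unfolding trees_Suc by (subst card_UN_disjoint) auto
  also have "\<dots> = (\<Sum>i\<le>k. card (?S i))"
    by (intro sum.cong refl card_image) (auto intro!: inj_onI)
  finally show ?thesis .
qed

lemma card_trees_product:
  assumes "\<And>l r. Q (Node l r) \<longleftrightarrow> P l \<and> R r"
  shows "card {t. size t = Suc k \<and> Q t} =
     (\<Sum>i\<le>k. card {t. size t = i \<and> P t} * card {t. size t = k - i \<and> R t})"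
proof -
  have "{(l, r). size l = i \<and> size r = k - i \<and> Q (Node l r)} =
      {t. size t = i \<and> P t} \<times> {t. size t = k - i \<and> R t}" for i
    by (auto simp: assms)
  then show ?thesis by (simp add: card_trees_Suc card_cartesian_product)
qed

lemma card_Leaf: "card {t. size t = k \<and> t = Leaf} = (if k = 0 then 1 else 0)"
  by (cases k) (auto simp: Collect_conv_if)

lemma card_tree21: "card {t. size t = k \<and> tree21 t} = 1"
proof (induction k)
  case (Suc k)
  have "card {t. size t = Suc k \<and> tree21 t} =
      (\<Sum>i\<le>k. card {t. size t = i \<and> t = Leaf} * card {t. size t = k - i \<and> tree21 t})"
    by (rule card_trees_product) simp
  also have "\<dots> = (\<Sum>i\<in>{0}. card {t. size t = k - i \<and> tree21 t})"
    unfolding card_Leaf by (rule sum.mono_neutral_cong_right) auto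
  finally show ?case using Suc by simp
qed (simp add: Collect_conv_if)

lemma card_tree12: "card {t. size t = k \<and> tree12 t} = 1"
proof (induction k)
  case (Suc k)
  have "card {t. size t = Suc k \<and> tree12 t} =
      (\<Sum>i\<le>k. card {t. size t = i \<and> tree12 t} * card {t. size t = k - i \<and> t = Leaf})"
    by (rule card_trees_product) auto
  also have "\<dots> = (\<Sum>i\<in>{k}. card {t. size t = i \<and> tree12 t})"
    unfolding card_Leaf by (rule sum.mono_neutral_cong_right) auto
  finally show ?case using Suc by simp
qed (simp add: Collect_conv_if)

lemma doubling_sum: "(\<Sum>i\<le>k. (2::nat) ^ (i - 1)) = 2 ^ k"
  by (induction k) auto

lemma card_tree321: "card {t. size t = k \<and> tree321 t} = 2 ^ (k - 1)"
proof (induction k rule: less_induct)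
  case (less k)
  show ?case
  proof (cases k)
    case (Suc j)
    have "card {t. size t = Suc j \<and> tree321 t} =
        (\<Sum>i\<le>j. card {t. size t = i \<and> tree21 t} * card {t. size t = j - i \<and> tree321 t})"
      by (rule card_trees_product) simp
    also have "\<dots> = (\<Sum>i\<le>j. 2 ^ (j - i - 1))"
      by (intro sum.cong refl) (use less Suc in \<open>simp add: card_tree21\<close>)
    also have "\<dots> = (\<Sum>i\<le>j. 2 ^ (i - 1))"
      by (rule sum.reindex_bij_witness[of _ "\<lambda>i. j - i" "\<lambda>i. j - i"]) auto
    finally show ?thesis using Suc doubling_sum by simp
  qed (simp add: Collect_conv_if)
qed

lemma card_tree231: "card {t. size t = k \<and> tree231 t} = 2 ^ (k - 1)"
proof (induction k rule: less_induct)
  case (less k)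
  show ?case
  proof (cases k)
    case (Suc j)
    have "card {t. size t = Suc j \<and> tree231 t} =
        (\<Sum>i\<le>j. card {t. size t = i \<and> tree12 t} * card {t. size t = j - i \<and> tree231 t})"
      by (rule card_trees_product) simp
    also have "\<dots> = (\<Sum>i\<le>j. 2 ^ (j - i - 1))"
      by (intro sum.cong refl) (use less Suc in \<open>simp add: card_tree12\<close>)
    also have "\<dots> = (\<Sum>i\<le>j. 2 ^ (i - 1))"
      by (rule sum.reindex_bij_witness[of _ "\<lambda>i. j - i" "\<lambda>i. j - i"]) auto
    finally show ?thesis using Suc doubling_sum by simp
  qed (simp add: Collect_conv_if)
qed

lemma card_tree132: "card {t. size t = k \<and> tree132 t} = 2 ^ (k - 1)"
proof (induction k rule: less_induct)
  case (less k)
  show ?case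
  proof (cases k)
    case (Suc j)
    have "card {t. size t = Suc j \<and> tree132 t} =
        (\<Sum>i\<le>j. card {t. size t = i \<and> tree132 t} * card {t. size t = j - i \<and> tree21 t})"
      by (rule card_trees_product) simp
    also have "\<dots> = (\<Sum>i\<le>j. 2 ^ (i - 1))"
      by (intro sum.cong refl) (use less Suc in \<open>simp add: card_tree21\<close>)
    finally show ?thesis using Suc doubling_sum by simp
  qed (simp add: Collect_conv_if)
qed

text \<open>
  In a tree with at least two nodes exactly one of the two subtrees of the root is empty, so removing
  the root is two-to-one.
\<close>

lemma card_tree213: "card {t. size t = k \<and> tree213 t} = 2 ^ (k - 1)"
proof (induction k)
  case (Suc k)
  show ?case
  proof (cases "k = 0")
    case True
    have "{t. size t = Suc 0 \<and> tree213 t} = {Node Leaf Leaf}"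
    proof (intro equalityI subsetI)
      fix t assume "t \<in> {t. size t = Suc 0 \<and> tree213 t}"
      then show "t \<in> {Node Leaf Leaf}" by (cases t) auto
    qed simp
    then show ?thesis using True by simp
  next
    case False
    let ?T = "{t. size t = k \<and> tree213 t}"
    have "{t. size t = Suc k \<and> tree213 t} = (\<lambda>l. Node l Leaf) ` ?T \<union> (\<lambda>r. Node Leaf r) ` ?T"
      (is "?L = ?R")
    proof (intro equalityI subsetI)
      fix t assume "t \<in> ?L"
      then show "t \<in> ?R" by (cases t) auto
    qed auto
    moreover have "card ?R = card ?T + card ?T"
    proof (subst card_Un_disjoint)
      show "(\<lambda>l. Node l Leaf) ` ?T \<inter> (\<lambda>r. Node Leaf r) ` ?T = {}" using False by auto
    qed (auto simp: card_image inj_on_def)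
    ultimately show ?thesis using Suc False by (cases k) auto
  qed
qed (simp add: Collect_conv_if)

text \<open>
  If the right subtree is empty, the left one is arbitrary; otherwise both are the unique trees of
  their size that avoid 12. Hence the number of trees grows by \<open>k\<close> from size \<open>k\<close> to size \<open>k + 1\<close>.
\<close>

lemma card_tree123: "card {t. size t = k \<and> tree123 t} = (k choose 2) + 1"
proof (induction k)
  case (Suc k)
  let ?S = "\<lambda>i. {(l, r). size l = i \<and> size r = k - i \<and> tree123 (Node l r)}"
  have tree12_123: "tree123 t" if "tree12 t" for t
    using that by (induction t) auto
  have last: "card (?S k) = (k choose 2) + 1"
  proof -
    have "?S k = {t. size t = k \<and> tree123 t} \<times> {Leaf}" by auto
    then show ?thesis using Suc by (simp add: card_cartesian_product)
  qed
  have init: "card (?S i) = 1" if "i < k" for i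
  proof -
    have "?S i = {t. size t = i \<and> tree12 t} \<times> {t. size t = k - i \<and> tree12 t}"
      using that tree12_123 by auto
    then show ?thesis by (simp add: card_cartesian_product card_tree12)
  qed
  have "card {t. size t = Suc k \<and> tree123 t} = (\<Sum>i<k. card (?S i)) + card (?S k)"
    unfolding card_trees_Suc lessThan_Suc_atMost[symmetric] by simp
  also have "\<dots> = k + ((k choose 2) + 1)" using init last by simp
  finally show ?case by (simp add: numeral_2_eq_2)
qed (simp add: Collect_conv_if)

lemma hereditary_trees:
  "hereditary (\<lambda>t. t = Leaf)" "hereditary tree21" "hereditary tree12" "hereditary tree321"
  "hereditary tree231" "hereditary tree132" "hereditary tree213" "hereditary tree123"
proof -
  have 1: "tree21 t \<Longrightarrow> tree321 t" "tree21 t \<Longrightarrow> tree132 t" for t by (induction t) auto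
  have 2: "tree12 t \<Longrightarrow> tree231 t" "tree12 t \<Longrightarrow> tree123 t" for t by (induction t) auto
  show "hereditary (\<lambda>t. t = Leaf)" "hereditary tree21" "hereditary tree12" "hereditary tree321"
    "hereditary tree231" "hereditary tree132" "hereditary tree213" "hereditary tree123"
    using 1 2 by (simp_all add: hereditary_def)
qed

section \<open>Pattern avoidance in terms of codes\<close>

text \<open>
  If \<open>a\<close> covered \<open>a + n\<close>, it would also cover everything that its translate covers, so that \<open>h a\<close>
  would exceed itself by \<open>n\<close>.
\<close>

lemma finite_letter_below_period:
  assumes "h \<in> codes n" "n > 0" "h a \<noteq> \<infinity>" "b \<ge> a + int n"
  shows "\<not> covers h a b"
proof
  assume c: "covers h a b"
  have nest: "nested h" and per: "periodic n h" using assms by (auto simp: codes_def)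
  obtain k where k: "h a = enat k" using assms(3) by auto
  have n: "int n \<le> int k" using c k assms(4) by (simp add: covers_enat)
  then have c1: "covers h a (a + int n)" using k assms(2) by (simp add: covers_enat)
  have "h (a + int n) = enat k" using per k by (simp add: periodic_def)
  then have "covers h (a + int n) (a + int n + int k)"
    using n assms(2) by (simp add: covers_enat)
  from nestedD[OF nest c1 this] show False using k assms(2) by (simp add: covers_enat)
qed

lemma code_shift: "h \<in> codes n \<Longrightarrow> h (a + i * int n) = h a"
  using periodic_shift by (auto simp: codes_def)

lemma covers_trans: "h \<in> codes n \<Longrightarrow> covers h a b \<Longrightarrow> covers h b c \<Longrightarrow> covers h a c"
  using nestedD by (auto simp: codes_def)

lemma far_copy:
  assumes "h \<in> codes n" "n > 0"
  shows "\<exists>a'>b. h a' = h a" and "\<exists>a'<b. h a' = h a"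
proof -
  define i where "i = \<bar>b - a\<bar> + 1"
  have "i * 1 \<le> i * int n" using assms(2) by (intro mult_left_mono) (auto simp: i_def)
  moreover have "b - a < i" "a - b < i" unfolding i_def by linarith+
  ultimately have i: "b < a + i * int n" "a + (- i) * int n < b" by (simp_all, linarith+)
  show "\<exists>a'>b. h a' = h a" using i(1) code_shift[OF assms(1)] by blast
  show "\<exists>a'<b. h a' = h a" using i(2) code_shift[OF assms(1)] by blast
qed

lemma code_contains:
  shows contains_1234: "contains_pattern (code_order h) [1, 2, 3, 4] \<longleftrightarrow> (\<exists>a b c d. a < b \<and> b < c \<and> c < d \<and>
      \<not> covers h a b \<and> \<not> covers h b c \<and> \<not> covers h c d)"
    and contains_1243: "contains_pattern (code_order h) [1, 2, 4, 3] \<longleftrightarrow> (\<exists>a b c d. a < b \<and> b < c \<and> c < d \<and>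
      \<not> covers h a b \<and> \<not> covers h b d \<and> covers h c d)"
    and contains_1324: "contains_pattern (code_order h) [1, 3, 2, 4] \<longleftrightarrow> (\<exists>a b c d. a < b \<and> b < c \<and> c < d \<and>
      \<not> covers h a c \<and> covers h b c \<and> \<not> covers h b d)"
    and contains_2134: "contains_pattern (code_order h) [2, 1, 3, 4] \<longleftrightarrow> (\<exists>a b c d. a < b \<and> b < c \<and> c < d \<and>
      covers h a b \<and> \<not> covers h a c \<and> \<not> covers h c d)"
    and contains_2143: "contains_pattern (code_order h) [2, 1, 4, 3] \<longleftrightarrow> (\<exists>a b c d. a < b \<and> b < c \<and> c < d \<and>
      covers h a b \<and> \<not> covers h a d \<and> covers h c d)"
    and contains_1432: "contains_pattern (code_order h) [1, 4, 3, 2] \<longleftrightarrow> (\<exists>a b c d. a < b \<and> b < c \<and> c < d \<and>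
      \<not> covers h a d \<and> covers h c d \<and> covers h b c)"
    and contains_1342: "contains_pattern (code_order h) [1, 3, 4, 2] \<longleftrightarrow> (\<exists>a b c d. a < b \<and> b < c \<and> c < d \<and>
      \<not> covers h a c \<and> \<not> covers h c d \<and> covers h b d)"
    and contains_3214: "contains_pattern (code_order h) [3, 2, 1, 4] \<longleftrightarrow> (\<exists>a b c d. a < b \<and> b < c \<and> c < d \<and>
      covers h b c \<and> covers h a b \<and> \<not> covers h a d)"
    and contains_2314: "contains_pattern (code_order h) [2, 3, 1, 4] \<longleftrightarrow> (\<exists>a b c d. a < b \<and> b < c \<and> c < d \<and>
      \<not> covers h b c \<and> covers h a c \<and> \<not> covers h a d)"
    and contains_3241: "contains_pattern (code_order h) [3, 2, 4, 1] \<longleftrightarrow> (\<exists>a b c d. a < b \<and> b < c \<and> c < d \<and>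
      covers h b c \<and> \<not> covers h b d \<and> covers h a d)"
    and contains_4321: "contains_pattern (code_order h) [4, 3, 2, 1] \<longleftrightarrow> (\<exists>a b c d. a < b \<and> b < c \<and> c < d \<and>
      covers h c d \<and> covers h b c \<and> covers h a b)"
    and contains_3421: "contains_pattern (code_order h) [3, 4, 2, 1] \<longleftrightarrow> (\<exists>a b c d. a < b \<and> b < c \<and> c < d \<and>
      \<not> covers h c d \<and> covers h b d \<and> covers h a b)"
    and contains_2431: "contains_pattern (code_order h) [2, 4, 3, 1] \<longleftrightarrow> (\<exists>a b c d. a < b \<and> b < c \<and> c < d \<and>
      \<not> covers h b d \<and> covers h c d \<and> covers h a c)"
    and contains_2341: "contains_pattern (code_order h) [2, 3, 4, 1] \<longleftrightarrow> (\<exists>a b c d. a < b \<and> b < c \<and> c < d \<and>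
      \<not> covers h b c \<and> \<not> covers h c d \<and> covers h a d)"
  by (subst contains_pattern_4, simp,
      intro ex_cong1 conj_cong refl, simp add: code_order_less code_order_greater)+

text \<open>
  The condition \<open>A\<close> for the interior of every finite interval.
\<close>

definition all_interiors :: "((int \<Rightarrow> enat) \<Rightarrow> int \<Rightarrow> int \<Rightarrow> bool) \<Rightarrow> (int \<Rightarrow> enat) \<Rightarrow> bool" where
  "all_interiors A h \<longleftrightarrow> (\<forall>a k. h a = enat k \<longrightarrow> A h (a + 1) (a + 1 + int k))"

lemma all_interiors_pair:
  assumes "\<And>x z. A h x z \<longleftrightarrow> (\<forall>b c. x \<le> b \<and> b < c \<and> c < z \<longrightarrow> P b c)"
  shows "all_interiors A h \<longleftrightarrow>
    (\<forall>a b c. a < b \<longrightarrow> b < c \<longrightarrow> h a \<noteq> \<infinity> \<longrightarrow> covers h a c \<longrightarrow> P b c)"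
proof (intro iffI allI impI)
  fix a b c assume "all_interiors A h" "a < b" "b < c" "h a \<noteq> \<infinity>" "covers h a c"
  moreover from \<open>h a \<noteq> \<infinity>\<close> obtain k where k: "h a = enat k" by auto
  ultimately have "A h (a + 1) (a + 1 + int k)" "c < a + 1 + int k"
    by (simp_all add: all_interiors_def covers_enat)
  then show "P b c" using assms \<open>a < b\<close> \<open>b < c\<close> by simp
next
  assume *: "\<forall>a b c. a < b \<longrightarrow> b < c \<longrightarrow> h a \<noteq> \<infinity> \<longrightarrow> covers h a c \<longrightarrow> P b c"
  show "all_interiors A h" unfolding all_interiors_def assms
  proof (intro allI impI)
    fix a k b c assume "h a = enat k" "a + 1 \<le> b \<and> b < c \<and> c < a + 1 + int k"
    then show "P b c" using *[rule_format, of a b c] by (simp add: covers_enat)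
  qed
qed

lemma all_interiors_triple:
  assumes "\<And>x z. A h x z \<longleftrightarrow> (\<forall>b c d. x \<le> b \<and> b < c \<and> c < d \<and> d < z \<longrightarrow> P b c d)"
  shows "all_interiors A h \<longleftrightarrow>
    (\<forall>a b c d. a < b \<longrightarrow> b < c \<longrightarrow> c < d \<longrightarrow> h a \<noteq> \<infinity> \<longrightarrow> covers h a d \<longrightarrow> P b c d)"
proof (intro iffI allI impI)
  fix a b c d assume "all_interiors A h" "a < b" "b < c" "c < d" "h a \<noteq> \<infinity>" "covers h a d"
  moreover from \<open>h a \<noteq> \<infinity>\<close> obtain k where k: "h a = enat k" by auto
  ultimately have "A h (a + 1) (a + 1 + int k)" "d < a + 1 + int k"
    by (simp_all add: all_interiors_def covers_enat)
  then show "P b c d" using assms \<open>a < b\<close> \<open>b < c\<close> \<open>c < d\<close> by simp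
next
  assume *: "\<forall>a b c d. a < b \<longrightarrow> b < c \<longrightarrow> c < d \<longrightarrow> h a \<noteq> \<infinity> \<longrightarrow> covers h a d \<longrightarrow> P b c d"
  show "all_interiors A h" unfolding all_interiors_def assms
  proof (intro allI impI)
    fix a k b c d
    assume "h a = enat k" "a + 1 \<le> b \<and> b < c \<and> c < d \<and> d < a + 1 + int k"
    then show "P b c d" using *[rule_format, of a b c d] by (simp add: covers_enat)
  qed
qed

lemmas all_interiors_simps =
  all_interiors_pair[of avoids21, OF avoids21_def] all_interiors_pair[of avoids12, OF avoids12_def]
  all_interiors_triple[of avoids321, OF avoids321_def] all_interiors_triple[of avoids231, OF avoids231_def]
  all_interiors_triple[of avoids132, OF avoids132_def] all_interiors_triple[of avoids213, OF avoids213_def]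
  all_interiors_triple[of avoids123, OF avoids123_def]

lemma covers_next: "h a \<noteq> 0 \<Longrightarrow> covers h a (a + 1)"
  by (cases "h a") (auto simp: covers_def one_enat_def[symmetric] zero_enat_def Suc_le_eq)

context
  fixes h :: "int \<Rightarrow> enat" and n :: nat
  assumes h: "h \<in> codes n" and n: "n > 0"
begin

lemma far: "h a \<noteq> \<infinity> \<Longrightarrow> a + int n \<le> b \<Longrightarrow> \<not> covers h a b"
  using finite_letter_below_period[OF h n] by blast

lemma copies:
  "h (a + int n) = h a" "h (a + 2 * int n) = h a" "h (a + 3 * int n) = h a" "h (a - int n) = h a"
  using code_shift[OF h, of a 1] code_shift[OF h, of a 2] code_shift[OF h, of a 3]
    code_shift[OF h, of a "-1"] by simp_all

text \<open>
  A finite letter together with its translates increases forever.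
\<close>

lemma avoids_1234: "\<not> contains_pattern (code_order h) [1, 2, 3, 4] \<longleftrightarrow> (\<forall>a. h a = \<infinity>)"
proof
  assume "\<forall>a. h a = \<infinity>"
  then show "\<not> contains_pattern (code_order h) [1, 2, 3, 4]"
    unfolding contains_1234 by (metis covers_infinity)
next
  assume av: "\<not> contains_pattern (code_order h) [1, 2, 3, 4]"
  show "\<forall>a. h a = \<infinity>"
  proof (rule ccontr)
    assume "\<not> (\<forall>a. h a = \<infinity>)"
    then obtain a where a: "h a \<noteq> \<infinity>" by blast
    have "contains_pattern (code_order h) [1, 2, 3, 4]"
      unfolding contains_1234
      by (intro exI[of _ a] exI[of _ "a + int n"] exI[of _ "a + 2 * int n"] exI[of _ "a + 3 * int n"] conjI far)
         (use a n copies in auto)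
    with av show False by blast
  qed
qed

text \<open>
  A finite letter has two increasing copies far to the left of any inversion.
\<close>

lemma avoids_1243:
  "\<not> contains_pattern (code_order h) [1, 2, 4, 3] \<longleftrightarrow> (\<forall>a. h a = \<infinity>) \<or> (\<forall>a. h a = 0)"
proof
  assume "(\<forall>a. h a = \<infinity>) \<or> (\<forall>a. h a = 0)"
  then show "\<not> contains_pattern (code_order h) [1, 2, 4, 3]"
    unfolding contains_1243
    by (auto simp: covers_infinity covers_def zero_enat_def)
next
  assume av: "\<not> contains_pattern (code_order h) [1, 2, 4, 3]"
  show "(\<forall>a. h a = \<infinity>) \<or> (\<forall>a. h a = 0)"
  proof (rule ccontr)
    assume "\<not> ?thesis"
    then obtain a0 c where a0: "h a0 \<noteq> \<infinity>" and c: "h c \<noteq> 0" by blast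
    obtain a where a: "a < c - 2 * int n" "h a = h a0" using far_copy(2)[OF h n] by blast
    have "contains_pattern (code_order h) [1, 2, 4, 3]"
      unfolding contains_1243
      by (intro exI[of _ a] exI[of _ "a + int n"] exI[of _ c] exI[of _ "c + 1"] conjI far covers_next)
         (use a a0 c n copies in auto)
    with av show False by blast
  qed
qed

text \<open>
  An inversion at a finite nonzero letter can be extended by translates of itself that are far away,
  to the right for 2134 and 2143 and to both sides for 1324.
\<close>

lemma avoids_zero_or_infinity:
  assumes "q \<in> {[2, 1, 3, 4], [2, 1, 4, 3], [1, 3, 2, 4]}"
  shows "\<not> contains_pattern (code_order h) q \<longleftrightarrow> (\<forall>a. h a = \<infinity> \<or> h a = 0)"
proof
  assume "\<forall>a. h a = \<infinity> \<or> h a = 0"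
  then have "\<not> (covers h a b \<and> \<not> covers h a c)" if "a < c" for a b c
    using that by (metis covers_def covers_infinity enat_ord_simps(1) le_zero_eq nat_0_iff zero_enat_def not_le diff_gt_0_iff_gt)
  then show "\<not> contains_pattern (code_order h) q"
    using assms by (auto simp: contains_2134 contains_2143 contains_1324 simp del: One_nat_def dest: less_trans)
next
  assume av: "\<not> contains_pattern (code_order h) q"
  show "\<forall>a. h a = \<infinity> \<or> h a = 0"
  proof (rule ccontr)
    assume "\<not> ?thesis"
    then obtain a where a: "h a \<noteq> \<infinity>" "h a \<noteq> 0" by blast
    have "contains_pattern (code_order h) [2, 1, 3, 4]"
      unfolding contains_2134
      by (intro exI[of _ a] exI[of _ "a + 1"] exI[of _ "a + 2 * int n"] exI[of _ "a + 3 * int n"] conjI far covers_next)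
         (use a n copies in auto)
    moreover have "contains_pattern (code_order h) [2, 1, 4, 3]"
      unfolding contains_2143
      by (intro exI[of _ a] exI[of _ "a + 1"] exI[of _ "a + 2 * int n"] exI[of _ "a + 2 * int n + 1"] conjI far covers_next)
         (use a n copies in auto)
    moreover have "contains_pattern (code_order h) [1, 3, 2, 4]"
      unfolding contains_1324
      by (intro exI[of _ "a - int n"] exI[of _ a] exI[of _ "a + 1"] exI[of _ "a + 1 + int n"] conjI far covers_next)
         (use a n copies in auto)
    ultimately show False using av assms by blast
  qed
qed

lemma trans_covers: "covers h a b \<Longrightarrow> covers h b c \<Longrightarrow> covers h a c"
  by (rule covers_trans[OF h])

lemma infinite_right: "h a = \<infinity> \<Longrightarrow> \<exists>b>x. h b = \<infinity>"
  using far_copy(1)[OF h n, of x a] by auto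

lemma finite_right: "h a \<noteq> \<infinity> \<Longrightarrow> \<exists>b>x. h b \<noteq> \<infinity>"
  using far_copy(1)[OF h n, of x a] by auto

lemma finite_escape: "h a \<noteq> \<infinity> \<Longrightarrow> \<exists>d>c. \<not> covers h a d"
  using far[of a "max (c + 1) (a + int n)"] by (intro exI[of _ "max (c + 1) (a + int n)"]) auto

text \<open>
  A finite letter far to the left serves as the 1. It rules out all infinite letters, whose
  translates decrease forever, and reduces the condition to avoidance of 321, where the two larger
  elements of an occurrence lie in the interval of the smallest.
\<close>

lemma avoids_1432:
  "\<not> contains_pattern (code_order h) [1, 4, 3, 2] \<longleftrightarrow>
     (\<forall>a. h a = \<infinity>) \<or> (\<forall>a. h a \<noteq> \<infinity>) \<and> all_interiors avoids21 h"
proof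
  assume "(\<forall>a. h a = \<infinity>) \<or> (\<forall>a. h a \<noteq> \<infinity>) \<and> all_interiors avoids21 h"
  then show "\<not> contains_pattern (code_order h) [1, 4, 3, 2]"
    unfolding contains_1432 all_interiors_simps
    by (metis covers_infinity trans_covers less_trans)
next
  assume av: "\<not> contains_pattern (code_order h) [1, 4, 3, 2]"
  have "h b = \<infinity> \<Longrightarrow> h a = \<infinity>" for a b
  proof (rule ccontr)
    assume b: "h b = \<infinity>" and a: "h a \<noteq> \<infinity>"
    \<comment> \<open>beyond a + n, so that no element from b' on can precede a\<close>
    obtain b' where b': "b' > a + int n" "h b' = \<infinity>" using infinite_right[OF b] by blast
    have "contains_pattern (code_order h) [1, 4, 3, 2]"
      unfolding contains_1432
      by (intro exI[of _ a] exI[of _ b'] exI[of _ "b' + int n"] exI[of _ "b' + 2 * int n"] conjI far)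
         (use a n b' copies in \<open>auto simp: covers_infinity\<close>)
    with av show False by blast
  qed
  moreover have "all_interiors avoids21 h"
    unfolding all_interiors_simps
  proof (intro allI impI notI)
    fix a b c assume *: "a < b" "b < c" "h a \<noteq> \<infinity>" "covers h a c" "covers h b c"
    have "contains_pattern (code_order h) [1, 4, 3, 2]"
      unfolding contains_1432
      by (intro exI[of _ "a - int n"] exI[of _ a] exI[of _ b] exI[of _ c] conjI far)
         (use * n copies covers_between[of h a c b] in auto)
    with av show False by blast
  qed
  ultimately show "(\<forall>a. h a = \<infinity>) \<or> (\<forall>a. h a \<noteq> \<infinity>) \<and> all_interiors avoids21 h" by blast
qed

text \<open>
  As for 1432, a finite letter far to the left serves as the 1. The interval of an infinite letter
  would contain two increasing copies of the finite letter.
\<close>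

lemma avoids_1342:
  "\<not> contains_pattern (code_order h) [1, 3, 4, 2] \<longleftrightarrow>
     (\<forall>a. h a = \<infinity>) \<or> (\<forall>a. h a \<noteq> \<infinity>) \<and> all_interiors avoids12 h"
proof
  assume "(\<forall>a. h a = \<infinity>) \<or> (\<forall>a. h a \<noteq> \<infinity>) \<and> all_interiors avoids12 h"
  then show "\<not> contains_pattern (code_order h) [1, 3, 4, 2]"
    unfolding contains_1342 all_interiors_simps
    using covers_infinity[of h] by blast
next
  assume av: "\<not> contains_pattern (code_order h) [1, 3, 4, 2]"
  have "h b = \<infinity> \<Longrightarrow> h a = \<infinity>" for a b
  proof (rule ccontr)
    assume b: "h b = \<infinity>" and a: "h a \<noteq> \<infinity>"
    obtain b' where b': "b' > a" "h b' = \<infinity>" using infinite_right[OF b] by blast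
    obtain c where c: "c > b' + int n" "h c \<noteq> \<infinity>" using finite_right[OF a] by blast
    have "contains_pattern (code_order h) [1, 3, 4, 2]"
      unfolding contains_1342
      by (intro exI[of _ a] exI[of _ b'] exI[of _ c] exI[of _ "c + int n"] conjI far)
         (use a n b' c copies in \<open>auto simp: covers_infinity\<close>)
    with av show False by blast
  qed
  moreover have "all_interiors avoids12 h"
    unfolding all_interiors_simps
  proof (intro allI impI, rule ccontr)
    fix a b c assume *: "a < b" "b < c" "h a \<noteq> \<infinity>" "covers h a c" "\<not> covers h b c"
    have "\<not> covers h (a - int n) b" using * copies by (intro far) auto
    then have "contains_pattern (code_order h) [1, 3, 4, 2]"
      unfolding contains_1342
      using * n by (intro exI[of _ "a - int n"] exI[of _ a] exI[of _ b] exI[of _ c] conjI) auto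
    with av show False by blast
  qed
  ultimately show "(\<forall>a. h a = \<infinity>) \<or> (\<forall>a. h a \<noteq> \<infinity>) \<and> all_interiors avoids12 h" by blast
qed

text \<open>
  The elements 3 and 2 lie in the interval of 1, and the 4 exists exactly if this interval is finite.
  Infinite letters are therefore unrestricted.
\<close>

lemma avoids_3214: "\<not> contains_pattern (code_order h) [3, 2, 1, 4] \<longleftrightarrow> all_interiors avoids21 h"
proof
  assume "all_interiors avoids21 h"
  then show "\<not> contains_pattern (code_order h) [3, 2, 1, 4]"
    unfolding contains_3214 all_interiors_simps
    by (metis covers_infinity trans_covers less_trans)
next
  assume "\<not> contains_pattern (code_order h) [3, 2, 1, 4]"
  then show "all_interiors avoids21 h"
    unfolding contains_3214 all_interiors_simps
    by (metis covers_between finite_escape less_imp_le)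
qed

lemma avoids_2314: "\<not> contains_pattern (code_order h) [2, 3, 1, 4] \<longleftrightarrow> all_interiors avoids12 h"
proof
  assume "all_interiors avoids12 h"
  then show "\<not> contains_pattern (code_order h) [2, 3, 1, 4]"
    unfolding contains_2314 all_interiors_simps
    by (metis covers_infinity less_trans)
next
  assume "\<not> contains_pattern (code_order h) [2, 3, 1, 4]"
  then show "all_interiors avoids12 h"
    unfolding contains_2314 all_interiors_simps
    by (metis finite_escape)
qed

text \<open>
  The interval of an infinite letter contains a translate of every letter, and a nonzero finite one
  yields the 2 and 3 together with a 4 to its right. So if there is an infinite letter, all finite
  letters are 0.
\<close>

lemma avoids_3241:
  "\<not> contains_pattern (code_order h) [3, 2, 4, 1] \<longleftrightarrow>
     (\<exists>a. h a = \<infinity>) \<and> (\<forall>a. h a = \<infinity> \<or> h a = 0) \<or>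
     (\<forall>a. h a \<noteq> \<infinity>) \<and> all_interiors avoids213 h"
proof
  assume *: "(\<exists>a. h a = \<infinity>) \<and> (\<forall>a. h a = \<infinity> \<or> h a = 0) \<or>
     (\<forall>a. h a \<noteq> \<infinity>) \<and> all_interiors avoids213 h"
  have flat: "\<not> (covers h b c \<and> \<not> covers h b d)" if "h b = \<infinity> \<or> h b = 0" "b < d" for b c d
    using that(1)
  proof
    assume "h b = \<infinity>"
    then show ?thesis using that(2) by (simp add: covers_infinity)
  next
    assume "h b = 0"
    then show ?thesis by (simp add: covers_def zero_enat_def)
  qed
  have "\<not> contains_pattern (code_order h) [3, 2, 4, 1]" if "\<forall>a. h a = \<infinity> \<or> h a = 0"
    unfolding contains_3241
  proof clarify
    fix a b c d assume "b < c" "c < d" "covers h b c" "\<not> covers h b d"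
    then show False using flat[of b d c] that by (meson less_trans)
  qed
  moreover have "\<not> contains_pattern (code_order h) [3, 2, 4, 1]"
    if "\<forall>a. h a \<noteq> \<infinity>" "all_interiors avoids213 h"
    using that unfolding contains_3241 all_interiors_simps by meson
  ultimately show "\<not> contains_pattern (code_order h) [3, 2, 4, 1]"
    using * by blast
next
  assume av: "\<not> contains_pattern (code_order h) [3, 2, 4, 1]"
  have "h b = \<infinity> \<or> h b = 0" if a: "h a = \<infinity>" for a b
  proof (rule ccontr)
    assume b: "\<not> (h b = \<infinity> \<or> h b = 0)"
    obtain b' where b': "b' > a" "h b' = h b" using far_copy(1)[OF h n] by blast
    have "contains_pattern (code_order h) [3, 2, 4, 1]"
      unfolding contains_3241
      by (intro exI[of _ a] exI[of _ b'] exI[of _ "b' + 1"] exI[of _ "b' + 1 + int n"] conjI far covers_next)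
         (use a n b b' in \<open>simp_all add: covers_infinity\<close>)
    with av show False by blast
  qed
  moreover have "all_interiors avoids213 h"
    using av unfolding contains_3241 all_interiors_simps by blast
  ultimately show "(\<exists>a. h a = \<infinity>) \<and> (\<forall>a. h a = \<infinity> \<or> h a = 0) \<or>
     (\<forall>a. h a \<noteq> \<infinity>) \<and> all_interiors avoids213 h"
    by (cases "\<exists>a. h a = \<infinity>") (simp_all, metis)
qed

text \<open>
  Translates of an infinite letter decrease forever.
\<close>

lemma avoids_4321:
  "\<not> contains_pattern (code_order h) [4, 3, 2, 1] \<longleftrightarrow>
     (\<forall>a. h a \<noteq> \<infinity>) \<and> all_interiors avoids321 h"
proof
  assume "(\<forall>a. h a \<noteq> \<infinity>) \<and> all_interiors avoids321 h"
  then show "\<not> contains_pattern (code_order h) [4, 3, 2, 1]"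
    unfolding contains_4321 all_interiors_simps by (metis trans_covers)
next
  assume av: "\<not> contains_pattern (code_order h) [4, 3, 2, 1]"
  have "h a \<noteq> \<infinity>" for a
  proof
    assume a: "h a = \<infinity>"
    have "contains_pattern (code_order h) [4, 3, 2, 1]"
      unfolding contains_4321
      by (intro exI[of _ a] exI[of _ "a + int n"] exI[of _ "a + 2 * int n"] exI[of _ "a + 3 * int n"] conjI)
         (use a n copies in \<open>auto simp: covers_infinity\<close>)
    with av show False by blast
  qed
  moreover have "all_interiors avoids321 h"
    using av unfolding contains_4321 all_interiors_simps
    by (meson covers_between less_imp_le less_trans)
  ultimately show "(\<forall>a. h a \<noteq> \<infinity>) \<and> all_interiors avoids321 h" by blast
qed

text \<open>
  An infinite letter and its translate have the increasing copies of any finite letter in their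
  intervals, which rules out that finite and infinite letters coexist.
\<close>

lemma avoids_3421:
  "\<not> contains_pattern (code_order h) [3, 4, 2, 1] \<longleftrightarrow>
     (\<forall>a. h a = \<infinity>) \<or> (\<forall>a. h a \<noteq> \<infinity>) \<and> all_interiors avoids231 h"
proof
  assume "(\<forall>a. h a = \<infinity>) \<or> (\<forall>a. h a \<noteq> \<infinity>) \<and> all_interiors avoids231 h"
  then show "\<not> contains_pattern (code_order h) [3, 4, 2, 1]"
    unfolding contains_3421 all_interiors_simps
    by (metis covers_infinity trans_covers)
next
  assume av: "\<not> contains_pattern (code_order h) [3, 4, 2, 1]"
  have "h a = \<infinity> \<Longrightarrow> h b = \<infinity>" for a b
  proof (rule ccontr)
    assume a: "h a = \<infinity>" and b: "h b \<noteq> \<infinity>"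
    obtain c where c: "c > a + int n" "h c \<noteq> \<infinity>" using finite_right[OF b] by blast
    have "contains_pattern (code_order h) [3, 4, 2, 1]"
      unfolding contains_3421
      by (intro exI[of _ a] exI[of _ "a + int n"] exI[of _ c] exI[of _ "c + int n"] conjI far)
         (use a n c copies in \<open>auto simp: covers_infinity\<close>)
    with av show False by blast
  qed
  moreover have "all_interiors avoids231 h"
    using av unfolding contains_3421 all_interiors_simps
    by (meson covers_between less_imp_le less_trans)
  ultimately show "(\<forall>a. h a = \<infinity>) \<or> (\<forall>a. h a \<noteq> \<infinity>) \<and> all_interiors avoids231 h" by blast
qed

text \<open>
  In the interval of an infinite letter, a finite letter is followed by a later copy of the infinite
  one, which supplies the descent 43.
\<close>

lemma avoids_2431:
  "\<not> contains_pattern (code_order h) [2, 4, 3, 1] \<longleftrightarrow>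
     (\<forall>a. h a = \<infinity>) \<or> (\<forall>a. h a \<noteq> \<infinity>) \<and> all_interiors avoids132 h"
proof
  assume "(\<forall>a. h a = \<infinity>) \<or> (\<forall>a. h a \<noteq> \<infinity>) \<and> all_interiors avoids132 h"
  then show "\<not> contains_pattern (code_order h) [2, 4, 3, 1]"
    unfolding contains_2431 all_interiors_simps
    by (metis covers_infinity trans_covers less_trans)
next
  assume av: "\<not> contains_pattern (code_order h) [2, 4, 3, 1]"
  have "h a = \<infinity> \<Longrightarrow> h b = \<infinity>" for a b
  proof (rule ccontr)
    assume a: "h a = \<infinity>" and b: "h b \<noteq> \<infinity>"
    obtain b' where b': "b' > a" "h b' \<noteq> \<infinity>" using finite_right[OF b] by blast
    obtain c where c: "c > b' + int n" "h c = \<infinity>" using infinite_right[OF a] by blast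
    have "contains_pattern (code_order h) [2, 4, 3, 1]"
      unfolding contains_2431
      by (intro exI[of _ a] exI[of _ b'] exI[of _ c] exI[of _ "c + 1"] conjI far)
         (use a n b' c in \<open>auto simp: covers_infinity\<close>)
    with av show False by blast
  qed
  moreover have "all_interiors avoids132 h"
    using av unfolding contains_2431 all_interiors_simps
    by (meson covers_between less_imp_le less_trans)
  ultimately show "(\<forall>a. h a = \<infinity>) \<or> (\<forall>a. h a \<noteq> \<infinity>) \<and> all_interiors avoids132 h" by blast
qed

text \<open>
  The interval of an infinite letter would contain three increasing copies of any finite letter.
\<close>

lemma avoids_2341:
  "\<not> contains_pattern (code_order h) [2, 3, 4, 1] \<longleftrightarrow>
     (\<forall>a. h a = \<infinity>) \<or> (\<forall>a. h a \<noteq> \<infinity>) \<and> all_interiors avoids123 h"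
proof
  assume "(\<forall>a. h a = \<infinity>) \<or> (\<forall>a. h a \<noteq> \<infinity>) \<and> all_interiors avoids123 h"
  then show "\<not> contains_pattern (code_order h) [2, 3, 4, 1]"
    unfolding contains_2341 all_interiors_simps
    by (metis covers_infinity)
next
  assume av: "\<not> contains_pattern (code_order h) [2, 3, 4, 1]"
  have "h a = \<infinity> \<Longrightarrow> h b = \<infinity>" for a b
  proof (rule ccontr)
    assume a: "h a = \<infinity>" and b: "h b \<noteq> \<infinity>"
    obtain b' where b': "b' > a" "h b' \<noteq> \<infinity>" using finite_right[OF b] by blast
    have "contains_pattern (code_order h) [2, 3, 4, 1]"
      unfolding contains_2341
      by (intro exI[of _ a] exI[of _ b'] exI[of _ "b' + int n"] exI[of _ "b' + 2 * int n"] conjI far)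
         (use a n b' copies in \<open>auto simp: covers_infinity\<close>)
    with av show False by blast
  qed
  moreover have "all_interiors avoids123 h"
    using av unfolding contains_2341 all_interiors_simps by blast
  ultimately show "(\<forall>a. h a = \<infinity>) \<or> (\<forall>a. h a \<noteq> \<infinity>) \<and> all_interiors avoids123 h" by blast
qed

end

section \<open>Generating functions\<close>

lemma all_interiors_captured:
  "captures A Q \<Longrightarrow> {h \<in> codes n. all_interiors A h} = interior_codes Q n"
  unfolding all_interiors_def by (rule codes_captured)

lemma all_interiors_tilings:
  assumes "captures A Q" "hereditary Q" "n > 0"
  shows "{h \<in> codes n. all_interiors A h} = tile.tilings Q True n"
    and "{h \<in> codes n. (\<forall>a. h a \<noteq> \<infinity>) \<and> all_interiors A h} = tile.tilings Q False n"
proof -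
  have e: "{h \<in> codes n. all_interiors A h} = interior_codes Q n"
    by (rule all_interiors_captured[OF assms(1)])
  show "{h \<in> codes n. all_interiors A h} = tile.tilings Q True n"
    unfolding e interior_codes_tilings[OF assms(3,2), symmetric] by simp
  have "{h \<in> codes n. (\<forall>a. h a \<noteq> \<infinity>) \<and> all_interiors A h} =
      {h \<in> {h \<in> codes n. all_interiors A h}. False \<or> (\<forall>a. h a \<noteq> \<infinity>)}" by blast
  also have "\<dots> = tile.tilings Q False n"
    unfolding e by (rule interior_codes_tilings[OF assms(3,2)])
  finally show "{h \<in> codes n. (\<forall>a. h a \<noteq> \<infinity>) \<and> all_interiors A h} = tile.tilings Q False n" .
qed

lemma codes_infinite: "{h \<in> codes n. \<forall>a. h a = \<infinity>} = {\<lambda>_. \<infinity>}"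
proof -
  have "(\<lambda>_. \<infinity>) \<in> codes n"
    by (auto simp: codes_def periodic_def nested_def covers_infinity)
  then show ?thesis by auto
qed

lemma codes_zero: "{h \<in> codes n. \<forall>a. h a = 0} = {\<lambda>_. 0}"
proof -
  have "(\<lambda>_. 0) \<in> codes n"
    by (auto simp: codes_def periodic_def nested_def covers_def zero_enat_def)
  then show ?thesis by auto
qed

lemma codes_zero_or_infinity:
  assumes "n > 0"
  shows "{h \<in> codes n. \<forall>a. h a = \<infinity> \<or> h a = 0} = tile.tilings (\<lambda>t. t = Leaf) True n"
proof -
  have "{h \<in> codes n. \<forall>a. h a = \<infinity> \<or> h a = 0} = interior_codes (\<lambda>t. t = Leaf) n"
  proof (intro equalityI subsetI)
    fix h assume h: "h \<in> {h \<in> codes n. \<forall>a. h a = \<infinity> \<or> h a = 0}"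
    have "k = 0" if "h a = enat k" for a k
      using h that by (metis (mono_tags, lifting) mem_Collect_eq enat.distinct(1) enat.inject zero_enat_def)
    then show "h \<in> interior_codes (\<lambda>t. t = Leaf) n"
      using h by (simp add: interior_codes_def codes_def)
  next
    fix h assume h: "h \<in> interior_codes (\<lambda>t. t = Leaf) n"
    have "h a = \<infinity> \<or> h a = 0" for a
    proof (cases "h a")
      case (enat k)
      then have "k = 0" using h by (auto simp: interior_codes_def)
      then show ?thesis using enat by (simp add: zero_enat_def)
    qed simp
    then show "h \<in> {h \<in> codes n. \<forall>a. h a = \<infinity> \<or> h a = 0}"
      using h interior_codes_subset by blast
  qed
  then show ?thesis
    using interior_codes_tilings[OF assms hereditary_trees(1), of True] by simp
qed

lemma card_infinite_or_finite:
  assumes "captures A Q" "hereditary Q" "n > 0"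
  shows "card {h \<in> codes n. (\<forall>a. h a = \<infinity>) \<or> (\<forall>a. h a \<noteq> \<infinity>) \<and> all_interiors A h} =
    Suc (card (tile.tilings Q False n))"
proof -
  have "{h \<in> codes n. (\<forall>a. h a = \<infinity>) \<or> (\<forall>a. h a \<noteq> \<infinity>) \<and> all_interiors A h} =
      {h \<in> codes n. \<forall>a. h a = \<infinity>} \<union> {h \<in> codes n. (\<forall>a. h a \<noteq> \<infinity>) \<and> all_interiors A h}" by blast
  also have "\<dots> = insert (\<lambda>_. \<infinity>) (tile.tilings Q False n)"
    unfolding codes_infinite all_interiors_tilings(2)[OF assms] by simp
  finally have e: "{h \<in> codes n. (\<forall>a. h a = \<infinity>) \<or> (\<forall>a. h a \<noteq> \<infinity>) \<and> all_interiors A h} =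
      insert (\<lambda>_. \<infinity>) (tile.tilings Q False n)" .
  have "(\<lambda>_. \<infinity>) \<notin> tile.tilings Q False n"
    unfolding all_interiors_tilings(2)[OF assms, symmetric] by simp
  then show ?thesis unfolding e using tile.finite_tilings[OF assms(3)] by simp
qed

lemma num_1234: "n > 0 \<Longrightarrow> num_avoiding {[3,1,2], [1,2,3,4]} n = 1"
  by (simp only: num_avoiding_312 avoids_1234 codes_infinite cong: conj_cong) simp

lemma num_1243:
  assumes n: "n > 0"
  shows "num_avoiding {[3,1,2], [1,2,4,3]} n = 2"
proof -
  have "{h \<in> codes n. \<not> contains_pattern (code_order h) [1,2,4,3]} =
      {h \<in> codes n. \<forall>a. h a = \<infinity>} \<union> {h \<in> codes n. \<forall>a. h a = 0}"
    using avoids_1243[OF _ n] by blast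
  also have "\<dots> = {\<lambda>_. \<infinity>, \<lambda>_. 0}" unfolding codes_infinite codes_zero by blast
  finally have e: "{h \<in> codes n. \<not> contains_pattern (code_order h) [1,2,4,3]} = {\<lambda>_. \<infinity>, \<lambda>_. 0}" .
  have "(\<lambda>_ :: int. \<infinity> :: enat) \<noteq> (\<lambda>_. 0)" by (metis infinity_ne_i0)
  then show ?thesis unfolding num_avoiding_312[OF n] e by simp
qed

lemma num_avoiding_312_cong:
  assumes "n > 0" "\<And>h. h \<in> codes n \<Longrightarrow> \<not> contains_pattern (code_order h) q \<longleftrightarrow> P h"
  shows "num_avoiding {[3,1,2], q} n = card {h \<in> codes n. P h}"
  unfolding num_avoiding_312[OF assms(1)] using assms(2) by (intro arg_cong[of _ _ card]) blast

lemma num_zero_or_infinity: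
  assumes "n > 0" "q \<in> {[2,1,3,4], [2,1,4,3], [1,3,2,4]}"
  shows "num_avoiding {[3,1,2], q} n = card (tile.tilings (\<lambda>t. t = Leaf) True n)"
  using num_avoiding_312_cong[OF assms(1) avoids_zero_or_infinity[OF _ assms]]
  by (simp only: codes_zero_or_infinity[OF assms(1)])

lemma num_infinite_or_finite:
  assumes "n > 0" "captures A Q" "hereditary Q"
    and "\<And>h. h \<in> codes n \<Longrightarrow> \<not> contains_pattern (code_order h) q \<longleftrightarrow>
      (\<forall>a. h a = \<infinity>) \<or> (\<forall>a. h a \<noteq> \<infinity>) \<and> all_interiors A h"
  shows "num_avoiding {[3,1,2], q} n = Suc (card (tile.tilings Q False n))"
  using num_avoiding_312_cong[OF assms(1,4)] card_infinite_or_finite[OF assms(2,3,1)] by simp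

lemma num_1432: "n > 0 \<Longrightarrow> num_avoiding {[3,1,2], [1,4,3,2]} n = Suc (card (tile.tilings tree21 False n))"
  by (rule num_infinite_or_finite[OF _ captures_21 hereditary_trees(2) avoids_1432])

lemma num_1342: "n > 0 \<Longrightarrow> num_avoiding {[3,1,2], [1,3,4,2]} n = Suc (card (tile.tilings tree12 False n))"
  by (rule num_infinite_or_finite[OF _ captures_12 hereditary_trees(3) avoids_1342])

lemma num_3421: "n > 0 \<Longrightarrow> num_avoiding {[3,1,2], [3,4,2,1]} n = Suc (card (tile.tilings tree231 False n))"
  by (rule num_infinite_or_finite[OF _ captures_231 hereditary_trees(5) avoids_3421])

lemma num_2431: "n > 0 \<Longrightarrow> num_avoiding {[3,1,2], [2,4,3,1]} n = Suc (card (tile.tilings tree132 False n))"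
  by (rule num_infinite_or_finite[OF _ captures_132 hereditary_trees(6) avoids_2431])

lemma num_2341: "n > 0 \<Longrightarrow> num_avoiding {[3,1,2], [2,3,4,1]} n = Suc (card (tile.tilings tree123 False n))"
  by (rule num_infinite_or_finite[OF _ captures_123 hereditary_trees(8) avoids_2341])

lemma num_4321: "n > 0 \<Longrightarrow> num_avoiding {[3,1,2], [4,3,2,1]} n = card (tile.tilings tree321 False n)"
  using num_avoiding_312_cong[OF _ avoids_4321, of n]
    all_interiors_tilings(2)[OF captures_321 hereditary_trees(4), of n] by simp

lemma num_3214: "n > 0 \<Longrightarrow> num_avoiding {[3,1,2], [3,2,1,4]} n = card (tile.tilings tree21 True n)"
  using num_avoiding_312_cong[OF _ avoids_3214, of n]
    all_interiors_tilings(1)[OF captures_21 hereditary_trees(2), of n] by simp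

lemma num_2314: "n > 0 \<Longrightarrow> num_avoiding {[3,1,2], [2,3,1,4]} n = card (tile.tilings tree12 True n)"
  using num_avoiding_312_cong[OF _ avoids_2314, of n]
    all_interiors_tilings(1)[OF captures_12 hereditary_trees(3), of n] by simp

text \<open>
  The words with letters 0 and \<open>\<infinity>\<close> include the one that is constantly 0, which has no infinite
  letter; it is already among the finite words and accounts for the \<open>Suc\<close>.
\<close>

lemma num_3241:
  assumes n: "n > 0"
  shows "Suc (num_avoiding {[3,1,2], [3,2,4,1]} n) =
    card (tile.tilings (\<lambda>t. t = Leaf) True n) + card (tile.tilings tree213 False n)"
proof -
  let ?M = "{h \<in> codes n. (\<exists>a. h a = \<infinity>) \<and> (\<forall>a. h a = \<infinity> \<or> h a = 0)}"
  let ?F = "{h \<in> codes n. (\<forall>a. h a \<noteq> \<infinity>) \<and> all_interiors avoids213 h}"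
  have F: "?F = tile.tilings tree213 False n"
    by (rule all_interiors_tilings(2)[OF captures_213 hereditary_trees(7) n])
  have "tile.tilings (\<lambda>t. t = Leaf) True n = {h \<in> codes n. \<forall>a. h a = \<infinity> \<or> h a = 0}"
    by (rule codes_zero_or_infinity[OF n, symmetric])
  also have "\<dots> = ?M \<union> {h \<in> codes n. \<forall>a. h a = 0}"
  proof -
    have "\<infinity> \<noteq> (0 :: enat)" by simp
    then show ?thesis by blast
  qed
  also have "\<dots> = insert (\<lambda>_. 0) ?M" unfolding codes_zero by simp
  finally have Z: "tile.tilings (\<lambda>t. t = Leaf) True n = insert (\<lambda>_. 0) ?M" .
  have fin: "finite ?M" "finite ?F"
    using tile.finite_tilings[OF n, of "\<lambda>t. t = Leaf" True] tile.finite_tilings[OF n, of tree213 False]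
    unfolding Z F by simp_all
  have "{h \<in> codes n. (\<exists>a. h a = \<infinity>) \<and> (\<forall>a. h a = \<infinity> \<or> h a = 0) \<or>
      (\<forall>a. h a \<noteq> \<infinity>) \<and> all_interiors avoids213 h} = ?M \<union> ?F" by blast
  then have "num_avoiding {[3,1,2], [3,2,4,1]} n = card (?M \<union> ?F)"
    using num_avoiding_312_cong[OF n avoids_3241[OF _ n]] by simp
  also have "\<dots> = card ?M + card ?F" using fin by (rule card_Un_disjoint) blast
  finally show ?thesis unfolding Z F[symmetric] using fin by simp
qed

definition tiling_gf :: "(bintree \<Rightarrow> bool) \<Rightarrow> bool \<Rightarrow> 'a :: comm_ring_1 fps" where
  "tiling_gf Q infin = Abs_fps (\<lambda>n. if n = 0 then 0 else of_nat (card (tile.tilings Q infin n)))"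

definition tile_gf :: "(bintree \<Rightarrow> bool) \<Rightarrow> bool \<Rightarrow> 'a :: comm_ring_1 fps" where
  "tile_gf Q infin = Abs_fps (\<lambda>m. of_nat (card (tile.blocks Q infin m)))"

text \<open>
  The formula \<open>x W' / (1 - W)\<close> for \<open>W = p / d\<close>, with denominators cleared.
\<close>

lemma tiling_gf_rational:
  fixes d p :: "'a :: comm_ring_1 fps"
  assumes "tile_gf Q infin * d = p"
  shows "tiling_gf Q infin * (d - p) * d = fps_X * (fps_deriv p * d - p * fps_deriv d)"
proof -
  define T W where "T = (tiling_gf Q infin :: 'a fps)" and "W = (tile_gf Q infin :: 'a fps)"
  have T: "T * (1 - W) = fps_X * fps_deriv W"
    unfolding T_def W_def tiling_gf_def tile_gf_def by (rule tile.tilings_gf)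
  have W: "W * d = p" using assms by (simp add: W_def)
  have D: "fps_deriv p = fps_deriv W * d + W * fps_deriv d"
    unfolding W[symmetric] by (simp add: algebra_simps)
  have "T * (d - p) * d = T * (1 - W) * d * d" unfolding W[symmetric] by (simp add: algebra_simps)
  also have "\<dots> = fps_X * (fps_deriv p * d - p * fps_deriv d)"
    unfolding T D W[symmetric] by (simp add: algebra_simps)
  finally show ?thesis by (simp add: T_def)
qed

lemma tile_gf_Leaf: "tile_gf (\<lambda>t. t = Leaf) True = 2 * fps_X"
  unfolding mult_2
  by (rule fps_ext) (auto simp: tile_gf_def card_tile_blocks card_Leaf Collect_conv_if fps_numeral_nth)

text \<open>
  A tile of length \<open>m\<close> has an interior of size \<open>m - 1\<close>; an infinite letter is one more tile of
  length 1.
\<close>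

lemma tile_gf_one:
  assumes "\<And>k. card {t. size t = k \<and> Q t} = 1"
  shows "tile_gf Q False * (1 - fps_X) = (fps_X :: 'a :: comm_ring_1 fps)"
    and "tile_gf Q True * (1 - fps_X) = (2 * fps_X - fps_X ^ 2 :: 'a fps)"
proof -
  have 1: "tile_gf Q False = Abs_fps (\<lambda>m. if m = 0 then 0 else 1)"
    by (rule fps_ext) (simp add: tile_gf_def card_tile_blocks assms)
  have 2: "tile_gf Q True = tile_gf Q False + fps_X"
    by (rule fps_ext) (auto simp: tile_gf_def card_tile_blocks assms)
  have "Abs_fps (\<lambda>m. if m = 0 then 0 else 1) * (1 - fps_X) = (fps_X :: 'a fps)"
    by (rule fps_ext) (auto simp: right_diff_distrib)
  then show 3: "tile_gf Q False * (1 - fps_X) = (fps_X :: 'a fps)" unfolding 1 .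
  show "tile_gf Q True * (1 - fps_X) = (2 * fps_X - fps_X ^ 2 :: 'a fps)"
    unfolding 2 distrib_right 3 by (simp add: algebra_simps power2_eq_square)
qed

text \<open>
  The truncated exponent \<open>k - 1\<close> makes the count 1 for the empty interior, so the tile numbers are
  \<open>1, 1, 2, 4, \<dots>\<close> and double only from length 2 on.
\<close>

lemma tile_gf_power:
  assumes "\<And>k. card {t. size t = k \<and> Q t} = 2 ^ (k - 1)"
  shows "tile_gf Q False * (1 - 2 * fps_X) = fps_X - fps_X ^ 2"
proof -
  have 1: "tile_gf Q False = Abs_fps (\<lambda>m. if m = 0 then 0 else 2 ^ (m - 1 - 1))"
    by (rule fps_ext) (simp add: tile_gf_def card_tile_blocks assms)
  have "fps_nth (Abs_fps (\<lambda>m. if m = 0 then 0 else 2 ^ (m - 1 - 1)) * (1 - 2 * fps_X)) m =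
      fps_nth (fps_X - fps_X ^ 2 :: 'a fps) m" for m
  proof -
    have e: "W * (1 - 2 * fps_X) = W - fps_const 2 * (W * fps_X)" for W :: "'a fps"
      by (simp add: algebra_simps numeral_fps_const)
    have "m = 0 \<or> m = 1 \<or> m = 2 \<or> m = (m - 3) + 3" by arith
    then consider "m = 0" | "m = 1" | "m = 2" | k where "m = k + 3" by blast
    then show ?thesis
      unfolding e by cases (auto simp: fps_X_power_nth numeral_3_eq_3)
  qed
  then show ?thesis unfolding 1 by (rule fps_ext)
qed

text \<open>
  The tile numbers grow quadratically, so taking differences three times leaves a polynomial.
\<close>

lemma tile_gf_123: "tile_gf tree123 False * (1 - fps_X) ^ 3 = fps_X * (1 - fps_X) ^ 2 + fps_X ^ 3"
proof -
  have e: "W * (1 - fps_X) = W - W * fps_X" for W :: "'a fps" by (simp add: algebra_simps)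
  have 1: "tile_gf tree123 False = Abs_fps (\<lambda>m. if m = 0 then 0 else of_nat ((m - 1 choose 2) + 1))"
    by (rule fps_ext) (simp add: tile_gf_def card_tile_blocks card_tree123)
  have cases: "m = 0 \<or> m = 1 \<or> m = 2 \<or> (\<exists>k. m = k + 3)" for m :: nat by presburger
  define U :: "'a fps" where "U = Abs_fps (\<lambda>m. of_nat (m - 2))"
  define V :: "'a fps" where "V = Abs_fps (\<lambda>m. if m < 3 then 0 else 1)"
  have W: "tile_gf tree123 False * (1 - fps_X) = fps_X + U"
  proof (rule fps_ext)
    fix m show "fps_nth (tile_gf tree123 False * (1 - fps_X)) m = fps_nth (fps_X + U) m"
      unfolding e 1 U_def using cases[of m]
      by (auto simp: numeral_3_eq_3 numeral_2_eq_2)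
  qed
  have U: "U * (1 - fps_X) = V"
  proof (rule fps_ext)
    fix m show "fps_nth (U * (1 - fps_X)) m = fps_nth V m"
      unfolding e U_def V_def using cases[of m] by (auto simp: numeral_3_eq_3 numeral_2_eq_2)
  qed
  have V: "V * (1 - fps_X) = fps_X ^ 3"
  proof (rule fps_ext)
    fix m show "fps_nth (V * (1 - fps_X)) m = fps_nth (fps_X ^ 3) m"
      unfolding e V_def fps_X_power_nth using cases[of m] by (auto simp: numeral_3_eq_3 numeral_2_eq_2)
  qed
  have "tile_gf tree123 False * (1 - fps_X) ^ 3 = (tile_gf tree123 False * (1 - fps_X)) * (1 - fps_X) ^ 2"
    by (simp add: power3_eq_cube power2_eq_square mult.assoc)
  also have "\<dots> = fps_X * (1 - fps_X) ^ 2 + (U * (1 - fps_X)) * (1 - fps_X)"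
    unfolding W distrib_right by (simp add: power2_eq_square mult.assoc)
  finally show ?thesis unfolding U V .
qed

text \<open>
  The generating function over an arbitrary ring of coefficients. Over the complex numbers it is
  compared with a sum of powers of complex roots.
\<close>

definition avoiding_gf :: "nat list \<Rightarrow> 'a :: comm_ring_1 fps" where
  "avoiding_gf q = Abs_fps (\<lambda>n. of_nat (num_avoiding {[3,1,2], q} n))"

lemma avoiding_gf_tilings:
  assumes "\<And>n. n > 0 \<Longrightarrow> num_avoiding {[3,1,2], q} n = card (tile.tilings Q infin n)"
  shows "avoiding_gf q = tiling_gf Q infin"
  by (rule fps_ext) (auto simp: avoiding_gf_def tiling_gf_def assms num_avoiding_def[of _ 0] simp del: One_nat_def)

text \<open>
  The additional word for each period is the one with all letters infinite.
\<close>

lemma avoiding_gf_Suc_tilings: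
  assumes "\<And>n. n > 0 \<Longrightarrow> num_avoiding {[3,1,2], q} n = Suc (card (tile.tilings Q infin n))"
  shows "(avoiding_gf q - tiling_gf Q infin) * (1 - fps_X) = fps_X"
proof -
  have "avoiding_gf q - tiling_gf Q infin = Abs_fps (\<lambda>n. if n = 0 then 0 else 1 :: 'a)"
    by (rule fps_ext) (auto simp: avoiding_gf_def tiling_gf_def assms num_avoiding_def[of _ 0] simp del: One_nat_def)
  moreover have "Abs_fps (\<lambda>n. if n = 0 then 0 else 1 :: 'a) * (1 - fps_X) = fps_X"
    by (rule fps_ext) (auto simp: right_diff_distrib)
  ultimately show ?thesis by (simp only:)
qed

lemma tiling_gf_Leaf: "tiling_gf (\<lambda>t. t = Leaf) True * (1 - 2 * fps_X) = 2 * fps_X"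
  using tiling_gf_rational[of "\<lambda>t. t = Leaf" True 1 "2 * fps_X"] tile_gf_Leaf
  by (simp add: mult.commute)

lemma tiling_gf_one:
  assumes "\<And>k. card {t. size t = k \<and> Q t} = 1"
  shows "tiling_gf Q False * ((1 - 2 * fps_X) * (1 - fps_X)) = fps_X"
    and "tiling_gf Q True * ((1 - 3 * fps_X + fps_X ^ 2) * (1 - fps_X)) = fps_X * (fps_X ^ 2 - 2 * fps_X + 2)"
  using tiling_gf_rational[OF tile_gf_one(1)[OF assms]] tiling_gf_rational[OF tile_gf_one(2)[OF assms]]
  by (simp_all add: algebra_simps power2_eq_square power3_eq_cube)

lemma tiling_gf_power:
  assumes "\<And>k. card {t. size t = k \<and> Q t} = 2 ^ (k - 1)"
  shows "tiling_gf Q False * ((1 - 3 * fps_X + fps_X ^ 2) * (1 - 2 * fps_X)) =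
    fps_X * (2 * fps_X ^ 2 - 2 * fps_X + 1)"
  using tiling_gf_rational[OF tile_gf_power[OF assms]]
  by (simp add: algebra_simps power2_eq_square power3_eq_cube)

section \<open>Symmetries\<close>

lemma length_permutation: "p \<in> permutations_of_set {1..k} \<Longrightarrow> length p = k"
  by (metis card_atLeastAtMost diff_Suc_1 distinct_card permutations_of_setD)

lemma set_permutation: "p \<in> permutations_of_set {1..k} \<Longrightarrow> set p = {1..k}"
  by (simp add: permutations_of_setD)

lemma contains_pattern_converse: "contains_pattern (r\<inverse>) (rev p) \<longleftrightarrow> contains_pattern r p"
  by (simp add: contains_pattern_def rev_map[symmetric])

lemma tito_converse: "tito n (r\<inverse>) \<longleftrightarrow> tito n r"
  unfolding tito_def linear_order_on_converse by auto

lemma num_avoiding_rev: "num_avoiding (rev ` P) n = num_avoiding P n"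
proof -
  have "avoiding_titos (rev ` P) n = converse ` avoiding_titos P n"
  proof (intro equalityI subsetI)
    fix r assume "r \<in> avoiding_titos (rev ` P) n"
    then have "r\<inverse> \<in> avoiding_titos P n"
      using contains_pattern_converse[of "r\<inverse>"] by (auto simp: avoiding_titos_def tito_converse)
    then show "r \<in> converse ` avoiding_titos P n" by (metis converse_converse image_eqI)
  qed (auto simp: avoiding_titos_def tito_converse contains_pattern_converse)
  moreover have "inj_on converse (avoiding_titos P n)" by (rule inj_onI) simp
  ultimately show ?thesis by (simp add: num_avoiding_def card_image)
qed

definition mirrored :: "int rel \<Rightarrow> int rel" where
  "mirrored r = {(a, b). (- a, - b) \<in> r}"

lemma mirrored_mirrored [simp]: "mirrored (mirrored r) = r"
  by (auto simp: mirrored_def)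

lemma tito_mirrored:
  assumes "tito n r" shows "tito n (mirrored r)"
proof -
  have n: "n > 0" and lin: "linear_order r"
    and per: "\<And>a b. (a, b) \<in> r \<longleftrightarrow> (a + int n, b + int n) \<in> r"
    using assms by (auto simp: tito_def)
  have m: "(a, b) \<in> mirrored r \<longleftrightarrow> (- a, - b) \<in> r" for a b by (simp add: mirrored_def)
  have r: "refl r" "trans r" "antisym r" "total r"
    using lin by (simp_all add: linear_order_on_def partial_order_on_def preorder_on_def)
  have "refl (mirrored r)" using r(1) by (simp add: refl_on_def m)
  moreover have "trans (mirrored r)"
    by (rule transI) (use transD[OF r(2)] in \<open>simp only: m\<close>)
  moreover have "antisym (mirrored r)"
    by (rule antisymI) (metis m antisymD[OF r(3)] neg_equal_iff_equal)
  moreover have "total (mirrored r)"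
    using r(4) by (simp add: total_on_def m)
  ultimately have "linear_order (mirrored r)"
    by (simp add: linear_order_on_def partial_order_on_def preorder_on_def)
  moreover have "(a, b) \<in> mirrored r \<longleftrightarrow> (a + int n, b + int n) \<in> mirrored r" for a b
    using per[of "- a - int n" "- b - int n"] by (simp add: mirrored_def)
  ultimately show ?thesis unfolding tito_def using n by (intro conjI allI)
qed

lemma compl_pattern_permutation:
  assumes "p \<in> permutations_of_set {1..k}"
  shows "compl_pattern p \<in> permutations_of_set {1..k}" "compl_pattern (compl_pattern p) = p"
    "compl_pattern p = map (\<lambda>j. k + 1 - j) p"
proof -
  have l: "length p = k" and s: "set p = {1..k}" "distinct p"
    using assms length_permutation by (auto simp: permutations_of_setD)
  show c: "compl_pattern p = map (\<lambda>j. k + 1 - j) p" by (simp add: compl_pattern_def l)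
  have "(\<lambda>j. k + 1 - j) ` {1..k} = {1..k}"
  proof (intro equalityI subsetI)
    fix j assume "j \<in> {1..k}"
    then show "j \<in> (\<lambda>j. k + 1 - j) ` {1..k}" by (intro image_eqI[of _ _ "k + 1 - j"]) auto
  qed auto
  moreover have "inj_on (\<lambda>j. k + 1 - j) {1..k}" by (rule inj_onI) auto
  ultimately show "compl_pattern p \<in> permutations_of_set {1..k}"
    unfolding c using s by (intro permutations_of_setI) (simp_all add: distinct_map)
  have "map (\<lambda>j. k + 1 - (k + 1 - j)) p = map (\<lambda>j. j) p"
    by (rule map_cong) (use s in auto)
  then show "compl_pattern (compl_pattern p) = p"
    by (simp add: compl_pattern_def l o_def)
qed

text \<open>
  If \<open>i\<close> places the complement of \<open>p\<close> in \<open>r\<close>, then \<open>j \<mapsto> - i (k + 1 - j)\<close> is increasing and places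
  \<open>p\<close> in the mirror image.
\<close>

lemma contains_pattern_mirrored_compl:
  assumes p: "p \<in> permutations_of_set {1..k}" and c: "contains_pattern r (compl_pattern p)"
  shows "contains_pattern (mirrored r) p"
proof -
  have l: "length p = k" and s: "set p = {1..k}"
    using p length_permutation by (auto simp: permutations_of_setD)
  obtain i :: "nat \<Rightarrow> int" where i: "strict_mono_on {1..k} i"
    "successively (\<lambda>a b. (a, b) \<in> r) (map i (compl_pattern p))"
    using c by (auto simp: contains_pattern_def compl_pattern_def l)
  have "strict_mono_on {1..k} (\<lambda>j. - i (k + 1 - j))"
    unfolding strict_mono_on_def
  proof (intro allI impI)
    fix a b assume "a \<in> {1..k} \<and> b \<in> {1..k} \<and> a < b"
    then have "k + 1 - b \<in> {1..k}" "k + 1 - a \<in> {1..k}" "k + 1 - b < k + 1 - a" by auto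
    then show "- i (k + 1 - a) < - i (k + 1 - b)"
      using i(1) unfolding strict_mono_on_def by simp
  qed
  moreover have "successively (\<lambda>a b. (a, b) \<in> mirrored r) (map (\<lambda>j. - i (k + 1 - j)) p)"
    using i(2) by (simp add: compl_pattern_def l successively_map mirrored_def)
  ultimately show ?thesis by (auto simp: contains_pattern_def l)
qed

lemma contains_pattern_mirrored:
  assumes p: "p \<in> permutations_of_set {1..k}"
  shows "contains_pattern (mirrored r) p \<longleftrightarrow> contains_pattern r (compl_pattern p)"
  using contains_pattern_mirrored_compl[OF p]
    contains_pattern_mirrored_compl[OF compl_pattern_permutation(1)[OF p], of "mirrored r"]
    compl_pattern_permutation(2)[OF p] by auto

lemma num_avoiding_compl:
  assumes "\<And>p. p \<in> P \<Longrightarrow> \<exists>k. p \<in> permutations_of_set {1..k}"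
  shows "num_avoiding (compl_pattern ` P) n = num_avoiding P n"
proof -
  have m: "contains_pattern (mirrored r) p \<longleftrightarrow> contains_pattern r (compl_pattern p)" if "p \<in> P" for r p
    using assms[OF that] contains_pattern_mirrored by blast
  have "avoiding_titos P n = mirrored ` avoiding_titos (compl_pattern ` P) n"
  proof (intro equalityI subsetI)
    fix r assume r: "r \<in> avoiding_titos P n"
    have "mirrored r \<in> avoiding_titos (compl_pattern ` P) n"
      using r m[of _ "mirrored r"] by (auto simp: avoiding_titos_def tito_mirrored)
    then show "r \<in> mirrored ` avoiding_titos (compl_pattern ` P) n"
      by (metis mirrored_mirrored image_eqI)
  qed (auto simp: avoiding_titos_def tito_mirrored m)
  moreover have "inj_on mirrored (avoiding_titos (compl_pattern ` P) n)"
    by (rule inj_on_inverseI) (rule mirrored_mirrored)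
  ultimately show ?thesis by (simp add: num_avoiding_def card_image)
qed

lemma num_avoiding_pair_symmetric:
  assumes "p \<in> permutations_of_set {1..k}" "q \<in> permutations_of_set {1..l}"
  shows "num_avoiding {p, q} n = num_avoiding {rev p, rev q} n"
    and "num_avoiding {p, q} n = num_avoiding {compl_pattern p, compl_pattern q} n"
proof -
  show "num_avoiding {p, q} n = num_avoiding {rev p, rev q} n"
    using num_avoiding_rev[of "{p, q}" n] by simp
  have "\<exists>k. s \<in> permutations_of_set {1..k}" if "s \<in> {p, q}" for s
    using assms that by blast
  then have "num_avoiding (compl_pattern ` {p, q}) n = num_avoiding {p, q} n"
    by (rule num_avoiding_compl)
  then show "num_avoiding {p, q} n = num_avoiding {compl_pattern p, compl_pattern q} n" by simp
qed

lemma subseq_rev: "subseq xs ys \<Longrightarrow> subseq (rev xs) (rev ys)"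
proof (induction rule: list_emb.induct)
  case (list_emb_Cons xs ys y)
  then show ?case unfolding rev.simps by (intro subseq_rev_drop_many)
next
  case (list_emb_Cons2 x y xs ys)
  then have "subseq (rev xs @ [x]) (rev ys @ [y])" by (intro list_emb_append_mono) simp_all
  then show ?case by simp
qed simp

lemma set_subseq: "subseq xs ys \<Longrightarrow> set xs \<subseteq> set ys"
  by (induction rule: list_emb.induct) auto

lemma sorted_wrt_subseq: "subseq xs ys \<Longrightarrow> sorted_wrt R ys \<Longrightarrow> sorted_wrt R xs"
proof (induction rule: list_emb.induct)
  case (list_emb_Cons2 x y xs ys)
  then show ?case using set_subseq[of xs ys] by (simp add: subset_iff)
qed simp_all

text \<open>
  Containment composes. Only neighbours in a pattern are compared, so passing to a subsequence needs
  transitivity of the order.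
\<close>

lemma contains_pattern_perm_contains:
  assumes r: "linear_order r" and q: "q \<in> permutations_of_set {1..l}"
    and p: "p \<in> permutations_of_set {1..k}" and pq: "perm_contains q p" and c: "contains_pattern r q"
  shows "contains_pattern r p"
proof -
  have tr: "transp (\<lambda>a b. (a, b) \<in> r)"
    using r by (auto simp: linear_order_on_def partial_order_on_def preorder_on_def transp_def dest: transD)
  have l: "length q = l" "set q = {1..l}" "length p = k" "set p = {1..k}"
    using p q by (auto simp: length_permutation set_permutation)
  obtain f where f: "strict_mono_on {1..l} f" "successively (\<lambda>a b. (a, b) \<in> r) (map f q)"
    using c unfolding contains_pattern_def l by blast
  obtain i where i: "strict_mono_on {1..k} i" "subseq (map i p) q"
    using pq unfolding perm_contains_def l by blast
  have "i ` {1..k} \<subseteq> {1..l}" using set_subseq[OF i(2)] l by simp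
  then have "strict_mono_on {1..k} (f \<circ> i)"
    using f(1) i(1) unfolding strict_mono_on_def by (simp add: image_subset_iff)
  moreover have "successively (\<lambda>a b. (a, b) \<in> r) (map (f \<circ> i) p)"
    using f(2) sorted_wrt_subseq[OF subseq_map[OF i(2), of f]] tr
    by (simp add: successively_conv_sorted_wrt)
  ultimately show ?thesis unfolding contains_pattern_def l by blast
qed

lemma num_avoiding_perm_contains:
  assumes "q \<in> permutations_of_set {1..l}" "p \<in> permutations_of_set {1..k}" "perm_contains q p"
  shows "num_avoiding {p, q} n = num_avoiding {p} n"
proof -
  have "avoiding_titos {p, q} n = avoiding_titos {p} n"
    using contains_pattern_perm_contains[OF _ assms] by (auto simp: avoiding_titos_def tito_def)
  then show ?thesis by (simp add: num_avoiding_def)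
qed

lemma perm_contains_rev: "perm_contains q p \<Longrightarrow> perm_contains (rev q) (rev p)"
  unfolding perm_contains_def rev_map[symmetric] length_rev using subseq_rev by blast

lemma perm_contains_compl:
  assumes q: "q \<in> permutations_of_set {1..l}" and p: "p \<in> permutations_of_set {1..k}"
    and pq: "perm_contains q p"
  shows "perm_contains (compl_pattern q) (compl_pattern p)"
proof -
  have l: "length q = l" "set q = {1..l}" "length p = k" "set p = {1..k}"
    using p q by (auto simp: length_permutation set_permutation)
  obtain i where i: "strict_mono_on {1..k} i" "subseq (map i p) q"
    using pq unfolding perm_contains_def l by blast
  have il: "i j \<in> {1..l}" if "j \<in> {1..k}" for j
  proof -
    have "i ` {1..k} \<subseteq> {1..l}" using set_subseq[OF i(2)] l by simp
    then show ?thesis using that by blast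
  qed
  define i' where "i' j = l + 1 - i (k + 1 - j)" for j
  have "strict_mono_on {1..k} i'"
    unfolding strict_mono_on_def
  proof (intro allI impI)
    fix a b assume ab: "a \<in> {1..k} \<and> b \<in> {1..k} \<and> a < b"
    then have "k + 1 - b \<in> {1..k}" "k + 1 - a \<in> {1..k}" "k + 1 - b < k + 1 - a" by auto
    then have "i (k + 1 - b) < i (k + 1 - a)"
      using i(1) unfolding strict_mono_on_def by simp
    moreover have "i (k + 1 - a) \<in> {1..l}" using ab by (intro il) auto
    ultimately show "i' a < i' b" by (auto simp: i'_def)
  qed
  moreover have "map i' (compl_pattern p) = map (\<lambda>j. l + 1 - j) (map i p)"
    using l by (auto simp: compl_pattern_def i'_def)
  ultimately show ?thesis
    using subseq_map[OF i(2), of "\<lambda>j. l + 1 - j"] l(1,3)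
    unfolding perm_contains_def by (auto simp: compl_pattern_def simp del: map_map intro!: exI[of _ i'])
qed

lemma permutations_3:
  fixes p :: "nat list"
  assumes p: "p \<in> permutations_of_set {1..3} - {[1,2,3], [3,2,1]}"
  shows "p \<in> {[3,1,2], [2,1,3], [1,3,2], [2,3,1]}"
proof -
  have "length p = 3" using p length_permutation by blast
  then obtain a b c where abc: "p = [a, b, c]" by (auto simp: numeral_3_eq_3 length_Suc_conv)
  have v: "x = 1 \<or> x = 2 \<or> x = 3" if "x \<in> {1..3}" for x :: nat
    using that unfolding atLeastAtMost_iff by linarith
  have "set [a, b, c] = {1..3}" "distinct [a, b, c]"
    using p permutations_of_setD[of p "{1..3}"] unfolding abc by blast+
  moreover from this have "a \<in> {1..3}" "b \<in> {1..3}" "c \<in> {1..3}" by auto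
  ultimately have "a = 1 \<or> a = 2 \<or> a = 3" "b = 1 \<or> b = 2 \<or> b = 3" "c = 1 \<or> c = 2 \<or> c = 3"
    "distinct [a, b, c]"
    using v by blast+
  then show ?thesis using p unfolding abc by auto
qed

lemma permutations_4:
  fixes q :: "nat list"
  assumes "q \<in> permutations_of_set {1..4}"
  obtains a b c d where "q = [a, b, c, d]" "distinct [a, b, c, d]"
    "a = 1 \<or> a = 2 \<or> a = 3 \<or> a = 4" "b = 1 \<or> b = 2 \<or> b = 3 \<or> b = 4"
    "c = 1 \<or> c = 2 \<or> c = 3 \<or> c = 4" "d = 1 \<or> d = 2 \<or> d = 3 \<or> d = 4"
proof -
  have "length q = 4" using length_permutation assms by blast
  then obtain a b c d where q: "q = [a, b, c, d]" by (auto simp: numeral_eq_Suc length_Suc_conv)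
  have v: "x = 1 \<or> x = 2 \<or> x = 3 \<or> x = 4" if "x \<in> {1..4}" for x :: nat
    using that unfolding atLeastAtMost_iff by linarith
  have "set [a, b, c, d] = {1..4}" "distinct [a, b, c, d]"
    using assms permutations_of_setD[of q "{1..4}"] unfolding q by blast+
  moreover from this have "a \<in> {1..4}" "b \<in> {1..4}" "c \<in> {1..4}" "d \<in> {1..4}" by auto
  ultimately show ?thesis using that[OF q] v by blast
qed

lemma perm_contains_312I:
  assumes "x < y" "y < z" "subseq [z, x, y] q"
  shows "perm_contains q [3, 1, 2]"
  unfolding perm_contains_def
proof (intro exI conjI)
  let ?i = "\<lambda>j :: nat. if j = 1 then x else if j = 2 then y else z"
  show "strict_mono_on {1..length [3, 1, 2 :: nat]} ?i" using assms by (auto simp: strict_mono_on_def)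
  show "subseq (map ?i [3, 1, 2]) q" using assms by simp
qed

text \<open>
  The case distinction tests the four triples of positions for the pattern 312; the permutations for
  which all tests fail are the tabulated ones.
\<close>

lemma tabulated_or_contains_312:
  assumes "q \<in> permutations_of_set {1..4}"
  shows "q \<in> tabulated_patterns \<or> perm_contains q [3, 1, 2]"
proof -
  obtain a b c d where q: "q = [a, b, c, d]" "distinct [a, b, c, d]"
    "a = 1 \<or> a = 2 \<or> a = 3 \<or> a = 4" "b = 1 \<or> b = 2 \<or> b = 3 \<or> b = 4"
    "c = 1 \<or> c = 2 \<or> c = 3 \<or> c = 4" "d = 1 \<or> d = 2 \<or> d = 3 \<or> d = 4"
    using permutations_4[OF assms] by blast
  show ?thesis
  proof (cases "b < c \<and> c < a \<or> b < d \<and> d < a \<or> c < d \<and> d < a \<or> c < d \<and> d < b")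
    case True
    then have "perm_contains q [3, 1, 2]"
      using perm_contains_312I[of b c a q] perm_contains_312I[of b d a q]
        perm_contains_312I[of c d a q] perm_contains_312I[of c d b q] by (auto simp: q(1))
    then show ?thesis ..
  next
    case False
    have "q \<in> tabulated_patterns"
      using q(3,4,5,6)
      by (elim disjE; use q(2) False in \<open>simp add: q(1) tabulated_patterns_def\<close>)
    then show ?thesis ..
  qed
qed

text \<open>
  Each of the four patterns of length 3 has one symmetry that takes it to 312. If the image of \<open>q\<close>
  under it is not tabulated, it contains 312, and the inverse symmetry shows that \<open>q\<close> contains \<open>p\<close>.
\<close>

lemma reduction_to_312:
  assumes p: "p \<in> permutations_of_set {1..3} - {[1,2,3], [3,2,1]}" and q: "q \<in> permutations_of_set {1..4}"
  shows "\<exists>g\<in>{id, rev, compl_pattern, rev \<circ> compl_pattern}.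
          g p = [3,1,2] \<and>
          (\<forall>n. num_avoiding {p, q} n = num_avoiding {[3,1,2], g q} n) \<and>
          (g q \<in> tabulated_patterns \<or>
           perm_contains q p \<and> (\<forall>n. num_avoiding {p, q} n = num_avoiding {p} n))"
proof -
  have p': "p \<in> permutations_of_set {1..3}" using p by blast
  have rev_perm: "rev s \<in> permutations_of_set {1..l}" if "s \<in> permutations_of_set {1..l}" for s l
    using that by (intro permutations_of_setI) (auto simp: permutations_of_setD)
  have main: ?thesis
    if g: "g \<in> {id, rev, compl_pattern, rev \<circ> compl_pattern}" "g p = [3,1,2]"
      and num: "\<And>n. num_avoiding {p, q} n = num_avoiding {g p, g q} n"
      and gq: "g q \<in> permutations_of_set {1..4}"
      and pull: "perm_contains (g q) [3,1,2] \<Longrightarrow> perm_contains q p" for g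
  proof (rule bexI[OF _ g(1)], intro conjI)
    show "g p = [3,1,2]" by (rule g(2))
    show "\<forall>n. num_avoiding {p, q} n = num_avoiding {[3,1,2], g q} n" using num g(2) by simp
    show "g q \<in> tabulated_patterns \<or>
        perm_contains q p \<and> (\<forall>n. num_avoiding {p, q} n = num_avoiding {p} n)"
      using tabulated_or_contains_312[OF gq] pull num_avoiding_perm_contains[OF q p'] by blast
  qed
  note c = compl_pattern_permutation[OF q] and s = num_avoiding_pair_symmetric[OF p' q]
  consider "p = [3,1,2]" | "p = [2,1,3]" | "p = [1,3,2]" | "p = [2,3,1]"
    using permutations_3[OF p] by blast
  then show ?thesis
  proof cases
    case 1
    then show ?thesis using q by (intro main[of id]) simp_all
  next
    case 2
    show ?thesis
    proof (rule main[of rev])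
      show "perm_contains q p" if "perm_contains (rev q) [3,1,2]"
        using perm_contains_rev[OF that] 2 by simp
    qed (use 2 s(1) rev_perm[OF q] in simp_all)
  next
    case 3
    have P: "[3,1,2] \<in> permutations_of_set {1..3::nat}" "compl_pattern [3,1,2] = [1,3,2]"
      by (auto simp: permutations_of_set_def compl_pattern_def)
    show ?thesis
    proof (rule main[of compl_pattern])
      show "perm_contains q p" if "perm_contains (compl_pattern q) [3,1,2]"
        using perm_contains_compl[OF c(1) P(1) that] 3 c(2) P(2) by simp
      show "compl_pattern p = [3,1,2]" using 3 by (simp add: compl_pattern_def)
    qed (use s(2) c(1) in simp_all)
  next
    case 4
    have P: "[2,1,3] \<in> permutations_of_set {1..3::nat}" "compl_pattern [2,1,3] = [2,3,1]"
      by (auto simp: permutations_of_set_def compl_pattern_def)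
    have cp: "compl_pattern p = [2,1,3]" using 4 by (simp add: compl_pattern_def)
    show ?thesis
    proof (rule main[of "rev \<circ> compl_pattern"])
      show "perm_contains q p" if "perm_contains ((rev \<circ> compl_pattern) q) [3,1,2]"
      proof -
        have "perm_contains (compl_pattern q) [2,1,3]" using perm_contains_rev[OF that] by simp
        from perm_contains_compl[OF c(1) P(1) this] show ?thesis using 4 c(2) P(2) by simp
      qed
      show "num_avoiding {p, q} n = num_avoiding {(rev \<circ> compl_pattern) p, (rev \<circ> compl_pattern) q} n" for n
        using s(2) num_avoiding_pair_symmetric(1)[OF compl_pattern_permutation(1)[OF p'] c(1)] by simp
    qed (use cp rev_perm[OF c(1)] in simp_all)
  qed
qed

section \<open>Closed forms\<close>

lemma gf_2134_2143_1324:
  assumes "q \<in> {[2,1,3,4], [2,1,4,3], [1,3,2,4]}"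
  shows "avoiding_gf q * (1 - 2 * fps_X) = (2 * fps_X :: 'a :: field_char_0 fps)"
proof -
  have "avoiding_gf q = (tiling_gf (\<lambda>t. t = Leaf) True :: 'a fps)"
    by (rule avoiding_gf_tilings) (rule num_zero_or_infinity[OF _ assms])
  then show ?thesis by (simp only: tiling_gf_Leaf)
qed

lemma one_minus_fps_X_neq_0:
  "(1 - fps_X :: 'a :: field_char_0 fps) \<noteq> 0" "(1 - 2 * fps_X :: 'a fps) \<noteq> 0"
proof -
  have "fps_nth (1 - fps_X :: 'a fps) 0 \<noteq> fps_nth 0 0" by simp
  then show "(1 - fps_X :: 'a fps) \<noteq> 0" by metis
  have "fps_nth (1 - 2 * fps_X :: 'a fps) 0 \<noteq> fps_nth 0 0" by simp
  then show "(1 - 2 * fps_X :: 'a fps) \<noteq> 0" by metis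
qed

lemma gf_1432_1342:
  assumes "q \<in> {[1,4,3,2], [1,3,4,2]}"
  shows "avoiding_gf q * (1 - 2 * fps_X) = (2 * fps_X :: 'a :: field_char_0 fps)"
proof -
  obtain Q where Q: "\<And>k. card {t. size t = k \<and> Q t} = 1"
    and N: "\<And>n. n > 0 \<Longrightarrow> num_avoiding {[3,1,2], q} n = Suc (card (tile.tilings Q False n))"
    using assms num_1432 num_1342 card_tree21 card_tree12 by blast
  have T: "tiling_gf Q False * ((1 - 2 * fps_X) * (1 - fps_X)) = (fps_X :: 'a fps)"
    and A: "(avoiding_gf q - tiling_gf Q False) * (1 - fps_X) = (fps_X :: 'a fps)"
    by (rule tiling_gf_one[OF Q], rule avoiding_gf_Suc_tilings, rule N)
  have "(avoiding_gf q * (1 - 2 * fps_X)) * (1 - fps_X :: 'a fps) = (2 * fps_X) * (1 - fps_X)"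
  proof -
    have "(avoiding_gf q * (1 - 2 * fps_X)) * (1 - fps_X :: 'a fps) =
        (avoiding_gf q - tiling_gf Q False) * (1 - fps_X) * (1 - 2 * fps_X) +
        tiling_gf Q False * ((1 - 2 * fps_X) * (1 - fps_X))"
      by (simp add: algebra_simps)
    also have "\<dots> = (2 * fps_X) * (1 - fps_X)"
      unfolding T A by (simp add: algebra_simps)
    finally show ?thesis .
  qed
  then show ?thesis by (simp only: mult_right_cancel[OF one_minus_fps_X_neq_0(1)])
qed

lemma gf_4321:
  "avoiding_gf [4,3,2,1] * ((1 - 2 * fps_X) * (1 - 3 * fps_X + fps_X ^ 2)) =
     (fps_X * (2 * fps_X ^ 2 - 2 * fps_X + 1) :: 'a :: field_char_0 fps)"
proof -
  have "avoiding_gf [4,3,2,1] = (tiling_gf tree321 False :: 'a fps)"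
    by (rule avoiding_gf_tilings) (rule num_4321)
  then show ?thesis
    using tiling_gf_power[OF card_tree321] by (simp only: mult.commute[of "1 - 2 * fps_X"])
qed

lemma gf_3421_2431:
  assumes "q \<in> {[3,4,2,1], [2,4,3,1]}"
  shows "avoiding_gf q * ((1 - fps_X) * (1 - 2 * fps_X) * (1 - 3 * fps_X + fps_X ^ 2)) =
    (fps_X * (2 - 8 * fps_X + 11 * fps_X ^ 2 - 4 * fps_X ^ 3) :: 'a :: field_char_0 fps)"
proof -
  obtain Q where Q: "\<And>k. card {t. size t = k \<and> Q t} = 2 ^ (k - 1)"
    and N: "\<And>n. n > 0 \<Longrightarrow> num_avoiding {[3,1,2], q} n = Suc (card (tile.tilings Q False n))"
    using assms num_3421 num_2431 card_tree231 card_tree132 by blast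
  have T: "tiling_gf Q False * ((1 - 3 * fps_X + fps_X ^ 2) * (1 - 2 * fps_X)) =
      (fps_X * (2 * fps_X ^ 2 - 2 * fps_X + 1) :: 'a fps)"
    and A: "(avoiding_gf q - tiling_gf Q False) * (1 - fps_X) = (fps_X :: 'a fps)"
    by (rule tiling_gf_power[OF Q], rule avoiding_gf_Suc_tilings, rule N)
  show ?thesis using T A by algebra
qed

lemma gf_3214_2314:
  assumes "q \<in> {[3,2,1,4], [2,3,1,4]}"
  shows "avoiding_gf q * ((fps_X - 1) * (fps_X ^ 2 - 3 * fps_X + 1)) =
    (- fps_X * (fps_X ^ 2 - 2 * fps_X + 2) :: 'a :: field_char_0 fps)"
proof -
  obtain Q where Q: "\<And>k. card {t. size t = k \<and> Q t} = 1"
    and N: "\<And>n. n > 0 \<Longrightarrow> num_avoiding {[3,1,2], q} n = card (tile.tilings Q True n)"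
    using assms num_3214 num_2314 card_tree21 card_tree12 by blast
  have T: "tiling_gf Q True * ((1 - 3 * fps_X + fps_X ^ 2) * (1 - fps_X)) =
      (fps_X * (fps_X ^ 2 - 2 * fps_X + 2) :: 'a fps)"
    and A: "avoiding_gf q = (tiling_gf Q True :: 'a fps)"
    by (rule tiling_gf_one[OF Q], rule avoiding_gf_tilings, rule N)
  show ?thesis using T unfolding A by algebra
qed

lemma gf_3241:
  "avoiding_gf [3,2,4,1] * ((fps_X - 1) * (fps_X ^ 2 - 3 * fps_X + 1)) =
    (- fps_X * (fps_X ^ 2 - 2 * fps_X + 2) :: 'a :: field_char_0 fps)"
proof -
  let ?L = "tiling_gf (\<lambda>t. t = Leaf) True :: 'a fps" and ?T = "tiling_gf tree213 False :: 'a fps"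
  have "of_nat (num_avoiding {[3,1,2], [3,2,4,1]} n) =
      (of_nat (card (tile.tilings (\<lambda>t. t = Leaf) True n)) +
      of_nat (card (tile.tilings tree213 False n)) - 1 :: 'a)" if "n > 0" for n
    using arg_cong[OF num_3241[OF that], of "of_nat :: nat \<Rightarrow> 'a"] by (simp add: algebra_simps)
  then have "?L + ?T - avoiding_gf [3,2,4,1] = Abs_fps (\<lambda>n. if n = 0 then 0 else 1)"
    by (intro fps_ext) (auto simp: avoiding_gf_def tiling_gf_def num_avoiding_def[of _ 0] simp del: One_nat_def)
  moreover have "Abs_fps (\<lambda>n. if n = 0 then 0 else 1 :: 'a) * (1 - fps_X) = fps_X"
    by (rule fps_ext) (auto simp: right_diff_distrib)
  ultimately have A: "(?L + ?T - avoiding_gf [3,2,4,1]) * (1 - fps_X) = fps_X" by (simp only:)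
  have L: "?L * (1 - 2 * fps_X) = 2 * fps_X" by (rule tiling_gf_Leaf)
  have T: "?T * ((1 - 3 * fps_X + fps_X ^ 2) * (1 - 2 * fps_X)) =
      fps_X * (2 * fps_X ^ 2 - 2 * fps_X + 1)"
    by (rule tiling_gf_power[OF card_tree213])
  have "(avoiding_gf [3,2,4,1] * ((fps_X - 1) * (fps_X ^ 2 - 3 * fps_X + 1))) * (1 - 2 * fps_X) =
      (- fps_X * (fps_X ^ 2 - 2 * fps_X + 2)) * (1 - 2 * fps_X :: 'a fps)"
  proof -
    let ?A3 = "1 - 3 * fps_X + fps_X ^ 2 :: 'a fps" and ?F = "avoiding_gf [3,2,4,1] :: 'a fps"
    have "(?F * ((fps_X - 1) * (fps_X ^ 2 - 3 * fps_X + 1))) * (1 - 2 * fps_X) =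
        (?L + ?T - ?F) * (1 - fps_X) * (?A3 * (1 - 2 * fps_X))
        - (?L * (1 - 2 * fps_X)) * ((1 - fps_X) * ?A3) - (?T * (?A3 * (1 - 2 * fps_X))) * (1 - fps_X)"
      by algebra
    also have "\<dots> = (- fps_X * (fps_X ^ 2 - 2 * fps_X + 2)) * (1 - 2 * fps_X)"
      unfolding A L T by algebra
    finally show ?thesis .
  qed
  then show ?thesis by (simp only: mult_right_cancel[OF one_minus_fps_X_neq_0(2)])
qed

lemma gf_2341:
  "avoiding_gf [2,3,4,1] * ((1 - fps_X) * (3 * fps_X ^ 3 - 5 * fps_X ^ 2 + 4 * fps_X - 1)) =
    (fps_X * (3 * fps_X ^ 3 - 9 * fps_X ^ 2 + 6 * fps_X - 2) :: 'a :: field_char_0 fps)"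
proof -
  let ?T = "tiling_gf tree123 False :: 'a fps"
  let ?d = "(1 - fps_X) ^ 3 :: 'a fps" and ?p = "fps_X * (1 - fps_X) ^ 2 + fps_X ^ 3 :: 'a fps"
  have A: "(avoiding_gf [2,3,4,1] - ?T) * (1 - fps_X) = fps_X"
    by (rule avoiding_gf_Suc_tilings[OF num_2341])
  have T: "?T * (?d - ?p) * ?d = fps_X * (fps_deriv ?p * ?d - ?p * fps_deriv ?d)"
    by (rule tiling_gf_rational[OF tile_gf_123])
  have d: "fps_deriv ?d = - 3 * (1 - fps_X) ^ 2"
    and p: "fps_deriv ?p = 1 - 4 * fps_X + 6 * fps_X ^ 2"
    by (simp_all add: fps_deriv_power algebra_simps power2_eq_square power3_eq_cube)
  have "(avoiding_gf [2,3,4,1] * ((1 - fps_X) * (3 * fps_X ^ 3 - 5 * fps_X ^ 2 + 4 * fps_X - 1))) * ?d =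
      (fps_X * (3 * fps_X ^ 3 - 9 * fps_X ^ 2 + 6 * fps_X - 2)) * ?d"
  proof -
    let ?F = "avoiding_gf [2,3,4,1] :: 'a fps"
    have "(?F * ((1 - fps_X) * (3 * fps_X ^ 3 - 5 * fps_X ^ 2 + 4 * fps_X - 1))) * ?d =
        - ((?F - ?T) * (1 - fps_X)) * ((?d - ?p) * ?d) - (?T * (?d - ?p) * ?d) * (1 - fps_X)"
      by algebra
    also have "\<dots> = (fps_X * (3 * fps_X ^ 3 - 9 * fps_X ^ 2 + 6 * fps_X - 2)) * ?d"
      unfolding A T d p by algebra
    finally show ?thesis .
  qed
  then show ?thesis by (simp only: mult_right_cancel[OF power_not_zero[OF one_minus_fps_X_neq_0(1)]])
qed

definition geometric :: "'a :: field \<Rightarrow> 'a fps" where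
  "geometric a = Abs_fps (\<lambda>n. a ^ n)"

lemma geometric_mult: "geometric a * (1 - fps_const a * fps_X) = 1"
proof (rule fps_ext)
  fix n
  show "fps_nth (geometric a * (1 - fps_const a * fps_X)) n = fps_nth 1 n"
    unfolding right_diff_distrib mult.left_commute[of _ "fps_const a"]
    by (cases n) (auto simp: geometric_def)
qed

lemma geometric_1: "geometric 1 * (1 - fps_X) = 1"
  using geometric_mult[of 1] by simp

lemma geometric_2: "geometric 2 * (1 - 2 * fps_X) = (1 :: 'a :: field_char_0 fps)"
  using geometric_mult[of "2 :: 'a"] by (simp add: numeral_fps_const)

text \<open>
  The two bases are the reciprocal roots of \<open>1 - 3 x + x\<^sup>2\<close>: their sum is 3 and their product 1.
\<close>

lemma geometric_golden:
  "(geometric ((3 + sqrt 5) / 2) + geometric ((3 - sqrt 5) / 2)) * (1 - 3 * fps_X + fps_X ^ 2) =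
     2 - 3 * fps_X"
proof -
  define a b where "a = fps_const ((3 + sqrt 5) / 2)" and "b = fps_const ((3 - sqrt 5) / 2)"
  have "a + b = fps_const ((3 + sqrt 5) / 2 + (3 - sqrt 5) / 2)"
    unfolding a_def b_def by (simp only: fps_const_add)
  also have "(3 + sqrt 5) / 2 + (3 - sqrt 5) / 2 = 3" by (simp add: field_simps)
  finally have ab: "a + b = 3" by (simp add: numeral_fps_const)
  have "a * b = fps_const ((3 + sqrt 5) / 2 * ((3 - sqrt 5) / 2))"
    unfolding a_def b_def by (simp only: fps_const_mult)
  also have "(3 + sqrt 5) / 2 * ((3 - sqrt 5) / 2) = 1" by (simp add: field_simps)
  finally have "a * b = 1" by simp
  moreover have "geometric ((3 + sqrt 5) / 2) * (1 - a * fps_X) = 1"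
    "geometric ((3 - sqrt 5) / 2) * (1 - b * fps_X) = 1"
    unfolding a_def b_def by (rule geometric_mult)+
  ultimately show ?thesis using ab by algebra
qed

lemma fps_quotientI:
  fixes F D N :: "'a :: field fps"
  assumes "F * D = N" "fps_nth D 0 \<noteq> 0"
  shows "F = N / D"
proof -
  have "D \<noteq> 0" using assms(2) by auto
  then show ?thesis unfolding assms(1)[symmetric] by simp
qed

lemma fps_eq_of_mult_eq:
  fixes F G D :: "'a :: field fps"
  assumes "F * D = N" "G * D = N" "fps_nth D 0 \<noteq> 0"
  shows "F = G"
  using fps_quotientI[OF assms(1,3)] fps_quotientI[OF assms(2,3)] by simp

lemma gf_avoiding_312: "gf_avoiding {[3,1,2], q} = avoiding_gf q"
  by (simp add: gf_avoiding_def avoiding_gf_def)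

lemma num_avoiding_nth: "of_nat (num_avoiding {[3,1,2], q} n) = fps_nth (avoiding_gf q) n"
  by (simp add: avoiding_gf_def)

text \<open>
  The intermediate value theorem gives a real root \<open>\<alpha>\<close>. The quadratic cofactor
  \<open>3 z\<^sup>2 + b z + c\<close> has negative discriminant for every real \<open>\<alpha>\<close>, which makes the other two roots
  conjugate and not real. The last three equations are Vieta's formulas for the reciprocal roots.
\<close>

lemma cubic_roots:
  obtains \<alpha> :: real and \<beta> :: complex where "\<beta> \<notin> \<real>"
    "{z :: complex. 3 * z ^ 3 - 5 * z ^ 2 + 4 * z - 1 = 0} = {of_real \<alpha>, \<beta>, cnj \<beta>}"
    "1 / of_real \<alpha> + 1 / \<beta> + 1 / cnj \<beta> = 4"
    "1 / of_real \<alpha> * (1 / \<beta>) + 1 / of_real \<alpha> * (1 / cnj \<beta>) + 1 / \<beta> * (1 / cnj \<beta>) = 5"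
    "1 / of_real \<alpha> * (1 / \<beta>) * (1 / cnj \<beta>) = 3"
proof -
  have "\<exists>x\<ge>0. x \<le> 1 \<and> 3 * x ^ 3 - 5 * x ^ 2 + 4 * x - 1 = (0 :: real)"
    by (rule IVT') (auto intro!: continuous_intros)
  then obtain \<alpha> :: real where \<alpha>: "3 * \<alpha> ^ 3 - 5 * \<alpha> ^ 2 + 4 * \<alpha> - 1 = 0" by blast
  define b c where "b = 3 * \<alpha> - 5" and "c = 3 * \<alpha> ^ 2 - 5 * \<alpha> + 4"
  \<comment> \<open>c is the reciprocal of the real root, so the constant term of the cofactor determines the product of all roots\<close>
  have ac: "\<alpha> * c = 1" using \<alpha> by (simp add: c_def algebra_simps power2_eq_square power3_eq_cube)
  \<comment> \<open>the negated discriminant of the cofactor, with the square completed in \<open>\<alpha>\<close>\<close>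
  have "12 * c - b ^ 2 = 27 * (\<alpha> - 5 / 9) ^ 2 + 44 / 3"
    by (simp add: b_def c_def algebra_simps power2_eq_square)
  then have disc: "12 * c - b ^ 2 > 0" using zero_le_power2[of "\<alpha> - 5 / 9"] by linarith
  define s where "s = sqrt (12 * c - b ^ 2)"
  have s: "s > 0" "s ^ 2 = 12 * c - b ^ 2" using disc by (simp_all add: s_def)
  define \<beta> where "\<beta> = Complex (- b / 6) (s / 6)"
  have nr: "\<beta> \<notin> \<real>" using s(1) by (simp add: complex_is_Real_iff \<beta>_def)
  have sum: "\<beta> + cnj \<beta> = of_real (- b / 3)" by (simp add: complex_eq_iff \<beta>_def)
  have "(b / 6) ^ 2 + (s / 6) ^ 2 = c / 3" using s(2) by (simp add: power_divide field_simps)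
  then have prod: "\<beta> * cnj \<beta> = of_real (c / 3)"
    by (simp add: complex_eq_iff \<beta>_def power2_eq_square)
  define A where "A = complex_of_real \<alpha>"
  have S: "3 * (\<beta> + cnj \<beta>) = 5 - 3 * A" unfolding sum by (simp add: A_def b_def)
  have P: "3 * (\<beta> * cnj \<beta>) = 3 * A ^ 2 - 5 * A + 4" unfolding prod by (simp add: A_def c_def)
  have R: "3 * A ^ 3 - 5 * A ^ 2 + 4 * A - 1 = 0"
    using arg_cong[OF \<alpha>, of complex_of_real] by (simp add: A_def)
  have fac: "3 * z ^ 3 - 5 * z ^ 2 + 4 * z - 1 = 3 * (z - A) * (z - \<beta>) * (z - cnj \<beta>)" for z
    using S P R by algebra
  have set: "{z :: complex. 3 * z ^ 3 - 5 * z ^ 2 + 4 * z - 1 = 0} = {of_real \<alpha>, \<beta>, cnj \<beta>}"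
    unfolding fac A_def by auto
  have n0: "A \<noteq> 0" "\<beta> \<noteq> 0" "cnj \<beta> \<noteq> 0"
    using ac nr by (auto simp: A_def)
  have p3: "3 * (A * \<beta> * cnj \<beta>) = 1" using P R by algebra
  have "1 / A + 1 / \<beta> + 1 / cnj \<beta> = 4"
  proof -
    have "\<beta> * cnj \<beta> + A * cnj \<beta> + A * \<beta> = 4 * (A * \<beta> * cnj \<beta>)" using S P p3 by algebra
    then show ?thesis using n0 by (simp add: field_simps)
  qed
  moreover have "1 / A * (1 / \<beta>) + 1 / A * (1 / cnj \<beta>) + 1 / \<beta> * (1 / cnj \<beta>) = 5"
  proof -
    have "cnj \<beta> + \<beta> + A = 5 * (A * \<beta> * cnj \<beta>)" using S P p3 by algebra
    then show ?thesis using n0 by (simp add: field_simps)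
  qed
  moreover have "1 / A * (1 / \<beta>) * (1 / cnj \<beta>) = 3"
  proof -
    have "1 = 3 * (A * \<beta> * cnj \<beta>)" using p3 by simp
    then show ?thesis using n0 by (simp add: field_simps)
  qed
  ultimately show ?thesis using that[OF nr set] unfolding A_def by blast
qed

lemma geometric_cubic:
  fixes u v w :: "'a :: field_char_0"
  assumes "u + v + w = 4" "u * v + u * w + v * w = 5" "u * v * w = 3"
  shows "(geometric u + geometric v + geometric w) * (1 - 4 * fps_X + 5 * fps_X ^ 2 - 3 * fps_X ^ 3) =
    3 - 8 * fps_X + 5 * fps_X ^ 2"
proof -
  define a b c where "a = fps_const u" and "b = fps_const v" and "c = fps_const w"
  have "a + b + c = fps_const (u + v + w)" "a * b + a * c + b * c = fps_const (u * v + u * w + v * w)"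
    "a * b * c = fps_const (u * v * w)"
    unfolding a_def b_def c_def by (simp_all only: fps_const_add fps_const_mult)
  then have "a + b + c = 4" "a * b + a * c + b * c = 5" "a * b * c = 3"
    unfolding assms by (simp_all add: numeral_fps_const)
  then have e: "4 = a + b + c" "5 = a * b + a * c + b * c" "3 = a * b * c" by simp_all
  have G: "geometric u * (1 - a * fps_X) = 1" "geometric v * (1 - b * fps_X) = 1"
    "geometric w * (1 - c * fps_X) = 1"
    unfolding a_def b_def c_def by (rule geometric_mult)+
  have D: "1 - 4 * fps_X + 5 * fps_X ^ 2 - 3 * fps_X ^ 3 =
      (1 - a * fps_X) * (1 - b * fps_X) * (1 - c * fps_X)"
    unfolding e by (simp add: algebra_simps power2_eq_square power3_eq_cube)
  have "(geometric u + geometric v + geometric w) * (1 - 4 * fps_X + 5 * fps_X ^ 2 - 3 * fps_X ^ 3) =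
      (geometric u * (1 - a * fps_X)) * ((1 - b * fps_X) * (1 - c * fps_X)) +
      (geometric v * (1 - b * fps_X)) * ((1 - a * fps_X) * (1 - c * fps_X)) +
      (geometric w * (1 - c * fps_X)) * ((1 - a * fps_X) * (1 - b * fps_X))"
    unfolding D by (simp add: algebra_simps)
  also have "\<dots> = 3 - 2 * (a + b + c) * fps_X + (a * b + a * c + b * c) * fps_X ^ 2"
    unfolding G by (simp add: algebra_simps power2_eq_square)
  also have "\<dots> = 3 - 8 * fps_X + 5 * fps_X ^ 2"
    unfolding e(1)[symmetric] e(2)[symmetric] by simp
  finally show ?thesis .
qed

text \<open>
  A closed form is verified by checking that its generating function satisfies the same equation
  with an invertible denominator. In each case below a constant is subtracted from the sum of geometric
  series in order to make the coefficient at 0 vanish.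
\<close>

lemma coefficients_from_gf:
  fixes F D N :: "'a :: field fps"
  assumes "F * D = N" "G * D = N" "fps_nth D 0 \<noteq> 0"
  shows "fps_nth F n = fps_nth G n"
  using fps_eq_of_mult_eq[OF assms] by simp

lemma num_4321_closed:
  assumes "n \<ge> 1"
  shows "real (num_avoiding {[3,1,2], [4,3,2,1]} n) =
    ((3 + sqrt 5) / 2) ^ n + ((3 - sqrt 5) / 2) ^ n - 2 ^ n"
proof -
  let ?L = "geometric ((3 + sqrt 5) / 2) + geometric ((3 - sqrt 5) / 2)"
  have "(?L - geometric 2 - 1) * ((1 - 2 * fps_X) * (1 - 3 * fps_X + fps_X ^ 2)) =
      (?L * (1 - 3 * fps_X + fps_X ^ 2)) * (1 - 2 * fps_X)
      - (geometric 2 * (1 - 2 * fps_X)) * (1 - 3 * fps_X + fps_X ^ 2)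
      - (1 - 2 * fps_X) * (1 - 3 * fps_X + fps_X ^ 2)"
    by algebra
  also have "\<dots> = fps_X * (2 * fps_X ^ 2 - 2 * fps_X + 1)"
    unfolding geometric_golden geometric_2 by algebra
  finally have "fps_nth (avoiding_gf [4,3,2,1]) n = fps_nth (?L - geometric 2 - 1) n"
    by (rule coefficients_from_gf[OF gf_4321]) simp
  then show ?thesis unfolding num_avoiding_nth using assms by (simp add: geometric_def)
qed

lemma num_3421_2431_closed:
  assumes "q \<in> {[3,4,2,1], [2,4,3,1]}" "n \<ge> 1"
  shows "real (num_avoiding {[3,1,2], q} n) =
    ((3 + sqrt 5) / 2) ^ n + ((3 - sqrt 5) / 2) ^ n - 2 ^ n + 1"
proof -
  let ?L = "geometric ((3 + sqrt 5) / 2) + geometric ((3 - sqrt 5) / 2)"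
  have "(?L - geometric 2 + geometric 1 - 2) * ((1 - fps_X) * (1 - 2 * fps_X) * (1 - 3 * fps_X + fps_X ^ 2)) =
      (?L * (1 - 3 * fps_X + fps_X ^ 2)) * ((1 - fps_X) * (1 - 2 * fps_X))
      - (geometric 2 * (1 - 2 * fps_X)) * ((1 - fps_X) * (1 - 3 * fps_X + fps_X ^ 2))
      + (geometric 1 * (1 - fps_X)) * ((1 - 2 * fps_X) * (1 - 3 * fps_X + fps_X ^ 2))
      - 2 * ((1 - fps_X) * (1 - 2 * fps_X) * (1 - 3 * fps_X + fps_X ^ 2))"
    by algebra
  also have "\<dots> = fps_X * (2 - 8 * fps_X + 11 * fps_X ^ 2 - 4 * fps_X ^ 3)"
    unfolding geometric_golden geometric_2 geometric_1 by algebra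
  finally have "fps_nth (avoiding_gf q) n = fps_nth (?L - geometric 2 + geometric 1 - 2) n"
    by (rule coefficients_from_gf[OF gf_3421_2431[OF assms(1)]]) simp
  then show ?thesis unfolding num_avoiding_nth using assms(2) by (simp add: geometric_def fps_numeral_nth)
qed

lemma gf_3241_3214_2314:
  assumes "q \<in> {[3,2,4,1], [3,2,1,4], [2,3,1,4]}"
  shows "avoiding_gf q * ((fps_X - 1) * (fps_X ^ 2 - 3 * fps_X + 1)) =
    (- fps_X * (fps_X ^ 2 - 2 * fps_X + 2) :: 'a :: field_char_0 fps)"
  using assms gf_3241 gf_3214_2314[of q] by blast

lemma num_3241_3214_2314_closed:
  assumes "q \<in> {[3,2,4,1], [3,2,1,4], [2,3,1,4]}" "n \<ge> 1"
  shows "real (num_avoiding {[3,1,2], q} n) =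
    ((3 + sqrt 5) / 2) ^ n + ((3 - sqrt 5) / 2) ^ n - 1"
proof -
  let ?L = "geometric ((3 + sqrt 5) / 2) + geometric ((3 - sqrt 5) / 2)"
  have "(?L - geometric 1 - 1) * ((fps_X - 1) * (fps_X ^ 2 - 3 * fps_X + 1)) =
      - (?L * (1 - 3 * fps_X + fps_X ^ 2)) * (1 - fps_X)
      + (geometric 1 * (1 - fps_X)) * (1 - 3 * fps_X + fps_X ^ 2)
      + (1 - fps_X) * (1 - 3 * fps_X + fps_X ^ 2)"
    by algebra
  also have "\<dots> = - fps_X * (fps_X ^ 2 - 2 * fps_X + 2)"
    unfolding geometric_golden geometric_1 by algebra
  finally have "fps_nth (avoiding_gf q) n = fps_nth (?L - geometric 1 - 1) n"
    by (rule coefficients_from_gf[OF gf_3241_3214_2314[OF assms(1)]]) simp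
  then show ?thesis unfolding num_avoiding_nth using assms(2) by (simp add: geometric_def)
qed

lemma num_2341_closed:
  fixes u v w :: complex
  assumes "u + v + w = 4" "u * v + u * w + v * w = 5" "u * v * w = 3" "n \<ge> 1"
  shows "of_nat (num_avoiding {[3,1,2], [2,3,4,1]} n) = - 2 + u ^ n + v ^ n + w ^ n"
proof -
  let ?L = "geometric u + geometric v + geometric w"
  have "(?L - 2 * geometric 1 - 1) * ((1 - fps_X) * (3 * fps_X ^ 3 - 5 * fps_X ^ 2 + 4 * fps_X - 1)) =
      - (?L * (1 - 4 * fps_X + 5 * fps_X ^ 2 - 3 * fps_X ^ 3)) * (1 - fps_X)
      + 2 * (geometric 1 * (1 - fps_X)) * (1 - 4 * fps_X + 5 * fps_X ^ 2 - 3 * fps_X ^ 3)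
      + (1 - fps_X) * (1 - 4 * fps_X + 5 * fps_X ^ 2 - 3 * fps_X ^ 3)"
    by algebra
  also have "\<dots> = fps_X * (3 * fps_X ^ 3 - 9 * fps_X ^ 2 + 6 * fps_X - 2)"
    unfolding geometric_cubic[OF assms(1-3)] geometric_1 by algebra
  finally have "fps_nth (avoiding_gf [2,3,4,1]) n = fps_nth (?L - 2 * geometric 1 - 1) n"
    by (rule coefficients_from_gf[OF gf_2341]) simp
  then show ?thesis unfolding num_avoiding_nth using assms(4) by (simp add: geometric_def numeral_fps_const)
qed

lemma gf_2_power:
  assumes "q \<in> {[2,1,3,4], [2,1,4,3], [1,3,2,4], [1,4,3,2], [1,3,4,2]}"
  shows "avoiding_gf q * (1 - 2 * fps_X) = (2 * fps_X :: 'a :: field_char_0 fps)"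
  using assms gf_1432_1342[of q] gf_2134_2143_1324[of q] by blast

lemma num_2_power:
  assumes "q \<in> {[2,1,3,4], [2,1,4,3], [1,3,2,4], [1,4,3,2], [1,3,4,2]}" "n \<ge> 1"
  shows "num_avoiding {[3,1,2], q} n = 2 ^ n"
proof -
  have "(geometric 2 - 1) * (1 - 2 * fps_X) = geometric 2 * (1 - 2 * fps_X) - (1 - 2 * fps_X :: real fps)"
    by (simp add: algebra_simps)
  also have "\<dots> = 2 * fps_X" unfolding geometric_2 by simp
  finally have "fps_nth (avoiding_gf q) n = fps_nth (geometric 2 - 1 :: real fps) n"
    by (rule coefficients_from_gf[OF gf_2_power[OF assms(1)]]) simp
  then have "real (num_avoiding {[3,1,2], q} n) = real (2 ^ n)"
    unfolding num_avoiding_nth using assms(2) by (simp add: geometric_def)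
  then show ?thesis by (simp only: of_nat_eq_iff)
qed

text \<open>
  Used where only the constant words survive.
\<close>

lemma gf_constant:
  assumes "\<And>n. n > 0 \<Longrightarrow> num_avoiding {[3,1,2], q} n = c"
  shows "gf_avoiding {[3,1,2], q} = of_nat c * fps_X / (1 - fps_X)"
proof (rule fps_quotientI)
  have "gf_avoiding {[3,1,2], q} = fps_const (real c) * Abs_fps (\<lambda>n. if n = 0 then 0 else 1)"
    by (rule fps_ext) (auto simp: gf_avoiding_def assms num_avoiding_def[of _ 0] simp del: One_nat_def)
  moreover have "Abs_fps (\<lambda>n. if n = 0 then 0 else 1 :: real) * (1 - fps_X) = fps_X"
    by (rule fps_ext) (auto simp: right_diff_distrib)
  ultimately show "gf_avoiding {[3,1,2], q} * (1 - fps_X) = of_nat c * fps_X"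
    by (simp add: mult.assoc fps_of_nat)
qed simp

section \<open>The table\<close>

theorem theorem1p2:
  shows
    "(gf_avoiding {[3,1,2], [1,2,3,4]} = fps_X / (1 - fps_X) \<and>
      (\<forall>n\<ge>1. num_avoiding {[3,1,2], [1,2,3,4]} n = 1))
     \<and>
     (gf_avoiding {[3,1,2], [1,2,4,3]} = 2 * fps_X / (1 - fps_X) \<and>
      (\<forall>n\<ge>1. num_avoiding {[3,1,2], [1,2,4,3]} n = 2))
     \<and>
     (gf_avoiding {[3,1,2], [4,3,2,1]} =
        fps_X * (2 * fps_X^2 - 2 * fps_X + 1) /
          ((1 - 2 * fps_X) * (1 - 3 * fps_X + fps_X^2)) \<and>
      (\<forall>n\<ge>1. real (num_avoiding {[3,1,2], [4,3,2,1]} n) =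
        ((3 + sqrt 5) / 2) ^ n + ((3 - sqrt 5) / 2) ^ n - 2 ^ n))
     \<and>
     (\<forall>q\<in>{[3,4,2,1], [2,4,3,1]}.
        gf_avoiding {[3,1,2], q} =
          fps_X * (2 - 8 * fps_X + 11 * fps_X^2 - 4 * fps_X^3) /
            ((1 - fps_X) * (1 - 2 * fps_X) * (1 - 3 * fps_X + fps_X^2)) \<and>
        (\<forall>n\<ge>1. real (num_avoiding {[3,1,2], q} n) =
          ((3 + sqrt 5) / 2) ^ n + ((3 - sqrt 5) / 2) ^ n - 2 ^ n + 1))
     \<and>
     (\<forall>q\<in>{[3,2,4,1], [3,2,1,4], [2,3,1,4]}.
        gf_avoiding {[3,1,2], q} =
          - fps_X * (fps_X^2 - 2 * fps_X + 2) /
            ((fps_X - 1) * (fps_X^2 - 3 * fps_X + 1)) \<and>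
        (\<forall>n\<ge>1. real (num_avoiding {[3,1,2], q} n) =
          ((3 + sqrt 5) / 2) ^ n + ((3 - sqrt 5) / 2) ^ n - 1))
     \<and>
     (gf_avoiding {[3,1,2], [2,3,4,1]} =
        fps_X * (3 * fps_X^3 - 9 * fps_X^2 + 6 * fps_X - 2) /
          ((1 - fps_X) * (3 * fps_X^3 - 5 * fps_X^2 + 4 * fps_X - 1)) \<and>
      (\<exists>(\<alpha>::real) (\<beta>::complex). \<beta> \<notin> \<real> \<and>
        {z::complex. 3 * z^3 - 5 * z^2 + 4 * z - 1 = 0} = {of_real \<alpha>, \<beta>, cnj \<beta>} \<and>
        (\<forall>n\<ge>1. of_nat (num_avoiding {[3,1,2], [2,3,4,1]} n) =
          - 2 + (1 / of_real \<alpha>) ^ n + (1 / \<beta>) ^ n + (1 / cnj \<beta>) ^ n)))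
     \<and>
     (\<forall>q\<in>{[2,1,3,4], [2,1,4,3], [1,3,2,4], [1,4,3,2], [1,3,4,2]}.
        gf_avoiding {[3,1,2], q} = 2 * fps_X / (1 - 2 * fps_X) \<and>
        (\<forall>n\<ge>1. num_avoiding {[3,1,2], q} n = 2 ^ n))
     \<and>
     (\<forall>k l. \<forall>p\<in>permutations_of_set {1..k}. \<forall>q\<in>permutations_of_set {1..l}. \<forall>n.
        num_avoiding {p, q} n = num_avoiding {rev p, rev q} n \<and>
        num_avoiding {p, q} n = num_avoiding {compl_pattern p, compl_pattern q} n)
     \<and>
     (\<forall>p\<in>permutations_of_set {1..3} - {[1,2,3], [3,2,1]}. \<forall>q\<in>permutations_of_set {1..4}.
        \<exists>g\<in>{id, rev, compl_pattern, rev \<circ> compl_pattern}.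
          g p = [3,1,2] \<and>
          (\<forall>n. num_avoiding {p, q} n = num_avoiding {[3,1,2], g q} n) \<and>
          (g q \<in> tabulated_patterns \<or>
           perm_contains q p \<and> (\<forall>n. num_avoiding {p, q} n = num_avoiding {p} n)))"
proof (intro conjI)
  show "gf_avoiding {[3,1,2], [1,2,3,4]} = fps_X / (1 - fps_X)"
    using gf_constant[OF num_1234] by simp
  show "\<forall>n\<ge>1. num_avoiding {[3,1,2], [1,2,3,4]} n = 1"
    using num_1234 by simp
  show "gf_avoiding {[3,1,2], [1,2,4,3]} = 2 * fps_X / (1 - fps_X)"
    using gf_constant[OF num_1243] by simp
  show "\<forall>n\<ge>1. num_avoiding {[3,1,2], [1,2,4,3]} n = 2"
    using num_1243 by simp
  show "gf_avoiding {[3,1,2], [4,3,2,1]} =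
        fps_X * (2 * fps_X^2 - 2 * fps_X + 1) /
          ((1 - 2 * fps_X) * (1 - 3 * fps_X + fps_X^2))"
    unfolding gf_avoiding_312 by (rule fps_quotientI[OF gf_4321]) simp
  show "\<forall>n\<ge>1. real (num_avoiding {[3,1,2], [4,3,2,1]} n) =
        ((3 + sqrt 5) / 2) ^ n + ((3 - sqrt 5) / 2) ^ n - 2 ^ n"
    using num_4321_closed by blast
  show "\<forall>q\<in>{[3,4,2,1], [2,4,3,1]}.
        gf_avoiding {[3,1,2], q} =
          fps_X * (2 - 8 * fps_X + 11 * fps_X^2 - 4 * fps_X^3) /
            ((1 - fps_X) * (1 - 2 * fps_X) * (1 - 3 * fps_X + fps_X^2)) \<and>
        (\<forall>n\<ge>1. real (num_avoiding {[3,1,2], q} n) =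
          ((3 + sqrt 5) / 2) ^ n + ((3 - sqrt 5) / 2) ^ n - 2 ^ n + 1)"
    unfolding gf_avoiding_312
    by (intro ballI conjI allI impI fps_quotientI[OF gf_3421_2431] num_3421_2431_closed) simp_all
  show "\<forall>q\<in>{[3,2,4,1], [3,2,1,4], [2,3,1,4]}.
        gf_avoiding {[3,1,2], q} =
          - fps_X * (fps_X^2 - 2 * fps_X + 2) /
            ((fps_X - 1) * (fps_X^2 - 3 * fps_X + 1)) \<and>
        (\<forall>n\<ge>1. real (num_avoiding {[3,1,2], q} n) =
          ((3 + sqrt 5) / 2) ^ n + ((3 - sqrt 5) / 2) ^ n - 1)"
    unfolding gf_avoiding_312
    by (intro ballI conjI allI impI fps_quotientI[OF gf_3241_3214_2314] num_3241_3214_2314_closed) simp_all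
  show "gf_avoiding {[3,1,2], [2,3,4,1]} =
        fps_X * (3 * fps_X^3 - 9 * fps_X^2 + 6 * fps_X - 2) /
          ((1 - fps_X) * (3 * fps_X^3 - 5 * fps_X^2 + 4 * fps_X - 1))"
    unfolding gf_avoiding_312 by (rule fps_quotientI[OF gf_2341]) simp
  show "\<exists>(\<alpha>::real) (\<beta>::complex). \<beta> \<notin> \<real> \<and>
        {z::complex. 3 * z^3 - 5 * z^2 + 4 * z - 1 = 0} = {of_real \<alpha>, \<beta>, cnj \<beta>} \<and>
        (\<forall>n\<ge>1. of_nat (num_avoiding {[3,1,2], [2,3,4,1]} n) =
          - 2 + (1 / of_real \<alpha>) ^ n + (1 / \<beta>) ^ n + (1 / cnj \<beta>) ^ n)"
  proof -
    obtain \<alpha> :: real and \<beta> :: complex where r: "\<beta> \<notin> \<real>"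
      "{z :: complex. 3 * z ^ 3 - 5 * z ^ 2 + 4 * z - 1 = 0} = {of_real \<alpha>, \<beta>, cnj \<beta>}"
      "1 / of_real \<alpha> + 1 / \<beta> + 1 / cnj \<beta> = 4"
      "1 / of_real \<alpha> * (1 / \<beta>) + 1 / of_real \<alpha> * (1 / cnj \<beta>) + 1 / \<beta> * (1 / cnj \<beta>) = 5"
      "1 / of_real \<alpha> * (1 / \<beta>) * (1 / cnj \<beta>) = 3"
      using cubic_roots by blast
    show ?thesis
      by (intro exI[of _ \<alpha>] exI[of _ \<beta>] conjI allI impI r(1,2) num_2341_closed r(3-5))
  qed
  show "\<forall>q\<in>{[2,1,3,4], [2,1,4,3], [1,3,2,4], [1,4,3,2], [1,3,4,2]}.
        gf_avoiding {[3,1,2], q} = 2 * fps_X / (1 - 2 * fps_X) \<and>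
        (\<forall>n\<ge>1. num_avoiding {[3,1,2], q} n = 2 ^ n)"
    unfolding gf_avoiding_312
    by (intro ballI conjI allI impI fps_quotientI[OF gf_2_power] num_2_power) simp_all
  show "\<forall>k l. \<forall>p\<in>permutations_of_set {1..k}. \<forall>q\<in>permutations_of_set {1..l}. \<forall>n.
        num_avoiding {p, q} n = num_avoiding {rev p, rev q} n \<and>
        num_avoiding {p, q} n = num_avoiding {compl_pattern p, compl_pattern q} n"
    using num_avoiding_pair_symmetric by blast
  show "\<forall>p\<in>permutations_of_set {1..3} - {[1,2,3], [3,2,1]}. \<forall>q\<in>permutations_of_set {1..4}.
        \<exists>g\<in>{id, rev, compl_pattern, rev \<circ> compl_pattern}.
          g p = [3,1,2] \<and>
          (\<forall>n. num_avoiding {p, q} n = num_avoiding {[3,1,2], g q} n) \<and>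
          (g q \<in> tabulated_patterns \<or>
           perm_contains q p \<and> (\<forall>n. num_avoiding {p, q} n = num_avoiding {p} n))"
    by (intro ballI reduction_to_312)
qed

end
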